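(* Whenever $\mathrm{Aut}(F_3)$ acts by semisimple isometries on a complete $\mathrm{CAT}(0)$ space $X$, either each Nielsen transformation fixes a point of $X$, or else each Nielsen $\mathbb{Z}^4\subset\mathrm{Aut}(F_3)$ leaves invariant an isometrically embedded 3-flat $\mathbb{E}^3\hookrightarrow X$ on which it acts as a discrete group of translations with Dirichlet domain a rhombic dodecahedron.
   Context: $F_3$ is the free group with a fixed basis $\{a_1,a_2,a_3\}$. The Nielsen transformations are the automorphisms, for $i\neq j$, $\lambda_{ij}: a_i\mapsto a_ja_i,\ a_k\mapsto a_k\ (k\ne i)$ and $\rho_{ij}: a_i\mapsto a_ia_j,\ a_k\mapsto a_k\ (k\neq i)$. A Nielsen $\mathbb{Z}^4$ is a subgroup of $\mathrm{Aut}(F_3)$ conjugate to $\Lambda=\langle\lambda_{21},\rho_{21},\lambda_{31},\rho_{31}\rangle\cong\mathbb{Z}^4$. For an isometry $\gamma$ of a complete $\mathrm{CAT}(0)$ space $X$, put $\|\gamma\|=\inf\{d(x,\gamma.x)\mid x\in X\}$ and $\mathrm{Min}(\gamma)=\{x\in X\mid d(x,\gamma.x)=\|\gamma\|\}$. The isometry $\gamma$ is semisimple if $\mathrm{Min}(\gamma)\ne\emptyset$. An action is by semisimple isometries if every group element acts as a semisimple isometry. The action is not assumed to be discrete, and the action of a Nielsen $\mathbb{Z}^4$ on the 3-flat is not asserted to be faithful. $\mathbb{E}^3$ is Euclidean 3-space. For a discrete group of translations of $\mathbb{E}^3$ with translation lattice $A\subset\mathbb{R}^3$, the Dirichlet domain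 (about the origin) is $\{x\in\mathbb{R}^3\mid \|x\|\le\|x-a\|\text{ for all }a\in A\}$. The rhombic dodecahedron is, up to similarity, the convex hull in $\mathbb{R}^3$ of the six points $\pm e_1,\pm e_2,\pm e_3$ (with $e_i$ the standard basis vectors) and the eight points $(\pm\frac12,\pm\frac12,\pm\frac12)$. *)

theory Defs
  imports "HOL-Analysis.Analysis" "HOL-Algebra.Group_Action" "HOL-Algebra.Generated_Groups"
begin

section \<open>The free group on the elements of a type\<close>

text \<open>A letter \<open>(x, True)\<close> stands for the basis element \<open>x\<close>, and \<open>(x, False)\<close> for its inverse.
  The elements of the group are the reduced words.\<close>

type_synonym 'a letter_word = "('a \<times> bool) list"

definition flip :: "'a \<times> bool \<Rightarrow> 'a \<times> bool" where
  "flip l = (fst l, \<not> snd l)"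

definition reduced :: "'a letter_word \<Rightarrow> bool" where
  "reduced w \<longleftrightarrow> successively (\<lambda>l m. m \<noteq> flip l) w"

text \<open>Left multiplication of a reduced word by a single letter, with cancellation.\<close>

fun push :: "'a \<times> bool \<Rightarrow> 'a letter_word \<Rightarrow> 'a letter_word" where
  "push l [] = [l]"
| "push l (m # w) = (if m = flip l then w else l # m # w)"

definition free_group :: "'a letter_word monoid" where
  "free_group = \<lparr>carrier = {w. reduced w}, mult = (\<lambda>u v. foldr push u v), one = []\<rparr>"

definition basis_elt :: "'a \<Rightarrow> 'a letter_word" where
  "basis_elt x = [(x, True)]"

text \<open>The endomorphism of the free group that sends each basis element \<open>x\<close> to \<open>f x\<close>; as required
  by \<^const>\<open>Bij\<close> and \<^const>\<open>auto\<close>, it is undefined outside the carrier.\<close>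

definition endo_of :: "('a \<Rightarrow> 'a letter_word) \<Rightarrow> 'a letter_word \<Rightarrow> 'a letter_word" where
  "endo_of f = (\<lambda>w\<in>carrier free_group.
     foldr (\<lambda>l v. (if snd l then f (fst l) else inv\<^bsub>free_group\<^esub> f (fst l)) \<otimes>\<^bsub>free_group\<^esub> v)
       w \<one>\<^bsub>free_group\<^esub>)"

section \<open>Nielsen transformations of the free group of rank three\<close>

text \<open>The basis is indexed by the three-element type \<^typ>\<open>3\<close>, whose elements are
  \<open>1\<close>, \<open>2\<close> and \<open>3 = 0\<close>.\<close>

abbreviation F3 :: "3 letter_word monoid" where
  "F3 \<equiv> free_group"

abbreviation AutF3 :: "(3 letter_word \<Rightarrow> 3 letter_word) monoid" where
  "AutF3 \<equiv> AutoGroup F3"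

definition nielsen_left :: "3 \<Rightarrow> 3 \<Rightarrow> 3 letter_word \<Rightarrow> 3 letter_word" where
  "nielsen_left i j =
     endo_of (\<lambda>k. if k = i then basis_elt j \<otimes>\<^bsub>F3\<^esub> basis_elt i else basis_elt k)"

definition nielsen_right :: "3 \<Rightarrow> 3 \<Rightarrow> 3 letter_word \<Rightarrow> 3 letter_word" where
  "nielsen_right i j =
     endo_of (\<lambda>k. if k = i then basis_elt i \<otimes>\<^bsub>F3\<^esub> basis_elt j else basis_elt k)"

definition nielsen_transformations :: "(3 letter_word \<Rightarrow> 3 letter_word) set" where
  "nielsen_transformations =
     {nielsen_left i j | i j. i \<noteq> j} \<union> {nielsen_right i j | i j. i \<noteq> j}"

definition Lambda :: "(3 letter_word \<Rightarrow> 3 letter_word) set" where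
  "Lambda = generate AutF3
     {nielsen_left 2 1, nielsen_right 2 1, nielsen_left 3 1, nielsen_right 3 1}"

definition nielsen_Z4 :: "(3 letter_word \<Rightarrow> 3 letter_word) set \<Rightarrow> bool" where
  "nielsen_Z4 H \<longleftrightarrow> (\<exists>g\<in>carrier AutF3. H = g <#\<^bsub>AutF3\<^esub> Lambda #>\<^bsub>AutF3\<^esub> inv\<^bsub>AutF3\<^esub> g)"

subsection \<open>Well-definedness: a group, and automorphisms of it\<close>

lemma flip_flip [simp]: "flip (flip l) = l" by (simp add: flip_def)
lemma flip_neq [simp]: "flip l \<noteq> l" "l \<noteq> flip l" by (auto simp: flip_def prod_eq_iff)
lemma flip_eq_iff: "flip l = m \<longleftrightarrow> l = flip m" by auto

lemma reduced_push: "reduced w \<Longrightarrow> reduced (push l w)"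
  by (cases w) (auto simp: reduced_def successively_Cons)

lemma push_flip: "reduced w \<Longrightarrow> push l (push (flip l) w) = w"
  by (cases w rule: list.exhaust; cases "tl w") (auto simp: reduced_def successively_Cons flip_eq_iff)

lemma reduced_mult: "reduced v \<Longrightarrow> reduced (foldr push u v)"
  by (induction u) (auto intro: reduced_push)

lemma foldr_push_push:
  assumes "reduced v"
  shows "foldr push (push l u) v = push l (foldr push u v)"
proof (cases u)
  case (Cons m w)
  then show ?thesis using push_flip[OF reduced_mult[OF assms, of w], of l] by auto
qed simp

lemma foldr_push_assoc:
  assumes "reduced w"
  shows "foldr push (foldr push u v) w = foldr push u (foldr push v w)"
  by (induction u) (auto simp: foldr_push_push[OF assms])

lemma foldr_push_reduced: "reduced u \<Longrightarrow> foldr push u [] = u"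
proof (induction u)
  case (Cons l u)
  then show ?case by (cases u) (auto simp: reduced_def)
qed simp

lemma winv_left: "foldr push (rev (map flip w)) (foldr push w v) = v" if "reduced v"
  using that
proof (induction w arbitrary: v)
  case (Cons l w)
  have "push (flip l) (push l (foldr push w v)) = foldr push w v"
    using push_flip[OF reduced_mult[OF Cons.prems], of "flip l" w] by simp
  then show ?case using Cons by simp
qed simp

lemma group_free_group: "group (free_group :: 'a letter_word monoid)"
proof (rule groupI)
  fix x :: "'a letter_word" assume x: "x \<in> carrier free_group"
  have r: "reduced []" by (simp add: reduced_def)
  have "foldr push (foldr push (rev (map flip x)) []) x = []"
    using x foldr_push_assoc[of x "rev (map flip x)" "[]"] foldr_push_assoc[of x "rev (map flip x)" "[]"]
      winv_left[OF r, of x] foldr_push_reduced[of x] by (simp add: free_group_def)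
  then show "\<exists>y\<in>carrier free_group. y \<otimes>\<^bsub>free_group\<^esub> x = \<one>\<^bsub>free_group\<^esub>"
    by (intro bexI[of _ "foldr push (rev (map flip x)) []"]) (auto simp: free_group_def reduced_mult r)
qed (use reduced_mult foldr_push_assoc in \<open>auto simp: free_group_def\<close>, simp_all add: reduced_def)

interpretation FG: group "free_group :: 'a letter_word monoid" by (rule group_free_group)

abbreviation (input) letter_val where "letter_val f l \<equiv> (if snd l then f (fst l) else inv\<^bsub>free_group\<^esub> f (fst l))"
abbreviation (input) word_val where "word_val f w \<equiv> foldr (\<lambda>l v. letter_val f l \<otimes>\<^bsub>free_group\<^esub> v) w \<one>\<^bsub>free_group\<^esub>"

context fixes f :: "'a \<Rightarrow> 'a letter_word" assumes f: "\<And>x. f x \<in> carrier free_group" begin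

lemma letter_val_closed: "letter_val f l \<in> carrier free_group" using f by auto
lemma word_val_closed: "word_val f w \<in> carrier free_group" by (induction w) (use f in auto)

lemma word_val_push: "word_val f (push l w) = letter_val f l \<otimes>\<^bsub>free_group\<^esub> word_val f w"
proof (cases w)
  case (Cons m u)
  show ?thesis
  proof (cases "m = flip l")
    case True
    have "letter_val f l \<otimes>\<^bsub>free_group\<^esub> (letter_val f (flip l) \<otimes>\<^bsub>free_group\<^esub> word_val f u) = word_val f u"
      using f word_val_closed by (auto simp: flip_def FG.m_assoc[symmetric])
    then show ?thesis using True Cons by simp
  qed (simp add: Cons)
qed simp

lemma word_val_mult: "word_val f (foldr push u v) = word_val f u \<otimes>\<^bsub>free_group\<^esub> word_val f v"
  by (induction u) (use word_val_closed letter_val_closed in \<open>simp_all add: word_val_push FG.m_assoc f\<close>)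

lemma endo_hom: "endo_of f \<in> hom free_group free_group"
proof (rule homI)
  fix x assume "x \<in> carrier (free_group :: 'a letter_word monoid)" then show "endo_of f x \<in> carrier free_group"
    unfolding endo_of_def using word_val_closed by simp
next
  fix x y :: "'a letter_word" assume xy: "x \<in> carrier free_group" "y \<in> carrier free_group"
  moreover have m: "x \<otimes>\<^bsub>free_group\<^esub> y = foldr push x y" by (simp add: free_group_def)
  moreover have "foldr push x y \<in> carrier free_group" using xy FG.m_closed[of x y] m by simp
  ultimately show "endo_of f (x \<otimes>\<^bsub>free_group\<^esub> y) = endo_of f x \<otimes>\<^bsub>free_group\<^esub> endo_of f y"
    unfolding endo_of_def by (simp only: m restrict_apply' word_val_mult)
qed

lemma endo_basis: "endo_of f (basis_elt x) = f x"
  using f by (simp add: endo_of_def basis_elt_def free_group_def reduced_def FG.r_one[unfolded free_group_def, simplified])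

end

lemma basis_elt_closed [simp]: "basis_elt x \<in> carrier free_group"
  by (simp add: basis_elt_def free_group_def reduced_def)

lemma inv_basis: "inv\<^bsub>free_group\<^esub> (basis_elt x) = [(x,False)]"
  by (rule FG.inv_equality) (auto simp: basis_elt_def free_group_def reduced_def flip_def)

lemma hom_id:
  assumes h: "h \<in> hom free_group free_group" and b: "\<And>x::'a. h (basis_elt x) = basis_elt x"
  shows "w \<in> carrier free_group \<Longrightarrow> h w = w"
proof (induction w)
  interpret group_hom free_group free_group h
    by (simp add: group_hom_def group_hom_axioms_def h group_free_group)
  case Nil then show ?case using hom_one by (simp add: free_group_def)
next
  interpret group_hom free_group free_group h
    by (simp add: group_hom_def group_hom_axioms_def h group_free_group)
  case (Cons l w)
  have c: "[l] \<in> carrier free_group" by (simp add: free_group_def reduced_def)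
  have w: "w \<in> carrier free_group" using Cons.prems by (auto simp: free_group_def reduced_def successively_Cons)
  have e: "l # w = [l] \<otimes>\<^bsub>free_group\<^esub> w" using Cons.prems by (cases w) (auto simp: free_group_def reduced_def)
  have "h [l] = [l]"
  proof (cases l)
    case (Pair x s)
    show ?thesis using b[of x] hom_inv[of "basis_elt x"] inv_basis[of x]
      by (cases s) (auto simp: Pair basis_elt_def[symmetric])
  qed
  then show ?case using Cons.IH[OF w] e hom_mult[OF c w] by simp
qed

lemma auto_by_inverse:
  assumes h: "h \<in> hom free_group free_group" "k \<in> hom free_group free_group" "h \<in> extensional (carrier free_group)"
    and "\<And>x::'a. h (k (basis_elt x)) = basis_elt x" "\<And>x. k (h (basis_elt x)) = basis_elt x"
  shows "h \<in> auto free_group"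
proof -
  have a: "h \<circ> k \<in> hom free_group free_group" "k \<circ> h \<in> hom free_group free_group"
    using h by (auto simp: hom_def Pi_iff)
  have 1: "h (k w) = w" if "w \<in> carrier free_group" for w using hom_id[OF a(1) _ that] assms by simp
  have 2: "k (h w) = w" if "w \<in> carrier free_group" for w using hom_id[OF a(2) _ that] assms by simp
  have "bij_betw h (carrier free_group) (carrier free_group)"
    using h 1 2 by (intro bij_betwI[of _ _ _ k]) (auto simp: hom_def)
  then show ?thesis using h by (simp add: auto_def Bij_def)
qed

lemma endo_ext: "endo_of f \<in> extensional (carrier free_group)" by (simp add: endo_of_def)

lemma nielsen_left_auto: assumes "i \<noteq> j" shows "nielsen_left i j \<in> auto F3"
proof -
  let ?f = "\<lambda>k. if k = i then basis_elt j \<otimes>\<^bsub>F3\<^esub> basis_elt i else basis_elt k"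
  let ?g = "\<lambda>k. if k = i then inv\<^bsub>F3\<^esub> basis_elt j \<otimes>\<^bsub>F3\<^esub> basis_elt i else basis_elt k"
  have fc: "\<And>k. ?f k \<in> carrier F3" and gc: "\<And>k. ?g k \<in> carrier F3" by auto
  note F = endo_hom[of ?f, OF fc] and G = endo_hom[of ?g, OF gc]
  interpret f: group_hom F3 F3 "endo_of ?f" using F by (simp add: group_hom_def group_hom_axioms_def group_free_group)
  interpret g: group_hom F3 F3 "endo_of ?g" using G by (simp add: group_hom_def group_hom_axioms_def group_free_group)
  note fb = endo_basis[of ?f, OF fc] and gb = endo_basis[of ?g, OF gc]
  show ?thesis unfolding nielsen_left_def
    by (rule auto_by_inverse[OF F G endo_ext]) (use assms in \<open>simp_all add: fb gb FG.m_assoc[symmetric]\<close>)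
qed

lemma nielsen_right_auto: assumes "i \<noteq> j" shows "nielsen_right i j \<in> auto F3"
proof -
  let ?f = "\<lambda>k. if k = i then basis_elt i \<otimes>\<^bsub>F3\<^esub> basis_elt j else basis_elt k"
  let ?g = "\<lambda>k. if k = i then basis_elt i \<otimes>\<^bsub>F3\<^esub> inv\<^bsub>F3\<^esub> basis_elt j else basis_elt k"
  have fc: "\<And>k. ?f k \<in> carrier F3" and gc: "\<And>k. ?g k \<in> carrier F3" by auto
  note F = endo_hom[of ?f, OF fc] and G = endo_hom[of ?g, OF gc]
  interpret f: group_hom F3 F3 "endo_of ?f" using F by (simp add: group_hom_def group_hom_axioms_def group_free_group)
  interpret g: group_hom F3 F3 "endo_of ?g" using G by (simp add: group_hom_def group_hom_axioms_def group_free_group)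
  note fb = endo_basis[of ?f, OF fc] and gb = endo_basis[of ?g, OF gc]
  show ?thesis unfolding nielsen_right_def
    by (rule auto_by_inverse[OF F G endo_ext]) (use assms in \<open>simp_all add: fb gb FG.m_assoc\<close>)
qed

lemma group_AutF3: "group AutF3"
  by (rule FG.AutoGroup)

section \<open>CAT(0) spaces\<close>

definition geodesic_segment :: "'x::metric_space \<Rightarrow> 'x \<Rightarrow> 'x set \<Rightarrow> bool" where
  "geodesic_segment x y S \<longleftrightarrow>
     (\<exists>c::real \<Rightarrow> 'x. c 0 = x \<and> c (dist x y) = y \<and> S = c ` {0..dist x y} \<and>
        (\<forall>s\<in>{0..dist x y}. \<forall>t\<in>{0..dist x y}. dist (c s) (c t) = \<bar>s - t\<bar>))"

text \<open>Indices are taken in the type \<^typ>\<open>3\<close>, hence modulo 3: side \<open>i\<close> of a triangle with vertices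
  \<open>v\<close> joins \<open>v i\<close> to \<open>v (i + 1)\<close>. The points \<open>p'\<close> and \<open>q'\<close> are the comparison points of \<open>p\<close> and \<open>q\<close>
  in the comparison triangle \<open>v'\<close>.\<close>

definition CAT0 :: "'x::metric_space set \<Rightarrow> bool" where
  "CAT0 X \<longleftrightarrow>
     (\<forall>x\<in>X. \<forall>y\<in>X. \<exists>S\<subseteq>X. geodesic_segment x y S) \<and>
     (\<forall>(v::3 \<Rightarrow> 'x) (S::3 \<Rightarrow> 'x set) (v'::3 \<Rightarrow> real^2).
        (\<forall>i. v i \<in> X \<and> S i \<subseteq> X \<and> geodesic_segment (v i) (v (i + 1)) (S i)) \<and>
        (\<forall>i. dist (v' i) (v' (i + 1)) = dist (v i) (v (i + 1))) \<longrightarrow>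
        (\<forall>i j. \<forall>p\<in>S i. \<forall>q\<in>S j.
           \<forall>p'\<in>closed_segment (v' i) (v' (i + 1)). \<forall>q'\<in>closed_segment (v' j) (v' (j + 1)).
             dist (v' i) p' = dist (v i) p \<and> dist (v' j) q' = dist (v j) q \<longrightarrow>
             dist p q \<le> dist p' q'))"

section \<open>Semisimple isometries\<close>

definition isometry_of :: "'x::metric_space set \<Rightarrow> ('x \<Rightarrow> 'x) \<Rightarrow> bool" where
  "isometry_of X \<gamma> \<longleftrightarrow> bij_betw \<gamma> X X \<and> (\<forall>x\<in>X. \<forall>y\<in>X. dist (\<gamma> x) (\<gamma> y) = dist x y)"

definition translation_length :: "'x::metric_space set \<Rightarrow> ('x \<Rightarrow> 'x) \<Rightarrow> real" where
  "translation_length X \<gamma> = (INF x\<in>X. dist x (\<gamma> x))"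

definition min_set :: "'x::metric_space set \<Rightarrow> ('x \<Rightarrow> 'x) \<Rightarrow> 'x set" where
  "min_set X \<gamma> = {x\<in>X. dist x (\<gamma> x) = translation_length X \<gamma>}"

definition semisimple :: "'x::metric_space set \<Rightarrow> ('x \<Rightarrow> 'x) \<Rightarrow> bool" where
  "semisimple X \<gamma> \<longleftrightarrow> isometry_of X \<gamma> \<and> min_set X \<gamma> \<noteq> {}"

section \<open>Translations of a flat and the rhombic dodecahedron\<close>

definition translation_vectors ::
    "('g \<Rightarrow> 'x \<Rightarrow> 'x) \<Rightarrow> 'g set \<Rightarrow> (real^3 \<Rightarrow> 'x) \<Rightarrow> (real^3) set" where
  "translation_vectors \<phi> H e = {a. \<exists>h\<in>H. \<forall>u. \<phi> h (e u) = e (u + a)}"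

definition dirichlet_domain :: "(real^3) set \<Rightarrow> (real^3) set" where
  "dirichlet_domain A = {x. \<forall>a\<in>A. norm x \<le> norm (x - a)}"

definition standard_rhombic_dodecahedron :: "(real^3) set" where
  "standard_rhombic_dodecahedron =
     convex hull ({axis i 1 | i. True} \<union> {- axis i 1 | i. True} \<union> {x. \<forall>i. x $ i \<in> {1/2, -1/2}})"

definition rhombic_dodecahedron :: "(real^3) set \<Rightarrow> bool" where
  "rhombic_dodecahedron P \<longleftrightarrow>
     (\<exists>f r. r > 0 \<and> (\<forall>x y. dist (f x) (f y) = r * dist x y) \<and>
        P = f ` standard_rhombic_dodecahedron)"

end

theory Submission
  imports Defs
begin

text \<open>Write \<open>l\<^sub>i\<close> and \<open>r\<^sub>i\<close> for the left and right multiplication of the basis element \<open>i\<close> by the basis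
  element \<open>1\<close>, so that \<open>Lambda\<close> is generated by the commuting elements \<open>l\<^sub>2, r\<^sub>2, l\<^sub>3, r\<^sub>3\<close>. All Nielsen
  transformations are conjugate to each other up to inversion, hence have the same translation length
  \<open>L\<close>. If \<open>L = 0\<close>, they all fix points, because they are semisimple. Assume \<open>L > 0\<close>.

  A semisimple isometry translates each point of its minimal set along an axis, and moving along the
  axes is a flow by isometries. The minimal sets of the four generators have a common point
  (\<open>common_Min_nonempty\<close>), the four flows commute on the intersection, and together they give an
  action of \<open>\<real>\<^sup>4\<close> on it. A point is moved by \<open>v\<close> through a distance whose square is a quadratic form
  in \<open>v\<close>: along a flow line the function \<open>t \<mapsto> d(y, F\<^sub>t z)\<^sup>2 - L\<^sup>2 t\<^sup>2\<close> is convex by the CAT(0) inequality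
  and concave by the quadrilateral inequality, hence affine (\<open>flow_on_quadratic\<close>). This form is the
  Euclidean structure of the flat, and on integer vectors it is the squared translation length in
  \<open>X\<close> (\<open>flat_action_len\<close>), hence invariant under conjugation.

  It remains to compute the Gram matrix of the four generators in \<open>Aut(F\<^sub>3)\<close>. The coefficient of \<open>t\<close> in the quadratic
  law is a cocycle, which turns translation along the axes of \<open>d\<close> into a homomorphism from the
  centralizer of \<open>d\<close> to \<open>\<real>\<close>. It kills commutators, so an element that is a commutator in the
  centralizer of \<open>d\<close> is orthogonal to \<open>d\<close> (\<open>commutator_orthogonal\<close>).
  \<^item> In the centralizer of \<open>l\<^sub>i\<close> the element \<open>r\<^sub>i\<close> is a commutator, so \<open>l\<^sub>i\<close> and \<open>r\<^sub>i\<close> are orthogonal.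
  \<^item> Inverting the basis element \<open>i\<close> conjugates \<open>l\<^sub>i\<close> to the inverse of \<open>r\<^sub>i\<close> and fixes the other two
    generators, so with \<open>c = \<langle>l\<^sub>2, l\<^sub>3\<rangle>\<close> one has \<open>\<langle>r\<^sub>2, l\<^sub>3\<rangle> = \<langle>l\<^sub>2, r\<^sub>3\<rangle> = - c\<close> and \<open>\<langle>r\<^sub>2, r\<^sub>3\<rangle> = c\<close>.
  \<^item> Conjugation by the basis element \<open>1\<close> is \<open>l\<^sub>2 l\<^sub>3 (r\<^sub>2 r\<^sub>3)\<^sup>-\<^sup>1\<close>, and \<open>l\<^sub>2\<close> is a commutator in its
    centralizer. Orthogonality of the two says that \<open>L\<^sup>2 + 2 c = 0\<close>.

  With \<open>k = L / \<surd>2\<close> this is the Gram matrix of \<open>k(1,1,0), k(-1,1,0), k(-1,0,1), k(1,0,1)\<close>. These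
  vectors generate the face-centred cubic lattice, whose Dirichlet domain, given by the inequalities
  \<open>\<bar>x\<^sub>i\<bar> + \<bar>x\<^sub>j\<bar> \<le> k\<close>, is a rhombic dodecahedron.\<close>

section \<open>Comparison triangles\<close>

lemma comparison_triangle:
  fixes a b c :: real
  assumes "0 \<le> a" "0 \<le> b" "0 \<le> c" "a \<le> b + c" "b \<le> a + c" "c \<le> a + b"
  obtains P Q R :: "real^2" where "dist P Q = a" "dist P R = b" "dist Q R = c"
proof (cases "a = 0")
  case True
  then have "b = c" using assms by auto
  show ?thesis
    by (rule that[of 0 0 "b *\<^sub>R axis 1 1"]) (use True assms \<open>b = c\<close> in auto)
next
  case False
  then have a: "a > 0" using assms by auto
  \<comment> \<open>The first coordinate of the third vertex, by the law of cosines, when the side of length \<open>a\<close> lies on the first axis.\<close>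
  define u where "u = (a\<^sup>2 + b\<^sup>2 - c\<^sup>2) / (2 * a)"
  have ua: "2 * a * u = a\<^sup>2 + b\<^sup>2 - c\<^sup>2" using a by (simp add: u_def)
  have "\<bar>u\<bar> \<le> b"
  proof -
    have "(a - b)\<^sup>2 \<le> c\<^sup>2" "c\<^sup>2 \<le> (a + b)\<^sup>2"
      using assms by (auto intro!: power2_le_imp_le power_mono simp flip: abs_le_square_iff)
    then have "2 * a * u \<le> 2 * a * b" "2 * a * (- u) \<le> 2 * a * b"
      using ua by (auto simp: power2_eq_square algebra_simps)
    then have "u \<le> b" "- u \<le> b" using a mult_le_cancel_left_pos[of "2*a" u b] mult_le_cancel_left_pos[of "2*a" "- u" b]
      by linarith+
    then show ?thesis by auto
  qed
  then have ub: "u\<^sup>2 \<le> b\<^sup>2" using assms abs_le_square_iff[of u b] by auto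
  define w where "w = sqrt (b\<^sup>2 - u\<^sup>2)"
  have w: "w\<^sup>2 = b\<^sup>2 - u\<^sup>2" using ub by (simp add: w_def)
  let ?Q = "vector [a, 0] :: real^2" and ?R = "vector [u, w] :: real^2"
  have n: "norm v = sqrt ((v$1)\<^sup>2 + (v$2)\<^sup>2)" for v :: "real^2"
    by (simp add: norm_vec_def L2_set_def sum_2)
  have "dist 0 ?Q = a" using a by (simp add: n)
  moreover have "dist 0 ?R = b" using assms by (simp add: n w)
  moreover have "dist ?Q ?R = c"
  proof -
    have "(a - u)\<^sup>2 + w\<^sup>2 = c\<^sup>2" using w ua by (simp add: power2_eq_square algebra_simps)
    then show ?thesis using assms by (simp add: dist_norm n)
  qed
  ultimately show ?thesis using that by blast
qed

lemma euclidean_stewart: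
  fixes P Q R :: "'a::real_inner"
  shows "(dist R ((1 - t) *\<^sub>R P + t *\<^sub>R Q))\<^sup>2
       = (1 - t) * (dist R P)\<^sup>2 + t * (dist R Q)\<^sup>2 - t * (1 - t) * (dist P Q)\<^sup>2"
  unfolding dist_norm power2_norm_eq_inner
  by (simp add: inner_simps inner_commute algebra_simps)

text \<open>The form of the CAT(0) condition on which everything below rests: Stewart's theorem turned into an
  inequality. It compares \<open>z\<close> with the point that divides a geodesic from \<open>x\<close> to \<open>y\<close> in the ratio \<open>t : 1 - t\<close>,
  and it is the comparison condition for the triangle \<open>x, y, z\<close> when one of the two points is the vertex \<open>z\<close>.\<close>

lemma CAT0_CN:
  fixes X :: "'x::metric_space set"
  assumes "CAT0 X" "x \<in> X" "y \<in> X" "0 \<le> t" "t \<le> 1"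
  shows "\<exists>p\<in>X. \<forall>z\<in>X. (dist z p)\<^sup>2
           \<le> (1 - t) * (dist z x)\<^sup>2 + t * (dist z y)\<^sup>2 - t * (1 - t) * (dist x y)\<^sup>2"
proof -
  have geo: "\<exists>S\<subseteq>X. geodesic_segment x y S" if "x \<in> X" "y \<in> X" for x y
    using assms(1) that by (auto simp: CAT0_def)
  obtain S1 where S1: "S1 \<subseteq> X" "geodesic_segment x y S1" using geo assms by blast
  obtain c where c: "c 0 = x" "c (dist x y) = y" "S1 = c ` {0..dist x y}"
    "\<forall>s\<in>{0..dist x y}. \<forall>t\<in>{0..dist x y}. dist (c s) (c t) = \<bar>s - t\<bar>"
    using S1(2) unfolding geodesic_segment_def by auto
  define p where "p = c (t * dist x y)"
  have tin: "t * dist x y \<in> {0..dist x y}" using assms by (auto simp: mult_left_le_one_le)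
  have pS: "p \<in> S1" unfolding p_def c(3) using tin by (rule imageI)
  have xp: "dist x p = t * dist x y" 
    using c(4)[rule_format, of 0 "t * dist x y"] tin c(1) by (simp add: p_def)
  show ?thesis
  proof (intro bexI[of _ p] ballI)
    show "p \<in> X" using pS S1 by auto
    fix z assume z: "z \<in> X"
    obtain S2 where S2: "S2 \<subseteq> X" "geodesic_segment y z S2" using geo assms z by blast
    obtain S3 where S3: "S3 \<subseteq> X" "geodesic_segment z x S3" using geo assms z by blast
    obtain c2 where c2: "c2 (dist y z) = z" "S2 = c2 ` {0..dist y z}"
      using S2 unfolding geodesic_segment_def by auto
    have zS: "z \<in> S2" unfolding c2(2) by (rule image_eqI[of _ _ "dist y z"]) (use c2 in auto)
    obtain P Q R :: "real^2" where PQR: "dist P Q = dist x y" "dist P R = dist x z" "dist Q R = dist y z"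
      using comparison_triangle[of "dist x y" "dist x z" "dist y z"]
        dist_triangle2[of x y z] dist_triangle[of x z y] dist_triangle3[of y z x]
      by (auto simp: dist_commute)
    \<comment> \<open>The vertices \<open>1, 2, 3\<close> of the triangle are \<open>x, y, z\<close>, so that \<open>p\<close> is on side \<open>1\<close> and \<open>z\<close> is an end of side \<open>2\<close>.\<close>
    define v :: "3 \<Rightarrow> 'x" where "v = (\<lambda>i. if i = 1 then x else if i = 2 then y else z)"
    define S :: "3 \<Rightarrow> 'x set" where "S = (\<lambda>i. if i = 1 then S1 else if i = 2 then S2 else S3)"
    define v' :: "3 \<Rightarrow> real^2" where "v' = (\<lambda>i. if i = 1 then P else if i = 2 then Q else R)"
    have ar: "(1::3) + 1 = 2" "(2::3) + 1 = 3" "(3::3) + 1 = 1" "(2::3) \<noteq> 1" "(3::3) \<noteq> 1" "(3::3) \<noteq> 2"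
      by simp_all
    have h1: "\<forall>i. v i \<in> X \<and> S i \<subseteq> X \<and> geodesic_segment (v i) (v (i + 1)) (S i)"
      unfolding forall_3 ar(1,2,3) using assms z S1 S2 S3 ar(4-) by (simp add: v_def S_def)
    have h2: "\<forall>i. dist (v' i) (v' (i + 1)) = dist (v i) (v (i + 1))"
      unfolding forall_3 ar(1,2,3) using PQR ar(4-) by (simp add: v_def v'_def dist_commute)
    let ?p' = "(1 - t) *\<^sub>R P + t *\<^sub>R Q"
    have cmp: "dist p q \<le> dist p' q'" if "p \<in> S 1" "q \<in> S 2"
      "p' \<in> closed_segment (v' 1) (v' (1 + 1))" "q' \<in> closed_segment (v' 2) (v' (2 + 1))"
      "dist (v' 1) p' = dist (v 1) p" "dist (v' 2) q' = dist (v 2) q" for p q p' q'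
      using assms(1) h1 h2 that unfolding CAT0_def by blast
    have "dist p z \<le> dist ?p' R"
    proof (rule cmp)
      show "?p' \<in> closed_segment (v' 1) (v' (1 + 1))"
        unfolding ar(1) closed_segment_def using assms ar(4-) by (auto simp: v'_def)
      show "R \<in> closed_segment (v' 2) (v' (2 + 1))"
        unfolding ar(2) using ar(4-) by (simp add: v'_def)
      have "dist P ?p' = t * dist P Q"
      proof -
        have "P - ?p' = t *\<^sub>R (P - Q)" by (simp add: algebra_simps)
        then show ?thesis using assms by (simp add: dist_norm)
      qed
      then show "dist (v' 1) ?p' = dist (v 1) p" using xp PQR by (simp add: v_def v'_def)
      show "dist (v' 2) R = dist (v 2) z" using PQR ar by (simp add: v_def v'_def)
    qed (use pS zS ar in \<open>auto simp: S_def\<close>)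
    then have "(dist z p)\<^sup>2 \<le> (dist R ?p')\<^sup>2" by (simp add: dist_commute)
    then show "(dist z p)\<^sup>2 \<le> (1 - t) * (dist z x)\<^sup>2 + t * (dist z y)\<^sup>2 - t * (1 - t) * (dist x y)\<^sup>2"
      unfolding euclidean_stewart using PQR by (simp add: dist_commute)
  qed
qed

section \<open>Convexity in complete CAT(0) spaces\<close>

text \<open>Stewart's inequality and completeness carry the whole geometric part; geodesics appear through their division points.\<close>

locale hadamard =
  fixes X :: "'x::metric_space set"
  assumes complete: "complete X"
    and stewart: "\<And>x y t. x \<in> X \<Longrightarrow> y \<in> X \<Longrightarrow> 0 \<le> t \<Longrightarrow> t \<le> 1 \<Longrightarrow>
      \<exists>p\<in>X. \<forall>z\<in>X. (dist z p)\<^sup>2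
         \<le> (1 - t) * (dist z x)\<^sup>2 + t * (dist z y)\<^sup>2 - t * (1 - t) * (dist x y)\<^sup>2"
begin

lemma point_unique:
  assumes X: "x \<in> X" "y \<in> X" "p \<in> X" "q \<in> X" and t: "0 \<le> t" "t \<le> 1"
    and p: "dist x p = t * dist x y" "dist p y = (1 - t) * dist x y"
    and q: "\<And>z. z \<in> X \<Longrightarrow> (dist z q)\<^sup>2
         \<le> (1 - t) * (dist z x)\<^sup>2 + t * (dist z y)\<^sup>2 - t * (1 - t) * (dist x y)\<^sup>2"
  shows "p = q"
proof -
  have "(dist p q)\<^sup>2 \<le> (1 - t) * (t * dist x y)\<^sup>2 + t * ((1 - t) * dist x y)\<^sup>2 - t * (1 - t) * (dist x y)\<^sup>2"
    using q[OF X(3)] p by (simp add: dist_commute)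
  also have "\<dots> = 0" by (simp add: power2_eq_square algebra_simps)
  finally show ?thesis by simp
qed

lemma stewart_at:
  assumes X: "x \<in> X" "y \<in> X" "p \<in> X" "z \<in> X" and t: "0 \<le> t" "t \<le> 1"
    and p: "dist x p = t * dist x y" "dist p y = (1 - t) * dist x y"
  shows "(dist z p)\<^sup>2 \<le> (1 - t) * (dist z x)\<^sup>2 + t * (dist z y)\<^sup>2 - t * (1 - t) * (dist x y)\<^sup>2"
  using stewart[OF X(1,2) t] point_unique[OF X(1-3) _ t p] X(4) by metis

lemma point_between:
  assumes X: "x \<in> X" "y \<in> X" and t: "0 \<le> t" "t \<le> 1"
  obtains p where "p \<in> X" "dist x p = t * dist x y" "dist p y = (1 - t) * dist x y"
proof -
  obtain p where p: "p \<in> X" "\<And>z. z \<in> X \<Longrightarrow> (dist z p)\<^sup>2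
         \<le> (1 - t) * (dist z x)\<^sup>2 + t * (dist z y)\<^sup>2 - t * (1 - t) * (dist x y)\<^sup>2"
    using stewart[OF X t] by blast
  have "(dist x p)\<^sup>2 \<le> (t * dist x y)\<^sup>2" "(dist y p)\<^sup>2 \<le> ((1 - t) * dist x y)\<^sup>2"
    using p(2)[OF X(1)] p(2)[OF X(2)] by (simp_all add: dist_commute power2_eq_square algebra_simps)
  then have "dist x p \<le> t * dist x y" "dist y p \<le> (1 - t) * dist x y"
    using t by (auto intro: power2_le_imp_le)
  moreover have "dist x y \<le> dist x p + dist y p" by (rule dist_triangle2)
  moreover have "dist x y = t * dist x y + (1 - t) * dist x y" by (simp add: algebra_simps)
  ultimately have "dist x p = t * dist x y" "dist y p = (1 - t) * dist x y" by linarith+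
  then show ?thesis using that[OF p(1)] by (simp add: dist_commute)
qed

definition midpt :: "'x \<Rightarrow> 'x \<Rightarrow> 'x \<Rightarrow> bool" where
  "midpt x y m \<longleftrightarrow> m \<in> X \<and> dist x m = dist x y / 2 \<and> dist m y = dist x y / 2"

lemma midpt_dist_sq:
  assumes "midpt x y m" shows "(dist x m)\<^sup>2 = (dist x y)\<^sup>2 / 4"
proof -
  have "dist x m = dist x y / 2" using assms by (simp only: midpt_def)
  then show ?thesis by (simp only: power_divide) simp
qed

lemma midpt_exists:
  assumes "x \<in> X" "y \<in> X" obtains m where "midpt x y m"
  using point_between[OF assms, of "1/2"] by (auto simp: midpt_def)

lemma midpt_CN:
  assumes "x \<in> X" "y \<in> X" "z \<in> X" "midpt x y m"
  shows "(dist z m)\<^sup>2 \<le> (dist z x)\<^sup>2 / 2 + (dist z y)\<^sup>2 / 2 - (dist x y)\<^sup>2 / 4"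
  using stewart_at[of x y m z "1/2"] assms by (simp add: midpt_def)

text \<open>Apply the median inequality in the two triangles into which the diagonal \<open>ac\<close> cuts the quadrilateral, and
  bound \<open>bd\<close> by the way through the midpoint of \<open>ac\<close>. Equality characterizes parallelograms, and this
  is what forces flatness later.\<close>

lemma quadrilateral:
  assumes X: "a \<in> X" "b \<in> X" "c \<in> X" "d \<in> X"
  shows "(dist a c)\<^sup>2 + (dist b d)\<^sup>2 \<le> (dist a b)\<^sup>2 + (dist b c)\<^sup>2 + (dist c d)\<^sup>2 + (dist d a)\<^sup>2"
proof -
  obtain m where m: "midpt a c m" using midpt_exists[OF X(1,3)] .
  have "dist b d \<le> dist b m + dist d m" by (rule dist_triangle2)
  then have "(dist b d)\<^sup>2 \<le> (dist b m + dist d m)\<^sup>2" by simp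
  also have "\<dots> \<le> 2 * (dist b m)\<^sup>2 + 2 * (dist d m)\<^sup>2"
    using sum_squares_ge_zero[of "dist b m - dist d m" 0] by (simp add: power2_eq_square algebra_simps)
  finally show ?thesis using midpt_CN[OF X(1,3,2) m] midpt_CN[OF X(1,3,4) m]
    by (simp add: dist_commute)
qed

lemma dist_midpts_same_start:
  assumes X: "x \<in> X" "y \<in> X" "z \<in> X" and m: "midpt x y m" and n: "midpt x z n"
  shows "dist m n \<le> dist y z / 2"
proof -
  have mn: "m \<in> X" "n \<in> X" using m n by (auto simp: midpt_def)
  have "(dist m n)\<^sup>2 \<le> (dist m x)\<^sup>2 / 2 + (dist m z)\<^sup>2 / 2 - (dist x z)\<^sup>2 / 4"
    using midpt_CN[OF X(1,3) mn(1) n] .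
  moreover have "(dist z m)\<^sup>2 \<le> (dist z x)\<^sup>2 / 2 + (dist z y)\<^sup>2 / 2 - (dist x y)\<^sup>2 / 4"
    using midpt_CN[OF X m] .
  moreover have "(dist m x)\<^sup>2 = (dist x y)\<^sup>2 / 4"
    using midpt_dist_sq[OF m] by (simp add: dist_commute)
  ultimately have "(dist m n)\<^sup>2 \<le> (dist y z / 2)\<^sup>2"
    by (simp add: dist_commute power_divide)
  then show ?thesis by (rule power2_le_imp_le) simp
qed

lemma midpt_commute: "midpt x y m \<longleftrightarrow> midpt y x m"
  by (auto simp: midpt_def dist_commute)

text \<open>Convexity of the metric: insert the midpoint of the diagonal from \<open>x\<close> to \<open>y'\<close>.\<close>

lemma dist_midpts:
  assumes X: "x \<in> X" "y \<in> X" "x' \<in> X" "y' \<in> X" and m: "midpt x y m" and m': "midpt x' y' m'"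
  shows "dist m m' \<le> (dist x x' + dist y y') / 2"
proof -
  obtain n where n: "midpt x y' n" using midpt_exists[OF X(1,4)] .
  have "dist m n \<le> dist y y' / 2" using dist_midpts_same_start[OF X(1,2,4) m n] .
  moreover have "dist n m' \<le> dist x x' / 2"
    using dist_midpts_same_start[of y' x x' n m'] X n m' midpt_commute by blast
  ultimately have "dist m m' \<le> dist y y' / 2 + dist x x' / 2" using dist_triangle[of m m' n] by linarith
  then show ?thesis by simp
qed

text \<open>Closed under midpoints, which for complete sets is the same as convexity.\<close>

definition closed_convex :: "'x set \<Rightarrow> bool" where
  "closed_convex C \<longleftrightarrow> C \<subseteq> X \<and> complete C \<and> (\<forall>x\<in>C. \<forall>y\<in>C. \<forall>m. midpt x y m \<longrightarrow> m \<in> C)"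

text \<open>By the median inequality, two points of \<open>C\<close> that are almost as close to \<open>x\<close> as possible are close to each
  other, since their midpoint is in \<open>C\<close>. So a minimizing sequence is a Cauchy sequence.\<close>

lemma nearest_point_exists:
  assumes C: "closed_convex C" "C \<noteq> {}" and x: "x \<in> X"
  shows "\<exists>p\<in>C. \<forall>q\<in>C. dist x p \<le> dist x q"
proof -
  define D where "D = (INF q\<in>C. dist x q)"
  have bdd: "bdd_below ((\<lambda>q. dist x q) ` C)" by (rule bdd_belowI2[of _ 0]) auto
  have D: "D \<le> dist x q" if "q \<in> C" for q
    unfolding D_def using bdd that by (rule cINF_lower)
  have D0: "0 \<le> D" unfolding D_def using C by (intro cINF_greatest) auto
  have "\<exists>q\<in>C. dist x q < D + 1 / real (Suc n)" for n
  proof (rule ccontr)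
    assume "\<not> ?thesis"
    then have "D + 1 / real (Suc n) \<le> D" unfolding D_def using C by (intro cINF_greatest) auto
    moreover have "0 < 1 / real (Suc n)" by simp
    ultimately show False by linarith
  qed
  then obtain q where q: "\<And>n. q n \<in> C" "\<And>n. dist x (q n) < D + 1 / real (Suc n)" by metis
  have CX: "C \<subseteq> X" using C by (simp add: closed_convex_def)
  have gap: "(dist (q i) (q j))\<^sup>2 \<le> 4 * (2 * D + 1) / real (Suc n)" if ij: "n \<le> i" "n \<le> j" for i j n
  proof -
    let ?e = "1 / real (Suc n)"
    have e: "0 < ?e" "?e \<le> 1" by auto
    obtain m where m: "midpt (q i) (q j) m" using midpt_exists q(1) CX by (meson subsetD)
    then have "m \<in> C" using C(1) q(1) unfolding closed_convex_def by blast
    then have "D\<^sup>2 \<le> (dist x m)\<^sup>2" using D D0 by (simp add: power_mono)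
    also have "\<dots> \<le> (dist x (q i))\<^sup>2 / 2 + (dist x (q j))\<^sup>2 / 2 - (dist (q i) (q j))\<^sup>2 / 4"
      using midpt_CN[OF _ _ x m] q(1) CX by blast
    finally have 1: "(dist (q i) (q j))\<^sup>2 \<le> 2 * (dist x (q i))\<^sup>2 + 2 * (dist x (q j))\<^sup>2 - 4 * D\<^sup>2" by linarith
    have b: "(dist x (q k))\<^sup>2 \<le> (D + ?e)\<^sup>2" if "n \<le> k" for k
    proof (rule power_mono)
      have "1 / real (Suc k) \<le> ?e" using that by (simp add: frac_le)
      then show "dist x (q k) \<le> D + ?e" using q(2)[of k] by linarith
    qed simp
    have "(dist (q i) (q j))\<^sup>2 \<le> 4 * (D + ?e)\<^sup>2 - 4 * D\<^sup>2" using 1 b[OF ij(1)] b[OF ij(2)] by linarith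
    also have "\<dots> = 4 * ?e * (2 * D + ?e)" by (simp add: power2_eq_square algebra_simps)
    also have "\<dots> \<le> 4 * ?e * (2 * D + 1)" using e D0 by (intro mult_left_mono) auto
    finally show ?thesis by simp
  qed
  have "Cauchy q"
  proof (rule metric_CauchyI)
    fix e :: real assume e: "0 < e"
    obtain n where n: "4 * (2 * D + 1) / e\<^sup>2 < real (Suc n)"
    proof -
      obtain n where "4 * (2 * D + 1) / e\<^sup>2 < real n" using reals_Archimedean2 by blast
      then have "4 * (2 * D + 1) / e\<^sup>2 < real (Suc n)" by (rule order_less_trans) simp
      then show ?thesis using that by blast
    qed
    then have "4 * (2 * D + 1) / real (Suc n) < e\<^sup>2" using e by (simp add: field_simps)
    then have "dist (q i) (q j) < e" if "n \<le> i" "n \<le> j" for i j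
    proof -
      have "(dist (q i) (q j))\<^sup>2 < e\<^sup>2"
        using order_le_less_trans[OF gap[OF that] \<open>4 * (2 * D + 1) / real (Suc n) < e\<^sup>2\<close>] .
      then show ?thesis using e by (intro power_less_imp_less_base[of _ 2 e]) auto
    qed
    then show "\<exists>M. \<forall>m\<ge>M. \<forall>n\<ge>M. dist (q m) (q n) < e" by blast
  qed
  then obtain p where p: "p \<in> C" "q \<longlonglongrightarrow> p"
    using C(1) q(1) unfolding closed_convex_def complete_def by blast
  have "(\<lambda>n. dist x (q n)) \<longlonglongrightarrow> dist x p" using p by (intro tendsto_intros)
  moreover have "(\<lambda>n. D + 1 / real (Suc n)) \<longlonglongrightarrow> D + 0"
    using LIMSEQ_inverse_real_of_nat by (intro tendsto_intros) (simp add: inverse_eq_divide)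
  ultimately have "dist x p \<le> D + 0" using q(2) by (intro LIMSEQ_le) (auto intro: less_imp_le)
  then show ?thesis using p(1) D by (intro bexI[of _ p] ballI) (auto intro: order_trans)
qed

text \<open>The angle at the foot of the projection is at least a right angle. Comparing with the midpoint of \<open>p\<close> and
  \<open>q\<close> improves the inequality with constant \<open>c\<close> on \<open>(dist p q)\<^sup>2\<close> to the one with constant \<open>(1 + c) / 2\<close>, and
  the constants tend to \<open>1\<close>.\<close>

lemma nearest_point_pythagoras:
  assumes C: "closed_convex C" and x: "x \<in> X" and p: "p \<in> C" "\<forall>q\<in>C. dist x p \<le> dist x q" and q: "q \<in> C"
  shows "(dist x p)\<^sup>2 + (dist p q)\<^sup>2 \<le> (dist x q)\<^sup>2"
proof -
  have CX: "C \<subseteq> X" using C by (simp add: closed_convex_def)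
  have "(dist x p)\<^sup>2 + (1 - (1/2)^n) * (dist p q)\<^sup>2 \<le> (dist x q)\<^sup>2" for n
    using q
  proof (induction n arbitrary: q)
    case 0
    then show ?case using p by (simp add: power_mono)
  next
    case (Suc n q)
    obtain m where m: "midpt p q m" using midpt_exists p Suc.prems CX by (meson subsetD)
    then have "m \<in> C" using C p Suc.prems unfolding closed_convex_def by blast
    then have "(dist x p)\<^sup>2 + (1 - (1/2)^n) * (dist p m)\<^sup>2 \<le> (dist x m)\<^sup>2" by (rule Suc.IH)
    moreover have "(dist x m)\<^sup>2 \<le> (dist x p)\<^sup>2 / 2 + (dist x q)\<^sup>2 / 2 - (dist p q)\<^sup>2 / 4"
      using midpt_CN[OF _ _ x m] p Suc.prems CX by blast
    moreover have "(dist p m)\<^sup>2 = (dist p q)\<^sup>2 / 4" using midpt_dist_sq[OF m] .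
    moreover define A where "A = (1/2)^n * (dist p q)\<^sup>2"
    ultimately have "(dist x p)\<^sup>2 + ((dist p q)\<^sup>2 - A) / 4 \<le> (dist x m)\<^sup>2"
        "(dist x m)\<^sup>2 \<le> (dist x p)\<^sup>2 / 2 + (dist x q)\<^sup>2 / 2 - (dist p q)\<^sup>2 / 4"
      by (simp_all add: algebra_simps)
    moreover have "a + P - A / 2 \<le> b" if "a + (P - A) / 4 \<le> M" "M \<le> a / 2 + b / 2 - P / 4"
      for a b P M :: real using that by (simp add: field_simps)
    ultimately have "(dist x p)\<^sup>2 + (dist p q)\<^sup>2 - A / 2 \<le> (dist x q)\<^sup>2" by blast
    then show ?case by (simp add: A_def algebra_simps)
  qed
  moreover have "(\<lambda>n. (dist x p)\<^sup>2 + (1 - (1/2)^n) * (dist p q)\<^sup>2) \<longlonglongrightarrow> (dist x p)\<^sup>2 + (1 - 0) * (dist p q)\<^sup>2"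
    by (intro tendsto_intros LIMSEQ_realpow_zero) auto
  ultimately have "(dist x p)\<^sup>2 + (1 - 0) * (dist p q)\<^sup>2 \<le> (dist x q)\<^sup>2"
    by (intro LIMSEQ_le_const2) auto
  then show ?thesis by simp
qed

lemma nearest_point_nonexpansive:
  assumes C: "closed_convex C" and x: "x \<in> X" and p: "p \<in> C" "\<forall>r\<in>C. dist x p \<le> dist x r"
    and y: "y \<in> X" and q: "q \<in> C" "\<forall>r\<in>C. dist y q \<le> dist y r"
  shows "dist p q \<le> dist x y"
proof -
  have CX: "C \<subseteq> X" using C by (simp add: closed_convex_def)
  have "(dist x p)\<^sup>2 + (dist p q)\<^sup>2 \<le> (dist x q)\<^sup>2" "(dist y q)\<^sup>2 + (dist q p)\<^sup>2 \<le> (dist y p)\<^sup>2"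
    using nearest_point_pythagoras C x y p q by blast+
  moreover have "(dist x q)\<^sup>2 + (dist y p)\<^sup>2 \<le> (dist x y)\<^sup>2 + (dist y q)\<^sup>2 + (dist q p)\<^sup>2 + (dist p x)\<^sup>2"
    using quadrilateral[of x y q p] x y p q CX by blast
  ultimately have "(dist p q)\<^sup>2 \<le> (dist x y)\<^sup>2"
    unfolding dist_commute[of q p] dist_commute[of p x] by linarith
  then show ?thesis by (rule power2_le_imp_le) simp
qed

end

lemma CAT0_hadamard: "complete X \<Longrightarrow> CAT0 X \<Longrightarrow> hadamard X"
  by (intro hadamard.intro CAT0_CN)

section \<open>Groups of semisimple isometries\<close>

text \<open>Along an arithmetic progression the increments of a midpoint-convex function do not decrease, so one
  positive increment makes the function unbounded.\<close>

lemma midconvex_bounded_const: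
  fixes f :: "real \<Rightarrow> real"
  assumes conv: "\<And>s t. f ((s + t) / 2) \<le> (f s + f t) / 2" and bdd: "\<And>t. f t \<le> K"
  shows "f s = f t"
proof -
  have "f b \<le> f a" for a b
  proof (rule ccontr)
    assume "\<not> f b \<le> f a"
    then have d: "0 < f b - f a" by simp
    define u where "u n = f (a + real n * (b - a))" for n
    have inc: "f b - f a \<le> u (Suc n) - u n" for n
    proof (induction n)
      case 0 then show ?case by (simp add: u_def)
    next
      case (Suc n)
      have "a + real (Suc n) * (b - a) = ((a + real n * (b - a)) + (a + real (Suc (Suc n)) * (b - a))) / 2"
        by (simp add: algebra_simps)
      then have "u (Suc n) \<le> (u n + u (Suc (Suc n))) / 2"
        unfolding u_def using conv by metis
      then show ?case using Suc by (simp add: field_simps)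
    qed
    have grow: "real n * (f b - f a) + u 0 \<le> u n" for n
    proof (induction n)
      case (Suc n) then show ?case using inc[of n] by (simp add: algebra_simps)
    qed simp
    obtain n where "K - u 0 < real n * (f b - f a)" using reals_Archimedean3[OF d] by blast
    then show False using grow[of n] bdd[of "a + real n * (b - a)"] by (simp add: u_def)
  qed
  then show ?thesis by (meson order_antisym)
qed

lemma stewart_line:
  fixes a b n s :: real
  shows "(1 - s) * (n - a)\<^sup>2 + s * (b - n)\<^sup>2 - s * (1 - s) * (b - a)\<^sup>2 = ((1 - s) * a + s * b - n)\<^sup>2"
  by (simp add: power2_eq_square algebra_simps)

locale hadamard_action = hadamard X + group_action G X \<phi>
  for X :: "'x::metric_space set" and G (structure) and \<phi> +
  assumes isometric: "g \<in> carrier G \<Longrightarrow> x \<in> X \<Longrightarrow> y \<in> X \<Longrightarrow> dist (\<phi> g x) (\<phi> g y) = dist x y"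
    and min_set_nonempty: "g \<in> carrier G \<Longrightarrow> min_set X (\<phi> g) \<noteq> {}"
begin

sublocale group G by (rule group_hom.axioms(1)[OF group_hom])

abbreviation Min where "Min g \<equiv> min_set X (\<phi> g)"
abbreviation len where "len g \<equiv> translation_length X (\<phi> g)"

lemma act_closed [simp]: "g \<in> carrier G \<Longrightarrow> x \<in> X \<Longrightarrow> \<phi> g x \<in> X"
  using element_image by blast

lemma act_one [simp]: "x \<in> X \<Longrightarrow> \<phi> \<one> x = x"
  using id_eq_one by (metis restrict_apply')

lemma act_mult: "g \<in> carrier G \<Longrightarrow> h \<in> carrier G \<Longrightarrow> x \<in> X \<Longrightarrow> \<phi> (g \<otimes> h) x = \<phi> g (\<phi> h x)"
  by (rule composition_rule)

lemma act_inv [simp]: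
  assumes "g \<in> carrier G" "x \<in> X"
  shows "\<phi> (inv g) (\<phi> g x) = x" "\<phi> g (\<phi> (inv g) x) = x"
  using assms act_mult[of "inv g" g x] act_mult[of g "inv g" x] by simp_all

lemma act_commute:
  assumes "g \<in> carrier G" "h \<in> carrier G" "g \<otimes> h = h \<otimes> g" "x \<in> X"
  shows "\<phi> g (\<phi> h x) = \<phi> h (\<phi> g x)"
  using assms act_mult by metis

lemma len_le: "x \<in> X \<Longrightarrow> len g \<le> dist x (\<phi> g x)"
  unfolding translation_length_def by (intro cINF_lower bdd_belowI2[of _ 0]) auto

lemma X_nonempty: "X \<noteq> {}"
  using min_set_nonempty[of \<one>] by (auto simp: min_set_def)

lemma len_nonneg: "0 \<le> len g"
  unfolding translation_length_def using X_nonempty by (intro cINF_greatest) auto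

lemma Min_subset: "x \<in> Min g \<Longrightarrow> x \<in> X" by (simp add: min_set_def)

lemma Min_dist: "x \<in> Min g \<Longrightarrow> dist x (\<phi> g x) = len g" by (simp add: min_set_def)

lemma Min_iff: "x \<in> Min g \<longleftrightarrow> x \<in> X \<and> (\<forall>z\<in>X. dist x (\<phi> g x) \<le> dist z (\<phi> g z))"
proof
  assume R: "x \<in> X \<and> (\<forall>z\<in>X. dist x (\<phi> g x) \<le> dist z (\<phi> g z))"
  then have "dist x (\<phi> g x) \<le> len g" unfolding translation_length_def by (intro cINF_greatest) auto
  then show "x \<in> Min g" using R len_le[of x g] by (simp add: min_set_def)
qed (auto simp: min_set_def len_le)

lemma midpt_act:
  assumes "g \<in> carrier G" "x \<in> X" "y \<in> X" "midpt x y m"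
  shows "midpt (\<phi> g x) (\<phi> g y) (\<phi> g m)"
  using assms by (simp add: midpt_def isometric)

lemma closed_convex_Min:
  assumes g: "g \<in> carrier G" shows "closed_convex (Min g)"
  unfolding closed_convex_def
proof (intro conjI ballI allI impI)
  show "Min g \<subseteq> X" by (auto simp: min_set_def)
  show "complete (Min g)" unfolding complete_def
  proof (intro allI impI, elim conjE)
    fix u :: "nat \<Rightarrow> 'x" assume u: "\<forall>n. u n \<in> Min g" "Cauchy u"
    then have uX: "u n \<in> X" for n by (simp add: min_set_def)
    then obtain l where l: "l \<in> X" "u \<longlonglongrightarrow> l" using complete u unfolding complete_def by blast
    have "dist l (\<phi> g l) \<le> 2 * dist l (u n) + len g" for n
      using dist_triangle[of l "\<phi> g l" "u n"] dist_triangle[of "u n" "\<phi> g l" "\<phi> g (u n)"]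
        isometric[OF g l(1) uX[of n]] Min_dist[of "u n" g] u(1) by (simp add: dist_commute)
    moreover have "(\<lambda>n. 2 * dist l (u n) + len g) \<longlonglongrightarrow> 2 * dist l l + len g"
      using l by (intro tendsto_intros)
    ultimately have "dist l (\<phi> g l) \<le> 2 * dist l l + len g"
      by (intro LIMSEQ_le_const) auto
    then have "l \<in> Min g" using l len_le[of l g] by (simp add: min_set_def)
    then show "\<exists>l\<in>Min g. u \<longlonglongrightarrow> l" using l by blast
  qed
next
  fix x y m assume xy: "x \<in> Min g" "y \<in> Min g" and m: "midpt x y m"
  have "dist m (\<phi> g m) \<le> (dist x (\<phi> g x) + dist y (\<phi> g y)) / 2"
    using xy m g by (intro dist_midpts midpt_act) (auto dest: Min_subset)
  moreover have "m \<in> X" using m by (simp add: midpt_def)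
  ultimately show "m \<in> Min g" using len_le[of m g] xy by (simp add: min_set_def)
qed

lemma Min_commute:
  assumes "g \<in> carrier G" "h \<in> carrier G" "g \<otimes> h = h \<otimes> g" "x \<in> Min g"
  shows "\<phi> h x \<in> Min g"
  using assms Min_subset[OF assms(4)] Min_dist[OF assms(4)] act_commute[OF assms(1-3)]
  by (simp add: min_set_def isometric)

text \<open>The projection to an invariant set \<open>C\<close> commutes with \<open>g\<close> and does not increase distances, so it maps a point of
  \<open>Min g\<close> to a point that \<open>g\<close> moves no further.\<close>

lemma closed_convex_meets_Min:
  assumes C: "closed_convex C" "C \<noteq> {}" and g: "g \<in> carrier G"
    and inv: "\<And>x. x \<in> C \<Longrightarrow> \<phi> g x \<in> C" "\<And>x. x \<in> C \<Longrightarrow> \<phi> (inv g) x \<in> C"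
  shows "C \<inter> Min g \<noteq> {}"
proof -
  have CX: "C \<subseteq> X" using C by (simp add: closed_convex_def)
  obtain z where z: "z \<in> Min g" using min_set_nonempty[OF g] by blast
  then have zX: "z \<in> X" by (rule Min_subset)
  obtain p where p: "p \<in> C" "\<forall>q\<in>C. dist z p \<le> dist z q"
    using nearest_point_exists[OF C zX] by blast
  have "\<forall>q\<in>C. dist (\<phi> g z) (\<phi> g p) \<le> dist (\<phi> g z) q"
  proof
    fix q assume q: "q \<in> C"
    have "dist (\<phi> g z) (\<phi> g p) = dist z p" using isometric g zX p CX by blast
    also have "\<dots> \<le> dist z (\<phi> (inv g) q)" using p inv q by blast
    also have "\<dots> = dist (\<phi> g z) (\<phi> g (\<phi> (inv g) q))"
      using isometric[OF g zX, of "\<phi> (inv g) q"] g q CX by auto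
    also have "\<dots> = dist (\<phi> g z) q" using g q CX by auto
    finally show "dist (\<phi> g z) (\<phi> g p) \<le> dist (\<phi> g z) q" .
  qed
  then have "dist p (\<phi> g p) \<le> dist z (\<phi> g z)"
    using nearest_point_nonexpansive[OF C(1) zX p, of "\<phi> g z" "\<phi> g p"] g zX inv p by auto
  then have "p \<in> Min g" using z p CX len_le[of p g] by (auto simp: min_set_def)
  then show ?thesis using p by blast
qed

text \<open>The points of \<open>X\<close> are taken explicitly, so that the empty family gives \<open>X\<close>.\<close>

definition common_Min where "common_Min S = {x \<in> X. \<forall>g\<in>S. x \<in> Min g}"

lemma closed_convex_common_Min:
  assumes "S \<subseteq> carrier G" shows "closed_convex (common_Min S)"
proof -
  have "complete (common_Min S)"
    unfolding complete_def
  proof (intro allI impI, elim conjE)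
    fix u :: "nat \<Rightarrow> 'x" assume u: "\<forall>n. u n \<in> common_Min S" "Cauchy u"
    then obtain l where l: "l \<in> X" "u \<longlonglongrightarrow> l" 
      using complete unfolding complete_def common_Min_def by blast
    have "l \<in> Min g" if "g \<in> S" for g
    proof -
      have "complete (Min g)" using closed_convex_Min that assms unfolding closed_convex_def by blast
      moreover have "\<forall>n. u n \<in> Min g" using u(1) that by (simp add: common_Min_def)
      ultimately obtain l' where "l' \<in> Min g" "u \<longlonglongrightarrow> l'" using u(2) unfolding complete_def by blast
      then show ?thesis using l LIMSEQ_unique by blast
    qed
    then show "\<exists>l\<in>common_Min S. u \<longlonglongrightarrow> l" using l by (auto simp: common_Min_def)
  qed
  moreover have "m \<in> common_Min S" if "x \<in> common_Min S" "y \<in> common_Min S" "midpt x y m" for x y m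
  proof -
    have "m \<in> Min g" if "g \<in> S" for g
    proof -
      have "closed_convex (Min g)" "x \<in> Min g" "y \<in> Min g"
        using closed_convex_Min that assms \<open>x \<in> common_Min S\<close> \<open>y \<in> common_Min S\<close>
        by (auto simp: common_Min_def)
      then show ?thesis using \<open>midpt x y m\<close> unfolding closed_convex_def by blast
    qed
    then show ?thesis using \<open>midpt x y m\<close> by (simp add: midpt_def common_Min_def)
  qed
  moreover have "common_Min S \<subseteq> X" unfolding common_Min_def by blast
  ultimately show ?thesis unfolding closed_convex_def by blast
qed

lemma common_Min_nonempty:
  assumes "finite S" "S \<subseteq> carrier G" "\<And>g h. g \<in> S \<Longrightarrow> h \<in> S \<Longrightarrow> g \<otimes> h = h \<otimes> g"
  shows "common_Min S \<noteq> {}"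
  using assms
proof (induction S)
  case empty
  then show ?case using X_nonempty by (auto simp: common_Min_def)
next
  case (insert g S)
  have g: "g \<in> carrier G" and S: "S \<subseteq> carrier G" using insert.prems by auto
  have "common_Min S \<inter> Min g \<noteq> {}"
  proof (rule closed_convex_meets_Min[OF closed_convex_common_Min[OF S] _ g])
    show "common_Min S \<noteq> {}" using insert.IH insert.prems by auto
    have c: "h \<otimes> g = g \<otimes> h" "h \<in> carrier G" if "h \<in> S" for h using insert.prems that by auto
    have ci: "h \<otimes> inv g = inv g \<otimes> h" if "h \<in> S" for h
      using c[OF that] g by (metis inv_closed inv_solve_left inv_solve_right' m_assoc m_closed)
    show "\<phi> g x \<in> common_Min S" "\<phi> (inv g) x \<in> common_Min S" if "x \<in> common_Min S" for x
      using that Min_commute[OF c(2) g c(1)] Min_commute[OF c(2) inv_closed[OF g] ci] g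
      by (auto simp: common_Min_def)
  qed
  then show ?case by (auto simp: common_Min_def)
qed

text \<open>If \<open>m\<close> is the midpoint of \<open>z\<close> and \<open>g z\<close>, then \<open>g m\<close> is the midpoint of \<open>g z\<close> and \<open>g\<^sup>2 z\<close>, so that
  \<open>len g \<le> d(m, g m) \<le> d(z, g\<^sup>2 z) / 2\<close>. Doubling in this way is what makes the orbits of points of
  \<open>Min g\<close> lie on geodesic lines.\<close>

lemma Min_square:
  assumes g: "g \<in> carrier G" and x: "x \<in> Min g"
  shows "x \<in> Min (g \<otimes> g)" "len (g \<otimes> g) = 2 * len g"
proof -
  have X: "x \<in> X" using x by (rule Min_subset)
  have low: "2 * len g \<le> dist z (\<phi> (g \<otimes> g) z)" if z: "z \<in> X" for z
  proof -
    obtain m where m: "midpt z (\<phi> g z) m" using midpt_exists z g act_closed by blast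
    have "dist m (\<phi> g m) \<le> dist z (\<phi> g (\<phi> g z)) / 2"
      using z g m midpt_act[OF g z _ m] midpt_commute
      by (intro dist_midpts_same_start[of "\<phi> g z"]) auto
    moreover have "m \<in> X" using m by (simp add: midpt_def)
    ultimately show ?thesis using len_le[of m g] act_mult[OF g g z] by simp
  qed
  have up: "dist x (\<phi> (g \<otimes> g) x) \<le> 2 * len g"
    using dist_triangle[of x "\<phi> g (\<phi> g x)" "\<phi> g x"] isometric[OF g X, of "\<phi> g x"] Min_dist[OF x]
      act_mult[OF g g X] g X by simp
  show 1: "x \<in> Min (g \<otimes> g)" unfolding Min_iff using X low up by force
  show "len (g \<otimes> g) = 2 * len g" using low[OF X] up Min_dist[OF 1] by simp
qed

lemma Min_two_power:
  assumes g: "g \<in> carrier G" and x: "x \<in> Min g"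
  shows "x \<in> Min (g [^] (2 ^ k :: nat)) \<and> len (g [^] (2 ^ k :: nat)) = 2 ^ k * len g"
proof (induction k)
  case (Suc k)
  have "g [^] (2 ^ Suc k :: nat) = g [^] (2 ^ k :: nat) \<otimes> g [^] (2 ^ k :: nat)"
    using g by (simp add: nat_pow_mult mult_2)
  then show ?case using Min_square[of "g [^] (2 ^ k :: nat)" x] g Suc by simp
qed (use g x in simp)

lemma dist_nat_pow_le:
  assumes g: "g \<in> carrier G" and x: "x \<in> X"
  shows "dist x (\<phi> (g [^] (n::nat)) x) \<le> real n * dist x (\<phi> g x)"
proof (induction n)
  case (Suc n)
  have "\<phi> (g [^] Suc n) x = \<phi> (g [^] n) (\<phi> g x)" using act_mult g x by simp
  then have "dist (\<phi> (g [^] n) x) (\<phi> (g [^] Suc n) x) = dist x (\<phi> g x)"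
    using isometric[of "g [^] n" x "\<phi> g x"] g x by simp
  then show ?case using Suc dist_triangle[of x "\<phi> (g [^] Suc n) x" "\<phi> (g [^] n) x"]
    by (simp add: algebra_simps)
qed (use x in simp)

lemma dist_nat_pow:
  assumes g: "g \<in> carrier G" and x: "x \<in> Min g"
  shows "dist x (\<phi> (g [^] (n::nat)) x) = real n * len g"
proof (rule antisym)
  have X: "x \<in> X" using x by (rule Min_subset)
  note le = dist_nat_pow_le[OF g X, unfolded Min_dist[OF x]]
  show "dist x (\<phi> (g [^] n) x) \<le> real n * len g" by (rule le)
  \<comment> \<open>The distance is known for powers of two; if it were too small for \<open>n\<close>, it would be too small for \<open>2 ^ n\<close>.\<close>
  have n2: "n \<le> 2 ^ n" by simp
  have "\<phi> (g [^] (2 ^ n :: nat)) x = \<phi> (g [^] n) (\<phi> (g [^] (2 ^ n - n)) x)"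
    using act_mult[of "g [^] n" "g [^] (2 ^ n - n)" x] g X n2 by (simp add: nat_pow_mult)
  then have "dist (\<phi> (g [^] n) x) (\<phi> (g [^] (2 ^ n :: nat)) x) = dist x (\<phi> (g [^] (2 ^ n - n)) x)"
    using isometric[of "g [^] n" x] g X by simp
  also have "\<dots> \<le> real (2 ^ n - n) * len g" by (rule le)
  finally have 1: "dist (\<phi> (g [^] n) x) (\<phi> (g [^] (2 ^ n :: nat)) x) \<le> (2 ^ n - real n) * len g"
    using n2 by (simp add: of_nat_diff)
  have "2 ^ n * len g = dist x (\<phi> (g [^] (2 ^ n :: nat)) x)"
    using Min_two_power[OF g x, of n] Min_dist by metis
  also have "\<dots> \<le> dist x (\<phi> (g [^] n) x) + dist (\<phi> (g [^] n) x) (\<phi> (g [^] (2 ^ n :: nat)) x)"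
    by (rule dist_triangle)
  finally show "real n * len g \<le> dist x (\<phi> (g [^] n) x)" using 1 by (simp add: algebra_simps)
qed

lemma dist_int_pow:
  assumes g: "g \<in> carrier G" and x: "x \<in> Min g"
  shows "dist (\<phi> (g [^] (i::int)) x) (\<phi> (g [^] (j::int)) x) = len g * \<bar>real_of_int i - real_of_int j\<bar>"
proof -
  have *: "dist (\<phi> (g [^] i) x) (\<phi> (g [^] j) x) = len g * \<bar>real_of_int i - real_of_int j\<bar>" if "i \<le> j" for i j :: int
  proof -
    obtain n where j: "j = i + int n" using \<open>i \<le> j\<close> zle_iff_zadd by blast
    have X: "x \<in> X" using x by (rule Min_subset)
    have "\<phi> (g [^] j) x = \<phi> (g [^] i) (\<phi> (g [^] n) x)"
      using act_mult[of "g [^] i" "g [^] int n" x] g X by (simp add: j int_pow_mult int_pow_int)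
    then show ?thesis using isometric[of "g [^] i" x "\<phi> (g [^] n) x"] dist_nat_pow[OF g x, of n] g X j
      by simp
  qed
  show ?thesis
  proof (cases "i \<le> j")
    case False
    then show ?thesis using *[of j i] by (simp add: dist_commute abs_minus_commute)
  qed (rule *)
qed

end

section \<open>Translation along the axes of an isometry\<close>

context hadamard_action
begin

lemma commute_inv:
  assumes "a \<in> carrier G" "b \<in> carrier G" "a \<otimes> b = b \<otimes> a"
  shows "inv a \<otimes> b = b \<otimes> inv a"
  using assms by (metis inv_closed inv_solve_left inv_solve_right' m_assoc m_closed)

lemma commute_int_pow:
  assumes "a \<in> carrier G" "b \<in> carrier G" "a \<otimes> b = b \<otimes> a"
  shows "a [^] (n::int) \<otimes> b = b \<otimes> a [^] n"
proof (cases n rule: int_cases2)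
  case (nonneg k)
  then show ?thesis using assms group_commutes_pow by (simp add: int_pow_int)
next
  case (nonpos k)
  have "a [^] k \<otimes> b = b \<otimes> a [^] k" using assms group_commutes_pow by blast
  then show ?thesis using assms nonpos commute_inv[of "a [^] k" b] by (simp add: int_pow_neg int_pow_int)
qed

text \<open>The point with parameter \<open>t\<close> on the axis of \<open>g\<close> through \<open>x\<close>, parametrized so that \<open>g\<close> adds \<open>1\<close>. It is described
  by its distances to the orbit of \<open>x\<close>, a condition which is visibly natural under isometries that commute
  with \<open>g\<close>. For \<open>len g = 0\<close> it says that \<open>p = x\<close>.\<close>

definition on_axis where
  "on_axis g (t::real) x p \<longleftrightarrow> p \<in> X \<and> (\<forall>n. dist (\<phi> (g [^] (n::int)) x) p = len g * \<bar>t - real_of_int n\<bar>)"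

lemma on_axis_stewart:
  assumes g: "g \<in> carrier G" and x: "x \<in> Min g" and p: "on_axis g t x p" and z: "z \<in> X"
    and ab: "real_of_int a \<le> t" "t \<le> real_of_int b" "a < b"
  defines "s \<equiv> (t - a) / (b - a)"
  shows "(dist z p)\<^sup>2 \<le> (1 - s) * (dist z (\<phi> (g [^] a) x))\<^sup>2 + s * (dist z (\<phi> (g [^] b) x))\<^sup>2
    - s * (1 - s) * (len g * (b - a))\<^sup>2"
proof -
  let ?a = "\<phi> (g [^] a) x" and ?b = "\<phi> (g [^] b) x"
  have X: "x \<in> X" using x by (rule Min_subset)
  have ba: "real_of_int b - real_of_int a > 0" using ab by simp
  have ab': "dist ?a ?b = len g * (b - a)"
    using dist_int_pow[OF g x, of a b] ab by simp
  have s: "0 \<le> s" "s \<le> 1" using ab ba by (auto simp: s_def field_simps)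
  have sa: "t - a = s * (b - a)" using ba by (simp add: s_def)
  then have sb: "b - t = (1 - s) * (b - a)" by (simp add: algebra_simps)
  have "dist ?a p = len g * (t - a)" "dist p ?b = len g * (b - t)"
    using p ab by (auto simp: on_axis_def dist_commute)
  then have "dist ?a p = s * dist ?a ?b" "dist p ?b = (1 - s) * dist ?a ?b"
    unfolding ab' sa sb by simp_all
  then show ?thesis
    using stewart_at[of ?a ?b p z s] s z X g p unfolding ab' by (auto simp: on_axis_def)
qed

text \<open>Stewart's inequality for a subdivided segment of the axis, with the distances that hold in the real line, gives
  the upper bound; the triangle inequality through orbit points on either side gives the lower one. For \<open>t = u\<close> this is the uniqueness
  of the point with a given parameter.\<close>

lemma on_axis_dist:
  assumes g: "g \<in> carrier G" and x: "x \<in> Min g" and p: "on_axis g t x p" and q: "on_axis g u x q"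
  shows "dist p q = len g * \<bar>t - u\<bar>"
proof -
  have X: "x \<in> X" "p \<in> X" "q \<in> X" using x p q by (auto simp: on_axis_def dest: Min_subset)
  have le: "dist p q \<le> len g * \<bar>t - u\<bar>"
  proof -
    define a b where "a = \<lfloor>t\<rfloor>" and "b = \<lfloor>t\<rfloor> + 1"
    define s where "s = (t - a) / (real_of_int b - real_of_int a)"
    have ab: "real_of_int a \<le> t" "t \<le> real_of_int b" "a < b" unfolding a_def b_def by linarith+
    have st: "(1 - s) * a + s * b = t" by (simp add: s_def a_def b_def algebra_simps)
    have "dist q (\<phi> (g [^] a) x) = len g * \<bar>u - a\<bar>" "dist q (\<phi> (g [^] b) x) = len g * \<bar>u - b\<bar>"
      using q by (auto simp: on_axis_def dist_commute)
    then have "(dist q p)\<^sup>2 \<le> (1 - s) * (len g * \<bar>u - a\<bar>)\<^sup>2 + s * (len g * \<bar>u - b\<bar>)\<^sup>2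
        - s * (1 - s) * (len g * (b - a))\<^sup>2"
      using on_axis_stewart[OF g x p X(3) ab] by (simp add: s_def)
    also have "\<dots> = (len g)\<^sup>2 * ((1 - s) * (u - a)\<^sup>2 + s * (b - u)\<^sup>2 - s * (1 - s) * (b - a)\<^sup>2)"
      unfolding power_mult_distrib power2_abs power2_commute[of u "real_of_int b"]
      by (simp add: algebra_simps)
    also have "\<dots> = (len g * \<bar>t - u\<bar>)\<^sup>2"
      using stewart_line[of s u "real_of_int a" "real_of_int b"] unfolding st by (simp add: power_mult_distrib)
    finally have "dist q p \<le> len g * \<bar>t - u\<bar>"
      by (rule power2_le_imp_le) (simp add: len_nonneg)
    then show ?thesis by (simp add: dist_commute)
  qed
  have ge: "len g * (u - t) \<le> dist p q"
    if tu: "t \<le> u" and p: "on_axis g t x p" and q: "on_axis g u x q" for t u p q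
  proof -
    define a b where "a = \<lfloor>t\<rfloor>" and "b = \<lceil>u\<rceil>"
    have ab: "a \<le> t" "u \<le> b" "a \<le> b" using tu unfolding a_def b_def by linarith+
    have "dist (\<phi> (g [^] a) x) p = len g * (t - a)" "dist (\<phi> (g [^] b) x) q = len g * (b - u)"
      using p q ab by (auto simp: on_axis_def)
    moreover have "dist (\<phi> (g [^] a) x) (\<phi> (g [^] b) x) = len g * (b - a)"
      using dist_int_pow[OF g x, of a b] ab by simp
    ultimately show ?thesis
      using dist_triangle[of "\<phi> (g [^] a) x" "\<phi> (g [^] b) x" p]
        dist_triangle[of p "\<phi> (g [^] b) x" q] by (simp add: dist_commute algebra_simps)
  qed
  show ?thesis
  proof (cases "t \<le> u")
    case True then show ?thesis using le ge[OF True p q] by simp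
  next
    case False then show ?thesis using le ge[OF _ q p] by (simp add: dist_commute)
  qed
qed

lemma on_axis_exists:
  assumes g: "g \<in> carrier G" and x: "x \<in> Min g"
  shows "\<exists>p. on_axis g t x p"
proof -
  define a b where "a = \<lfloor>t\<rfloor>" and "b = \<lfloor>t\<rfloor> + 1"
  define s where "s = t - a"
  have X: "x \<in> X" using x by (rule Min_subset)
  have s: "0 \<le> s" "s \<le> 1" unfolding s_def a_def by linarith+
  have st: "(1 - s) * a + s * b = t" by (simp add: s_def a_def b_def algebra_simps)
  let ?a = "\<phi> (g [^] a) x" and ?b = "\<phi> (g [^] b) x"
  obtain p where p: "p \<in> X" "dist ?a p = s * dist ?a ?b" "dist p ?b = (1 - s) * dist ?a ?b"
    using point_between[of ?a ?b s] s X g by auto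
  have le: "dist (\<phi> (g [^] n) x) p \<le> len g * \<bar>t - n\<bar>" for n :: int
  proof -
    let ?n = "\<phi> (g [^] n) x"
    have "(dist ?n p)\<^sup>2 \<le> (1 - s) * (dist ?n ?a)\<^sup>2 + s * (dist ?n ?b)\<^sup>2 - s * (1 - s) * (dist ?a ?b)\<^sup>2"
      using stewart_at[of ?a ?b p ?n s] s p X g by simp
    also have "\<dots> = (len g)\<^sup>2 * ((1 - s) * (n - a)\<^sup>2 + s * (b - n)\<^sup>2 - s * (1 - s) * (b - a)\<^sup>2)"
      unfolding dist_int_pow[OF g x] power_mult_distrib power2_abs power2_commute[of "real_of_int n" "real_of_int b"]
        power2_commute[of "real_of_int a" "real_of_int b"]
      by (simp add: algebra_simps)
    also have "\<dots> = (len g * \<bar>t - n\<bar>)\<^sup>2"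
      using stewart_line[of s "real_of_int n" "real_of_int a" "real_of_int b"] unfolding st by (simp add: power_mult_distrib)
    finally show ?thesis by (rule power2_le_imp_le) (simp add: len_nonneg)
  qed
  have ge: "len g * \<bar>t - n\<bar> \<le> dist (\<phi> (g [^] n) x) p" for n :: int
  proof (cases "n \<le> t")
    case True
    define j where "j = \<lceil>t\<rceil>"
    have j: "t \<le> j" "n \<le> j" using True unfolding j_def by linarith+
    have "dist (\<phi> (g [^] n) x) (\<phi> (g [^] j) x) = len g * (j - n)"
      using dist_int_pow[OF g x, of n j] j by simp
    moreover have "dist (\<phi> (g [^] j) x) p \<le> len g * (j - t)" using le[of j] j by simp
    ultimately show ?thesis
      using dist_triangle2[of "\<phi> (g [^] n) x" "\<phi> (g [^] j) x" p] True by (simp add: algebra_simps)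
  next
    case False
    define j where "j = \<lfloor>t\<rfloor>"
    have j: "j \<le> t" "j \<le> n" using False unfolding j_def by linarith+
    have "dist (\<phi> (g [^] n) x) (\<phi> (g [^] j) x) = len g * (n - j)"
      using dist_int_pow[OF g x, of n j] j by simp
    moreover have "dist (\<phi> (g [^] j) x) p \<le> len g * (t - j)" using le[of j] j by simp
    ultimately show ?thesis
      using dist_triangle2[of "\<phi> (g [^] n) x" "\<phi> (g [^] j) x" p] False by (simp add: algebra_simps)
  qed
  show ?thesis using p(1) le ge unfolding on_axis_def by (meson order_antisym)
qed

definition flow where
  "flow g t x = (SOME p. on_axis g t x p)"

lemma flow_on_axis:
  assumes "g \<in> carrier G" "x \<in> Min g" shows "on_axis g t x (flow g t x)"
  unfolding flow_def using on_axis_exists[OF assms] by (rule someI_ex)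

lemma flow_eqI:
  assumes "g \<in> carrier G" "x \<in> Min g" "on_axis g t x p" shows "flow g t x = p"
proof -
  have "dist (flow g t x) p = len g * \<bar>t - t\<bar>"
    by (rule on_axis_dist[OF assms(1,2) flow_on_axis[OF assms(1,2)] assms(3)])
  then show ?thesis by simp
qed

lemma flow_closed: "g \<in> carrier G \<Longrightarrow> x \<in> Min g \<Longrightarrow> flow g t x \<in> X"
  using flow_on_axis by (auto simp: on_axis_def)

lemma flow_dist: "g \<in> carrier G \<Longrightarrow> x \<in> Min g \<Longrightarrow> dist (flow g t x) (flow g u x) = len g * \<bar>t - u\<bar>"
  using on_axis_dist flow_on_axis by blast

lemma flow_int:
  assumes g: "g \<in> carrier G" and x: "x \<in> Min g"
  shows "flow g (of_int i) x = \<phi> (g [^] i) x"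
  by (rule flow_eqI[OF g x])
    (use g Min_subset[OF x] dist_int_pow[OF g x] in \<open>auto simp: on_axis_def abs_minus_commute\<close>)

lemma flow_0: "g \<in> carrier G \<Longrightarrow> x \<in> Min g \<Longrightarrow> flow g 0 x = x"
  using flow_int[of g x 0] by (simp add: Min_subset)

lemma flow_1: "g \<in> carrier G \<Longrightarrow> x \<in> Min g \<Longrightarrow> flow g 1 x = \<phi> g x"
  using flow_int[of g x 1] by simp

lemma flow_commute:
  assumes g: "g \<in> carrier G" and h: "h \<in> carrier G" and gh: "g \<otimes> h = h \<otimes> g" and x: "x \<in> Min g"
  shows "flow g t (\<phi> h x) = \<phi> h (flow g t x)"
proof (rule flow_eqI[OF g Min_commute[OF g h gh x]])
  have X: "x \<in> X" using x by (rule Min_subset)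
  have "\<phi> (g [^] n) (\<phi> h x) = \<phi> h (\<phi> (g [^] n) x)" for n :: int
  proof (rule act_commute[OF _ h _ X])
    show "g [^] n \<otimes> h = h \<otimes> g [^] n"
      using commute_int_pow[OF g h gh] .
  qed (use g in simp)
  then show "on_axis g t (\<phi> h x) (\<phi> h (flow g t x))"
    using flow_on_axis[OF g x, of t] isometric g h X unfolding on_axis_def by simp
qed

lemma flow_succ:
  assumes g: "g \<in> carrier G" and x: "x \<in> Min g"
  shows "\<phi> (g [^] (n::int)) (flow g t x) = flow g (t + n) x"
proof (rule flow_eqI[OF g x, symmetric])
  have X: "x \<in> X" using x by (rule Min_subset)
  have "dist (\<phi> (g [^] i) x) (\<phi> (g [^] n) (flow g t x)) = len g * \<bar>t + n - i\<bar>" for i :: int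
  proof -
    have "g [^] i = g [^] n \<otimes> g [^] (i - n)" using g by (simp add: int_pow_mult[symmetric])
    then have "\<phi> (g [^] i) x = \<phi> (g [^] n) (\<phi> (g [^] (i - n)) x)" using act_mult g X by simp
    then have "dist (\<phi> (g [^] i) x) (\<phi> (g [^] n) (flow g t x)) = dist (\<phi> (g [^] (i - n)) x) (flow g t x)"
      using isometric g X flow_closed[OF g x] by simp
    also have "\<dots> = len g * \<bar>t - (i - n)\<bar>" using flow_on_axis[OF g x, of t] by (simp add: on_axis_def)
    finally show ?thesis by (simp add: algebra_simps)
  qed
  then show "on_axis g (t + n) x (\<phi> (g [^] n) (flow g t x))"
    using g flow_closed[OF g x] by (simp add: on_axis_def)
qed

lemma flow_Min:
  assumes g: "g \<in> carrier G" and x: "x \<in> Min g"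
  shows "flow g t x \<in> Min g"
  using flow_succ[OF g x, of 1 t] flow_dist[OF g x, of t "t + 1"] g flow_closed[OF g x]
  by (simp add: min_set_def)

lemma flow_add:
  assumes g: "g \<in> carrier G" and x: "x \<in> Min g"
  shows "flow g s (flow g t x) = flow g (s + t) x"
  by (rule flow_eqI[OF g flow_Min[OF g x]])
    (use flow_closed[OF g x] flow_succ[OF g x] flow_dist[OF g x] in
      \<open>simp add: on_axis_def abs_minus_commute algebra_simps\<close>)

text \<open>The distance between the two flow lines is midpoint-convex in \<open>t\<close> and, as \<open>g\<close> is an isometry, it is bounded.
  This replaces the flat strip theorem.\<close>

lemma flow_isometric:
  assumes g: "g \<in> carrier G" and x: "x \<in> Min g" and y: "y \<in> Min g"
  shows "dist (flow g t x) (flow g t y) = dist x y"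
proof -
  define f where "f t = dist (flow g t x) (flow g t y)" for t
  have mid: "midpt (flow g s x) (flow g t x) (flow g ((s + t) / 2) x)" if x: "x \<in> Min g" for s t x
  proof -
    have h: "\<bar>s - (s + t) / 2\<bar> = \<bar>s - t\<bar> / 2" "\<bar>(s + t) / 2 - t\<bar> = \<bar>s - t\<bar> / 2"
      by (simp_all add: field_simps abs_if)
    show ?thesis unfolding midpt_def flow_dist[OF g x] h by (simp add: flow_closed[OF g x])
  qed
  have "f t = f 0"
  proof (rule midconvex_bounded_const[of f])
    show "f ((s + t) / 2) \<le> (f s + f t) / 2" for s t
      unfolding f_def using mid x y flow_closed g by (intro dist_midpts) auto
    show "f t \<le> 2 * len g + dist x y" for t
    proof -
      define n where "n = \<lfloor>t\<rfloor>"
      have n: "\<bar>t - n\<bar> \<le> 1" unfolding n_def by linarith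
      have XY: "x \<in> X" "y \<in> X" using x y by (auto dest: Min_subset)
      have "dist (\<phi> (g [^] n) x) (\<phi> (g [^] n) y) = dist x y" using isometric g XY by simp
      moreover have "dist (flow g t x) (\<phi> (g [^] n) x) \<le> len g" "dist (flow g t y) (\<phi> (g [^] n) y) \<le> len g"
        using flow_dist[OF g x, of t n] flow_dist[OF g y, of t n] n flow_int[OF g x, of n] flow_int[OF g y, of n]
          mult_left_mono[OF n len_nonneg[of g]] by simp_all
      ultimately show ?thesis unfolding f_def
        using dist_triangle[of "flow g t x" "flow g t y" "\<phi> (g [^] n) x"]
          dist_triangle2[of "\<phi> (g [^] n) x" "flow g t y" "\<phi> (g [^] n) y"] by linarith
    qed
  qed
  then show ?thesis by (simp add: f_def flow_0 g x y)
qed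

end

section \<open>The quadratic law for flows\<close>

text \<open>After subtraction of the affine interpolation at \<open>0\<close> and \<open>1\<close>, such a function is additive, so it is odd and
  has period \<open>1\<close>. By convexity it is at most \<open>0\<close> on the unit interval, hence everywhere, and it vanishes by oddness.\<close>

lemma affine_of_convex_midconcave:
  fixes h :: "real \<Rightarrow> real"
  assumes convex: "\<And>a b \<theta>. 0 \<le> \<theta> \<Longrightarrow> \<theta> \<le> 1 \<Longrightarrow> h ((1 - \<theta>) * a + \<theta> * b) \<le> (1 - \<theta>) * h a + \<theta> * h b"
    and midconcave: "\<And>t s. h (t + s) + h (t - s) \<le> 2 * h t"
  shows "h t = h 0 + t * (h 1 - h 0)"
proof -
  \<comment> \<open>The deviation of \<open>h\<close> from the affine interpolation.\<close>
  define k where "k t = h t - h 0 - t * (h 1 - h 0)" for t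
  have k01: "k 0 = 0" "k 1 = 0" by (simp_all add: k_def)
  have mid: "k (t + s) + k (t - s) = 2 * k t" for t s
  proof -
    have "h ((1 - 1/2) * (t + s) + 1/2 * (t - s)) \<le> (1 - 1/2) * h (t + s) + 1/2 * h (t - s)"
      by (rule convex) auto
    moreover have "(1 - 1/2) * (t + s) + 1/2 * (t - s) = t" by (simp add: field_simps)
    ultimately have "2 * h t \<le> h (t + s) + h (t - s)" by simp
    then have "h (t + s) + h (t - s) = 2 * h t" using midconcave[of t s] by simp
    then show ?thesis by (simp add: k_def algebra_simps)
  qed
  have odd: "k (- t) = - k t" for t using mid[of 0 t] k01 by simp
  have dbl: "k (2 * t) = 2 * k t" for t using mid[of t t] k01 by simp
  have per: "k (t + 1) = k t" for t
  proof -
    have eq: "(t + 1) / 2 + (t - 1) / 2 = t" "(t + 1) / 2 - (t - 1) / 2 = 1" "2 * ((t + 1) / 2) = t + 1"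
      by (simp_all add: field_simps)
    show ?thesis using mid[of "(t + 1) / 2" "(t - 1) / 2"] dbl[of "(t + 1) / 2"] unfolding eq k01 by simp
  qed
  have perint: "k (t + real n) = k t" for t n
  proof (induction n)
    case (Suc n)
    then show ?case using per[of "t + real n"] by (simp add: ac_simps)
  qed simp
  have unit: "k t \<le> 0" if "0 \<le> t" "t \<le> 1" for t
    using convex[OF that, of 0 1] by (simp add: k_def algebra_simps)
  have pos: "k t \<le> 0" if "0 \<le> t" for t
  proof -
    define n where "n = nat \<lfloor>t\<rfloor>"
    have "real n \<le> t" "t \<le> real n + 1" using that unfolding n_def by linarith+
    then show ?thesis using unit[of "t - real n"] perint[of "t - real n" n] by simp
  qed
  have "k t \<le> 0" for t
  proof -
    obtain n :: nat where "- t \<le> real n" using real_arch_simple by blast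
    then show ?thesis using pos[of "t + real n"] perint[of t n] by simp
  qed
  from this[of t] this[of "- t"] have "k t = 0" unfolding odd by simp
  then show ?thesis by (simp add: k_def)
qed

lemma bounded_slope_nonpos:
  fixes c K :: real
  assumes "\<And>n::nat. c * real n \<le> K" shows "c \<le> 0"
proof (rule ccontr)
  assume "\<not> c \<le> 0"
  then obtain n where "K < real n * c" using reals_Archimedean3[of c] by auto
  then show False using assms[of n] by (simp add: mult.commute)
qed

context hadamard
begin

text \<open>A one-parameter group of isometries of \<open>C\<close> all of whose orbits are geodesic lines of speed \<open>L\<close>. The case \<open>L = 0\<close>
  is the trivial flow.\<close>

definition flow_on :: "'x set \<Rightarrow> (real \<Rightarrow> 'x \<Rightarrow> 'x) \<Rightarrow> real \<Rightarrow> bool" where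
  "flow_on C F L \<longleftrightarrow> C \<subseteq> X \<and> 0 \<le> L \<and> (\<forall>x\<in>C. F 0 x = x) \<and>
     (\<forall>x\<in>C. \<forall>t. F t x \<in> C) \<and> (\<forall>x\<in>C. \<forall>s t. F s (F t x) = F (s + t) x) \<and>
     (\<forall>x\<in>C. \<forall>s t. dist (F s x) (F t x) = L * \<bar>s - t\<bar>) \<and>
     (\<forall>x\<in>C. \<forall>y\<in>C. \<forall>t. dist (F t x) (F t y) = dist x y)"

text \<open>The coefficient in the quadratic law \<open>flow_on_quadratic\<close>. In a product \<open>Y \<times> \<real>\<close> with the flow along \<open>\<real>\<close>, it is \<open>L\<close>
  times the height of \<open>z\<close> above \<open>y\<close>.\<close>

definition lead :: "(real \<Rightarrow> 'x \<Rightarrow> 'x) \<Rightarrow> real \<Rightarrow> 'x \<Rightarrow> 'x \<Rightarrow> real" where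
  "lead F L y z = ((dist y (F 1 z))\<^sup>2 - L\<^sup>2 - (dist y z)\<^sup>2) / 2"

context
  fixes C F L assumes F: "flow_on C F L"
begin

lemma flow_on_facts:
  shows "C \<subseteq> X" "0 \<le> L" "x \<in> C \<Longrightarrow> F 0 x = x" "x \<in> C \<Longrightarrow> F t x \<in> C"
    "x \<in> C \<Longrightarrow> F s (F t x) = F (s + t) x"
    "x \<in> C \<Longrightarrow> dist (F s x) (F t x) = L * \<bar>s - t\<bar>"
    "x \<in> C \<Longrightarrow> y \<in> C \<Longrightarrow> dist (F t x) (F t y) = dist x y"
  using F unfolding flow_on_def by blast+

lemma flow_on_shift:
  assumes "y \<in> C" "z \<in> C" shows "dist (F s y) (F t z) = dist y (F (t - s) z)"
  using flow_on_facts(7)[OF assms(1) flow_on_facts(4)[OF assms(2)], of s "t - s"] flow_on_facts(5)[OF assms(2), of s "t - s"]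
  by simp

text \<open>Subtract \<open>L\<^sup>2 t\<^sup>2\<close>. Convexity of the difference is Stewart's inequality on the flow line of \<open>z\<close>. Midpoint
  concavity is the quadrilateral inequality for \<open>y\<close>, \<open>F\<^sub>s y\<close>, \<open>F\<^sub>t\<^sub>+\<^sub>s z\<close>, \<open>F\<^sub>t z\<close>, in which the sides have the lengths
  \<open>L s\<close>, \<open>d(y, F\<^sub>t z)\<close>, \<open>L s\<close>, \<open>d(y, F\<^sub>t z)\<close> and the diagonals are \<open>d(y, F\<^sub>t\<^sub>+\<^sub>s z)\<close> and \<open>d(y, F\<^sub>t\<^sub>-\<^sub>s z)\<close>.\<close>

lemma flow_on_quadratic:
  assumes y: "y \<in> C" and z: "z \<in> C"
  shows "(dist y (F t z))\<^sup>2 = L\<^sup>2 * t\<^sup>2 + 2 * lead F L y z * t + (dist y z)\<^sup>2"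
proof -
  note X = flow_on_facts(1)[THEN subsetD]
  note cl = flow_on_facts(4)
  define h where "h t = (dist y (F t z))\<^sup>2 - L\<^sup>2 * t\<^sup>2" for t
  have "h t = h 0 + t * (h 1 - h 0)"
  proof (rule affine_of_convex_midconcave)
    fix a b \<theta> :: real assume th: "0 \<le> \<theta>" "\<theta> \<le> 1"
    define u where "u = (1 - \<theta>) * a + \<theta> * b"
    have "a - u = \<theta> * (a - b)" "u - b = (1 - \<theta>) * (a - b)" by (simp_all add: u_def algebra_simps)
    then have "dist (F a z) (F u z) = \<theta> * dist (F a z) (F b z)" "dist (F u z) (F b z) = (1 - \<theta>) * dist (F a z) (F b z)"
      using th by (simp_all add: flow_on_facts(6)[OF z] abs_mult)
    then have "(dist y (F u z))\<^sup>2 \<le> (1 - \<theta>) * (dist y (F a z))\<^sup>2 + \<theta> * (dist y (F b z))\<^sup>2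
         - \<theta> * (1 - \<theta>) * (dist (F a z) (F b z))\<^sup>2"
      using th cl[OF z] y X by (intro stewart_at) auto
    moreover have "(dist (F a z) (F b z))\<^sup>2 = L\<^sup>2 * (a - b)\<^sup>2"
      by (simp add: flow_on_facts(6)[OF z] power_mult_distrib)
    moreover have "L\<^sup>2 * u\<^sup>2 = (1 - \<theta>) * (L\<^sup>2 * a\<^sup>2) + \<theta> * (L\<^sup>2 * b\<^sup>2) - \<theta> * (1 - \<theta>) * (L\<^sup>2 * (a - b)\<^sup>2)"
      by (simp add: u_def power2_eq_square algebra_simps)
    ultimately have "h u \<le> (1 - \<theta>) * h a + \<theta> * h b"
      unfolding h_def by (simp only: right_diff_distrib)
    then show "h ((1 - \<theta>) * a + \<theta> * b) \<le> (1 - \<theta>) * h a + \<theta> * h b" by (simp only: u_def)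
  next
    fix t s
    have "(dist y (F (t + s) z))\<^sup>2 + (dist (F s y) (F t z))\<^sup>2
      \<le> (dist y (F s y))\<^sup>2 + (dist (F s y) (F (t + s) z))\<^sup>2 + (dist (F (t + s) z) (F t z))\<^sup>2 + (dist (F t z) y)\<^sup>2"
      using cl y z X by (intro quadrilateral) auto
    moreover have "dist (F s y) (F t z) = dist y (F (t - s) z)" "dist (F s y) (F (t + s) z) = dist y (F t z)"
      using flow_on_shift[OF y z, of s] by simp_all
    moreover have "(dist y (F s y))\<^sup>2 = L\<^sup>2 * s\<^sup>2" 
      using flow_on_facts(6)[OF y, of 0 s] flow_on_facts(3)[OF y] by (simp add: power_mult_distrib)
    moreover have "(dist (F (t + s) z) (F t z))\<^sup>2 = L\<^sup>2 * s\<^sup>2"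
      using flow_on_facts(6)[OF z, of "t + s" t] by (simp add: power_mult_distrib)
    ultimately show "h (t + s) + h (t - s) \<le> 2 * h t"
      unfolding h_def by (simp add: dist_commute power2_eq_square algebra_simps)
  qed
  then show ?thesis by (simp add: h_def lead_def flow_on_facts(3)[OF z] field_simps)
qed

text \<open>Go from \<open>y\<close> to \<open>F\<^sub>2\<^sub>t w\<close> by way of \<open>F\<^sub>t z\<close>, and use \<open>(p + q)\<^sup>2 \<le> 2 p\<^sup>2 + 2 q\<^sup>2\<close>: the terms in \<open>t\<^sup>2\<close> cancel, and the
  linear terms can be compared for large \<open>t\<close>.\<close>

lemma lead_triangle:
  assumes y: "y \<in> C" and z: "z \<in> C" and w: "w \<in> C"
  shows "lead F L y w \<le> lead F L y z + lead F L z w"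
proof -
  have "4 * (lead F L y w - lead F L y z - lead F L z w) * t \<le> 2 * (dist y z)\<^sup>2 + 2 * (dist z w)\<^sup>2" for t
  proof -
    have "dist y (F (2 * t) w) \<le> dist y (F t z) + dist (F t z) (F (2 * t) w)" by (rule dist_triangle)
    also have "dist (F t z) (F (2 * t) w) = dist z (F t w)" using flow_on_shift[OF z w, of t "2 * t"] by simp
    finally have "(dist y (F (2 * t) w))\<^sup>2 \<le> (dist y (F t z) + dist z (F t w))\<^sup>2" by (intro power_mono) auto
    also have "\<dots> \<le> 2 * (dist y (F t z))\<^sup>2 + 2 * (dist z (F t w))\<^sup>2"
      using zero_le_power2[of "dist y (F t z) - dist z (F t w)"] by (simp add: power2_eq_square algebra_simps)
    finally have "(dist y w)\<^sup>2 + 4 * (lead F L y w - lead F L y z - lead F L z w) * t \<le> 2 * (dist y z)\<^sup>2 + 2 * (dist z w)\<^sup>2"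
      unfolding flow_on_quadratic[OF y w] flow_on_quadratic[OF y z] flow_on_quadratic[OF z w] 
      by (simp add: power_mult_distrib algebra_simps)
    then show ?thesis using zero_le_power2[of "dist y w"] by linarith
  qed
  then have "4 * (lead F L y w - lead F L y z - lead F L z w) \<le> 0" by (rule bounded_slope_nonpos)
  then show ?thesis by simp
qed

lemma lead_antisym:
  assumes y: "y \<in> C" and z: "z \<in> C"
  shows "lead F L z y = - lead F L y z"
proof -
  have "dist z (F 1 y) = dist (F 0 z) (F 1 y)" using flow_on_facts(3)[OF z] by simp
  also have "\<dots> = dist (F 1 y) (F 0 z)" by (rule dist_commute)
  also have "\<dots> = dist y (F (- 1) z)" using flow_on_shift[OF y z, of 1 0] by simp
  finally show ?thesis using flow_on_quadratic[OF y z, of "- 1"] flow_on_quadratic[OF z y, of 1]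
    by (simp add: dist_commute)
qed

lemma lead_cocycle:
  assumes "y \<in> C" "z \<in> C" "w \<in> C"
  shows "lead F L y w = lead F L y z + lead F L z w"
  using lead_triangle[OF assms] lead_triangle[OF assms(3,2,1)] lead_antisym[OF assms(1,2)]
    lead_antisym[OF assms(2,3)] lead_antisym[OF assms(1,3)] by linarith

end
end

section \<open>Orthogonality of commutators\<close>

context hadamard_action
begin

lemma flow_on_Min:
  assumes g: "g \<in> carrier G" shows "flow_on (Min g) (flow g) (len g)"
  unfolding flow_on_def
  using flow_0[OF g] flow_Min[OF g] flow_add[OF g] flow_dist[OF g] flow_isometric[OF g] len_nonneg Min_subset
  by blast

text \<open>For \<open>u\<close> in the centralizer of \<open>d\<close>, the lead of \<open>u x\<close> over \<open>x\<close> with respect to the flow of \<open>d\<close> is additive in \<open>u\<close>,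
  because the lead is a cocycle that is invariant under the centralizer. The element \<open>c\<close> is a commutator of
  \<open>g\<close> and \<open>h\<close>, so its lead is \<open>0\<close>, and the quadratic law becomes the theorem of Pythagoras.\<close>

lemma commutator_orthogonal:
  assumes d: "d \<in> carrier G" and x: "x \<in> Min d"
    and g: "g \<in> carrier G" "d \<otimes> g = g \<otimes> d" and h: "h \<in> carrier G" "d \<otimes> h = h \<otimes> d"
    and c: "c \<in> carrier G" "d \<otimes> c = c \<otimes> d" and comm: "g \<otimes> h = h \<otimes> g \<otimes> c"
  shows "(dist x (\<phi> (d \<otimes> c) x))\<^sup>2 = (dist x (\<phi> d x))\<^sup>2 + (dist x (\<phi> c x))\<^sup>2"
proof -
  note fl = flow_on_Min[OF d]
  define \<tau> where "\<tau> u = lead (flow d) (len d) x (\<phi> u x)" for u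
  have X: "x \<in> X" using x by (rule Min_subset)
  have add: "\<tau> (u \<otimes> v) = \<tau> u + \<tau> v"
    if u: "u \<in> carrier G" "d \<otimes> u = u \<otimes> d" and v: "v \<in> carrier G" "d \<otimes> v = v \<otimes> d" for u v
  proof -
    have M: "\<phi> u x \<in> Min d" "\<phi> v x \<in> Min d" using Min_commute[OF d] u v x by auto
    have "lead (flow d) (len d) (\<phi> u x) (\<phi> u (\<phi> v x)) = lead (flow d) (len d) x (\<phi> v x)"
      unfolding lead_def using flow_commute[OF d u M(2), of 1] isometric[OF u(1)] X flow_closed[OF d M(2)] v
      by simp
    then show ?thesis
      using lead_cocycle[OF fl x M(1), of "\<phi> u (\<phi> v x)"] Min_commute[OF d u M(2)] act_mult[OF u(1) v(1) X]
      by (simp add: \<tau>_def)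
  qed
  have dhg: "d \<otimes> (h \<otimes> g) = (h \<otimes> g) \<otimes> d"
    using d g h by (metis m_assoc)
  have "\<tau> g + \<tau> h = \<tau> (g \<otimes> h)" using add g h by simp
  also have "\<dots> = \<tau> h + \<tau> g + \<tau> c" unfolding comm using add dhg g h c by simp
  finally have "\<tau> c = 0" by simp
  moreover have M: "\<phi> c x \<in> Min d" using Min_commute[OF d c x] .
  ultimately have "(dist x (flow d 1 (\<phi> c x)))\<^sup>2 = (len d)\<^sup>2 + (dist x (\<phi> c x))\<^sup>2"
    using flow_on_quadratic[OF fl x M, of 1] by (simp add: \<tau>_def)
  then show ?thesis using flow_1[OF d M] act_mult[OF d c(1) X] Min_dist[OF x] by simp
qed

end

section \<open>Euclidean actions of vector spaces\<close>

locale vector_action = hadamard X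
  for X :: "'x::metric_space set" +
  fixes C :: "'x set" and T :: "'v::real_vector \<Rightarrow> 'x \<Rightarrow> 'x"
  assumes CX: "C \<subseteq> X" and C_nonempty: "C \<noteq> {}"
    and T_closed: "x \<in> C \<Longrightarrow> T v x \<in> C"
    and T_zero: "x \<in> C \<Longrightarrow> T 0 x = x"
    and T_add: "x \<in> C \<Longrightarrow> T (v + w) x = T v (T w x)"
    and T_isometric: "x \<in> C \<Longrightarrow> y \<in> C \<Longrightarrow> dist (T v x) (T v y) = dist x y"
begin

definition geodesic_dir :: "'v \<Rightarrow> bool" where
  "geodesic_dir v \<longleftrightarrow> (\<exists>L. flow_on C (\<lambda>t. T (t *\<^sub>R v)) L)"

lemma T_diff_dist: "x \<in> C \<Longrightarrow> dist (T v x) (T w x) = dist x (T (w - v) x)"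
  using T_isometric[of x "T (w - v) x" v] T_add[of x v "w - v"] T_closed by simp

text \<open>Speeds at different points agree, as \<open>T\<close> acts by isometries: the displacements of two points by \<open>n v\<close> differ by at most
  twice their distance.\<close>

lemma geodesic_dirI:
  assumes "\<And>x t. x \<in> C \<Longrightarrow> dist x (T (t *\<^sub>R v) x) = \<bar>t\<bar> * dist x (T v x)"
  shows "geodesic_dir v"
proof -
  have le: "dist y (T v y) \<le> dist x (T v x)" if x: "x \<in> C" and y: "y \<in> C" for x y
  proof -
    have "(dist y (T v y) - dist x (T v x)) * real t \<le> 2 * dist x y" for t :: nat
    proof -
      let ?T = "T (real t *\<^sub>R v)"
      have "dist y (?T y) \<le> dist y x + dist x (?T x) + dist (?T x) (?T y)"
        using dist_triangle[of y "?T y" x] dist_triangle[of x "?T y" "?T x"]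
        by linarith
      then show ?thesis
        unfolding assms[OF x] assms[OF y] T_isometric[OF x y] by (simp add: dist_commute algebra_simps)
    qed
    then have "dist y (T v y) - dist x (T v x) \<le> 0" by (rule bounded_slope_nonpos)
    then show ?thesis by simp
  qed
  obtain x0 where x0: "x0 \<in> C" using C_nonempty by blast
  have eq: "dist x (T v x) = dist x0 (T v x0)" if "x \<in> C" for x
    using le[OF that x0] le[OF x0 that] by simp
  have "dist (T (s *\<^sub>R v) x) (T (t *\<^sub>R v) x) = dist x0 (T v x0) * \<bar>s - t\<bar>" if "x \<in> C" for s t x
    using T_diff_dist[OF that, of "s *\<^sub>R v" "t *\<^sub>R v"] assms[OF that, of "t - s"] eq[OF that]
    by (simp add: scaleR_left_diff_distrib abs_minus_commute)
  then have "flow_on C (\<lambda>t. T (t *\<^sub>R v)) (dist x0 (T v x0))"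
    unfolding flow_on_def using CX T_closed T_zero T_isometric
    by (auto simp: T_add[symmetric] scaleR_left_distrib)
  then show ?thesis by (auto simp: geodesic_dir_def)
qed

lemma geodesic_dirD:
  assumes "geodesic_dir v" "x \<in> C" shows "dist x (T (t *\<^sub>R v) x) = \<bar>t\<bar> * dist x (T v x)"
proof -
  obtain L where "flow_on C (\<lambda>t. T (t *\<^sub>R v)) L" using assms by (auto simp: geodesic_dir_def)
  note f = flow_on_facts(6)[OF this assms(2)]
  show ?thesis using f[of 0 t] f[of 0 1] T_zero[OF assms(2)] by simp
qed

lemma geodesic_dir_speed:
  assumes "geodesic_dir v" "x \<in> C" shows "flow_on C (\<lambda>t. T (t *\<^sub>R v)) (dist x (T v x))"
proof -
  obtain L where L: "flow_on C (\<lambda>t. T (t *\<^sub>R v)) L" using assms by (auto simp: geodesic_dir_def)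
  have "dist x (T v x) = L" using flow_on_facts(6)[OF L assms(2), of 0 1] T_zero[OF assms(2)] by simp
  then show ?thesis using L by simp
qed

lemma geodesic_dir_scale:
  assumes "geodesic_dir v" shows "geodesic_dir (a *\<^sub>R v)"
  by (rule geodesic_dirI) (use geodesic_dirD[OF assms] in \<open>simp add: abs_mult\<close>)

text \<open>The squared displacement by \<open>s v + t w\<close> obeys the quadratic law along the flow of \<open>v\<close> and along that of \<open>w\<close>. Comparing the
  two, it is a homogeneous quadratic polynomial in \<open>s\<close> and \<open>t\<close>, so it grows quadratically along the diagonal.\<close>

lemma geodesic_dir_add:
  assumes v: "geodesic_dir v" and w: "geodesic_dir w" shows "geodesic_dir (v + w)"
proof (rule geodesic_dirI)
  fix x t assume x: "x \<in> C"
  let ?F = "\<lambda>t. T (t *\<^sub>R v)" and ?G = "\<lambda>t. T (t *\<^sub>R w)"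
  let ?L = "dist x (T v x)" and ?K = "dist x (T w x)"
  define c where "c t = lead ?F ?L x (?G t x)" for t
  define c' where "c' s = lead ?G ?K x (?F s x)" for s
  have F: "(dist x (T (s *\<^sub>R v + t *\<^sub>R w) x))\<^sup>2 = ?L\<^sup>2 * s\<^sup>2 + 2 * c t * s + (\<bar>t\<bar> * ?K)\<^sup>2" for s t
    using flow_on_quadratic[OF geodesic_dir_speed[OF v x] x T_closed[OF x], of s "t *\<^sub>R w"] geodesic_dirD[OF w x, of t]
    by (simp add: c_def T_add[OF x])
  have G: "(dist x (T (s *\<^sub>R v + t *\<^sub>R w) x))\<^sup>2 = ?K\<^sup>2 * t\<^sup>2 + 2 * c' s * t + (\<bar>s\<bar> * ?L)\<^sup>2" for s t
    using flow_on_quadratic[OF geodesic_dir_speed[OF w x] x T_closed[OF x], of t "s *\<^sub>R v"] geodesic_dirD[OF v x, of s]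
    by (simp add: c'_def T_add[OF x] add.commute[of "s *\<^sub>R v"])
  \<comment> \<open>The two quadratic laws have the same pure terms, so their mixed terms agree; hence \<open>c\<close> is linear.\<close>
  have "c t * s = c' s * t" for s t using F[of s t] G[of s t] by (simp add: power_mult_distrib)
  from this[of t 1 for t] have "c t = c' 1 * t" for t by simp
  then have Q: "(dist x (T (s *\<^sub>R v + t *\<^sub>R w) x))\<^sup>2 = ?L\<^sup>2 * s\<^sup>2 + 2 * c' 1 * t * s + t\<^sup>2 * ?K\<^sup>2" for s t
    using F[of s t] by (simp add: power_mult_distrib)
  have "(dist x (T (t *\<^sub>R (v + w)) x))\<^sup>2 = (\<bar>t\<bar> * dist x (T (v + w) x))\<^sup>2"
    using Q[of t t] Q[of 1 1] by (simp add: scaleR_right_distrib power_mult_distrib power2_eq_square algebra_simps)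
  then show "dist x (T (t *\<^sub>R (v + w)) x) = \<bar>t\<bar> * dist x (T (v + w) x)"
    by (rule power2_eq_imp_eq) auto
qed

lemma geodesic_dir_zero: "geodesic_dir 0"
  by (rule geodesic_dirI) (simp add: T_zero)

lemma geodesic_dir_span:
  assumes "\<And>b. b \<in> B \<Longrightarrow> geodesic_dir b" "v \<in> span B" shows "geodesic_dir v"
  using assms(2)
  by (induction rule: span_induct_alt)
    (auto intro: geodesic_dir_zero geodesic_dir_add geodesic_dir_scale assms(1))

end

locale flat_action = vector_action X C T for X :: "'x::metric_space set" and C and T :: "'v::real_vector \<Rightarrow> 'x \<Rightarrow> 'x" +
  assumes geodesic: "geodesic_dir v"
begin

text \<open>The displacement does not depend on the point (lemma \<open>disp\<close> below), so any point will do.\<close>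

definition disp :: "'v \<Rightarrow> real" where "disp v = dist (SOME x. x \<in> C) (T v (SOME x. x \<in> C))"

lemma disp: assumes "x \<in> C" shows "dist x (T v x) = disp v"
proof -
  define x0 where "x0 = (SOME x. x \<in> C)"
  have x0: "x0 \<in> C" unfolding x0_def using C_nonempty by (simp add: some_in_eq)
  obtain L where L: "flow_on C (\<lambda>t. T (t *\<^sub>R v)) L" using geodesic by (auto simp: geodesic_dir_def)
  show ?thesis
    using flow_on_facts(6)[OF L x0, of 0 1] flow_on_facts(6)[OF L assms, of 0 1] T_zero x0 assms
    by (simp add: disp_def x0_def)
qed

lemma disp_nonneg: "0 \<le> disp v" by (simp add: disp_def)

lemma disp_scale: "disp (t *\<^sub>R v) = \<bar>t\<bar> * disp v"
  using C_nonempty geodesic_dirD[OF geodesic] disp by fastforce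

lemma disp_dist: "x \<in> C \<Longrightarrow> dist (T v x) (T w x) = disp (v - w)"
  using T_diff_dist[of x v w] disp[of x "w - v"] disp_scale[of "-1" "v - w"] by simp

text \<open>The inner product of which \<open>disp\<close> is the norm.\<close>

definition polar :: "'v \<Rightarrow> 'v \<Rightarrow> real" where
  "polar v w = ((disp (v + w))\<^sup>2 - (disp v)\<^sup>2 - (disp w)\<^sup>2) / 2"

lemma disp_line: "(disp (t *\<^sub>R v + w))\<^sup>2 = t\<^sup>2 * (disp v)\<^sup>2 + 2 * t * polar v w + (disp w)\<^sup>2"
proof -
  obtain x where x: "x \<in> C" using C_nonempty by blast
  have f: "flow_on C (\<lambda>t. T (t *\<^sub>R v)) (disp v)" using geodesic_dir_speed[OF geodesic x] disp[OF x] by metis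
  show ?thesis
    using flow_on_quadratic[OF f x T_closed[OF x], of t w] disp[OF x]
    by (simp add: lead_def polar_def T_add[OF x, symmetric] algebra_simps)
qed

lemma polar_commute: "polar v w = polar w v" by (simp add: polar_def add.commute)

lemma polar_self: "polar v v = (disp v)\<^sup>2"
  using disp_scale[of 2 v] by (simp add: polar_def scaleR_2 power_mult_distrib)

lemma parallelogram: "(disp (v + w))\<^sup>2 + (disp (v - w))\<^sup>2 = 2 * (disp v)\<^sup>2 + 2 * (disp w)\<^sup>2"
  using disp_line[of 1 w v] disp_line[of "-1" w v] by (simp add: add.commute)

text \<open>The argument of Jordan and von Neumann, from the parallelogram law.\<close>

lemma polar_add_right: "polar u (v + w) = polar u v + polar u w"
proof -
  have "(disp (u + w + v))\<^sup>2 + (disp (u + w - v))\<^sup>2 = 2 * (disp (u + w))\<^sup>2 + 2 * (disp v)\<^sup>2"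
    "(disp (u + (w - v)))\<^sup>2 + (disp (u - (w - v)))\<^sup>2 = 2 * (disp u)\<^sup>2 + 2 * (disp (w - v))\<^sup>2"
    "(disp (u + v + w))\<^sup>2 + (disp (u + v - w))\<^sup>2 = 2 * (disp (u + v))\<^sup>2 + 2 * (disp w)\<^sup>2"
    "(disp (w + v))\<^sup>2 + (disp (w - v))\<^sup>2 = 2 * (disp w)\<^sup>2 + 2 * (disp v)\<^sup>2"
    by (rule parallelogram)+
  moreover have "u + w + v = u + v + w" "u + (w - v) = u + w - v" "u - (w - v) = u + v - w" "w + v = v + w"
    by (simp_all add: algebra_simps)
  moreover have "polar u (v + w) = ((disp (u + v + w))\<^sup>2 - (disp u)\<^sup>2 - (disp (v + w))\<^sup>2) / 2"
    by (simp add: polar_def add.assoc)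
  ultimately show ?thesis unfolding polar_def[of u v] polar_def[of u w] by (simp add: field_simps)
qed

lemma polar_scale_left: "polar (t *\<^sub>R v) w = t * polar v w"
  using disp_line[of t v w] disp_scale[of t v] by (simp add: polar_def power_mult_distrib field_simps)

lemma polar_scale_right: "polar v (t *\<^sub>R w) = t * polar v w"
  using polar_scale_left polar_commute by metis

lemma polar_add_left: "polar (v + w) u = polar v u + polar w u"
  using polar_add_right polar_commute by metis

lemma polar_minus: "polar (- v) w = - polar v w" "polar v (- w) = - polar v w"
  using polar_scale_left[of "-1" v w] polar_scale_right[of v "-1" w] by simp_all

lemma polar_diff: "polar (u - v) w = polar u w - polar v w" "polar w (u - v) = polar w u - polar w v"
  using polar_add_left[of u "- v" w] polar_add_right[of w u "- v"] by (simp_all add: polar_minus)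

lemmas polar_simps = polar_add_left polar_add_right polar_diff polar_minus polar_scale_left polar_scale_right

end

section \<open>The flat of a commuting family\<close>

context hadamard_action
begin

lemma flow_Min_commuting:
  assumes g: "g \<in> carrier G" and h: "h \<in> carrier G" and gh: "g \<otimes> h = h \<otimes> g"
    and x: "x \<in> Min g" "x \<in> Min h"
  shows "flow g t x \<in> Min h"
  using flow_commute[OF g h gh x(1), of t] flow_isometric[OF g x(1) Min_commute[OF g h gh x(1)], of t]
    Min_dist[OF x(2)] flow_closed[OF g x(1)] by (simp add: min_set_def)

lemma flow_flow_commute:
  assumes g: "g \<in> carrier G" and h: "h \<in> carrier G" and gh: "g \<otimes> h = h \<otimes> g"
    and x: "x \<in> Min g" "x \<in> Min h"
  shows "flow g s (flow h t x) = flow h t (flow g s x)"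
proof (rule flow_eqI[OF g])
  show "flow h t x \<in> Min g" using flow_Min_commuting[OF h g gh[symmetric] x(2,1)] .
  have M: "flow g s x \<in> Min h" using flow_Min_commuting[OF g h gh x] .
  have "dist (\<phi> (g [^] n) (flow h t x)) (flow h t (flow g s x)) = len g * \<bar>s - real_of_int n\<bar>" for n :: int
  proof -
    have c: "h \<otimes> g [^] n = g [^] n \<otimes> h" "g [^] n \<in> carrier G" using commute_int_pow[OF g h gh, of n] g by simp_all
    have "dist (\<phi> (g [^] n) (flow h t x)) (flow h t (flow g s x)) = dist (\<phi> (g [^] n) x) (flow g s x)"
      using flow_isometric[OF h Min_commute[OF h c(2,1) x(2)] M, of t] flow_commute[OF h c(2,1) x(2)] by simp
    then show ?thesis using flow_on_axis[OF g x(1), of s] by (simp add: on_axis_def)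
  qed
  then show "on_axis g s (flow h t x) (flow h t (flow g s x))"
    using flow_closed[OF h M] by (simp add: on_axis_def)
qed

context
  fixes a :: "'n::finite \<Rightarrow> _"
  assumes a: "\<And>i. a i \<in> carrier G" and comm: "\<And>i j. a i \<otimes> a j = a j \<otimes> a i"
begin

text \<open>The coordinates are applied one after the other, in the order of a list. It does not matter which order is used,
  because the flows commute.\<close>

definition multiflow where "multiflow js v x = foldr (\<lambda>i. flow (a i) (v $ i)) js x"

lemma C_Min: "x \<in> common_Min (range a) \<Longrightarrow> x \<in> Min (a i)" by (simp add: common_Min_def)

lemma flow_C: "x \<in> common_Min (range a) \<Longrightarrow> flow (a i) t x \<in> common_Min (range a)"
  using flow_Min_commuting[OF a a comm C_Min C_Min] flow_closed[OF a C_Min] by (auto simp: common_Min_def)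

lemma multiflow_C: "x \<in> common_Min (range a) \<Longrightarrow> multiflow js v x \<in> common_Min (range a)"
  by (induction js) (auto simp: multiflow_def flow_C)

lemma flow_multiflow: "x \<in> common_Min (range a) \<Longrightarrow> flow (a i) t (multiflow js v x) = multiflow js v (flow (a i) t x)"
proof (induction js)
  case (Cons j ks)
  have M: "multiflow ks v x \<in> common_Min (range a)" using multiflow_C Cons.prems by blast
  show ?case using flow_flow_commute[OF a a comm C_Min[OF M] C_Min[OF M], of i t j "v $ j"] Cons by (simp add: multiflow_def)
qed (simp add: multiflow_def)

lemma multiflow_isometric:
  "x \<in> common_Min (range a) \<Longrightarrow> y \<in> common_Min (range a) \<Longrightarrow> dist (multiflow js v x) (multiflow js v y) = dist x y"
proof (induction js)
  case (Cons j ks)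
  show ?case
    using flow_isometric[OF a C_Min[OF multiflow_C] C_Min[OF multiflow_C], OF Cons.prems, of j "v $ j" ks v ks v] Cons
    by (simp add: multiflow_def)
qed (simp add: multiflow_def)

lemma multiflow_add: "x \<in> common_Min (range a) \<Longrightarrow> multiflow js (v + w) x = multiflow js v (multiflow js w x)"
proof (induction js)
  case (Cons j ks)
  have M: "multiflow ks w x \<in> common_Min (range a)" "multiflow ks v (multiflow ks w x) \<in> common_Min (range a)"
    using multiflow_C Cons.prems by blast+
  show ?case
    using Cons flow_add[OF a C_Min[OF M(2)], of j "v $ j" "w $ j"] flow_multiflow[OF M(1), of j "w $ j" ks v]
    by (simp add: multiflow_def)
qed (simp add: multiflow_def)

lemma multiflow_axis:
  "x \<in> common_Min (range a) \<Longrightarrow> distinct js \<Longrightarrow> multiflow js (t *\<^sub>R axis i 1) x = (if i \<in> set js then flow (a i) t x else x)"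
proof (induction js)
  case (Cons j ks)
  then show ?case
    using flow_0[OF a C_Min[OF Cons.prems(1)], of j] flow_0[OF a C_Min[OF flow_C[OF Cons.prems(1)]], of j]
    by (auto simp: multiflow_def axis_def)
qed (simp add: multiflow_def)

end

text \<open>A form of the flat torus theorem: commuting semisimple isometries extend to an action of \<open>\<real>\<^sup>n\<close> on the intersection of their minimal sets.\<close>

lemma commuting_flat_action:
  fixes a :: "'n::finite \<Rightarrow> _"
  assumes a: "\<And>i. a i \<in> carrier G" and comm: "\<And>i j. a i \<otimes> a j = a j \<otimes> a i"
  obtains C T where "flat_action X C (T :: real^'n \<Rightarrow> _)" "\<And>i x. x \<in> C \<Longrightarrow> T (axis i 1) x = \<phi> (a i) x"
proof -
  obtain js :: "'n list" where js: "set js = UNIV" "distinct js" using finite_distinct_list[of "UNIV :: 'n set"] by auto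
  let ?C = "common_Min (range a)" and ?T = "multiflow a js"
  have axis: "?T (t *\<^sub>R axis i 1) x = flow (a i) t x" if "x \<in> ?C" for i t x
    using multiflow_axis[OF a comm that js(2)] js by simp
  interpret vector_action X ?C ?T
  proof
    show "?C \<subseteq> X" by (auto simp: common_Min_def)
    show "?C \<noteq> {}" using a comm by (intro common_Min_nonempty) auto
    show "?T 0 x = x" if "x \<in> ?C" for x
      using axis[OF that, of 0] flow_0[OF a] that by (simp add: common_Min_def)
  qed (rule multiflow_C[OF a comm] multiflow_add[OF a comm] multiflow_isometric[OF a comm]; assumption)+
  have axis_dir: "geodesic_dir (axis i 1)" for i
  proof (rule geodesic_dirI)
    fix x t assume x: "x \<in> ?C"
    then have M: "x \<in> Min (a i)" by (simp add: common_Min_def)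
    show "dist x (?T (t *\<^sub>R axis i 1) x) = \<bar>t\<bar> * dist x (?T (axis i 1) x)"
      using axis[OF x, of t i] axis[OF x, of 1 i] flow_dist[OF a M, of 0] flow_0[OF a M] by simp
  qed
  have "span (range (\<lambda>i. axis i 1 :: real^'n)) = UNIV"
  proof -
    have "(Basis :: (real^'n) set) = range (\<lambda>i. axis i 1)" by (auto simp: Basis_vec_def)
    then show ?thesis using span_Basis by metis
  qed
  then have "geodesic_dir v" for v
    using geodesic_dir_span[of "range (\<lambda>i. axis i 1)" v] axis_dir by blast
  then have "flat_action X ?C ?T" by unfold_locales
  moreover have "?T (axis i 1) x = \<phi> (a i) x" if "x \<in> ?C" for i x
    using axis[OF that, of 1 i] flow_1[OF a] that by (simp add: common_Min_def)
  ultimately show ?thesis using that by blast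
qed

text \<open>The displacement of points of \<open>C\<close> by powers of \<open>g\<close> is linear in the exponent, so no point of \<open>X\<close> is moved less than the points
  of \<open>C\<close>. Thus \<open>disp\<close> depends only on the conjugacy class of \<open>g\<close>.\<close>

lemma flat_action_len:
  assumes "flat_action X C T" and g: "g \<in> carrier G" and gT: "\<And>x. x \<in> C \<Longrightarrow> \<phi> g x = T v x"
  shows "C \<subseteq> Min g" "len g = flat_action.disp C T v"
proof -
  interpret flat_action X C T by fact
  obtain x where x: "x \<in> C" using C_nonempty by blast
  then have xX: "x \<in> X" using CX by blast
  have pow: "\<phi> (g [^] n) x = T (real n *\<^sub>R v) x" for n :: nat
  proof (induction n)
    case (Suc n)
    have "\<phi> (g [^] Suc n) x = \<phi> g (\<phi> (g [^] n) x)"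
      using act_mult[of g "g [^] n" x] g xX nat_pow_Suc2[OF g] by simp
    then show ?case using Suc gT[OF T_closed[OF x]] T_add[OF x, of v "real n *\<^sub>R v"]
      by (simp add: scaleR_left_distrib add.commute)
  qed (use x xX T_zero in simp)
  have low: "disp v \<le> dist z (\<phi> g z)" if z: "z \<in> X" for z
  proof -
    have "(disp v - dist z (\<phi> g z)) * real n \<le> 2 * dist x z" for n
    proof -
      have "real n * disp v = dist x (\<phi> (g [^] n) x)" unfolding pow by (simp add: disp[OF x] disp_scale)
      also have "\<dots> \<le> dist x z + dist z (\<phi> (g [^] n) z) + dist (\<phi> (g [^] n) z) (\<phi> (g [^] n) x)"
        using dist_triangle[of x "\<phi> (g [^] n) x" z] dist_triangle[of z "\<phi> (g [^] n) x" "\<phi> (g [^] n) z"]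
        by linarith
      also have "\<dots> \<le> dist x z + real n * dist z (\<phi> g z) + dist z x"
        using dist_nat_pow_le[OF g z, of n] isometric[of "g [^] n" z x] g z xX by simp
      finally show ?thesis by (simp add: dist_commute algebra_simps)
    qed
    then have "disp v - dist z (\<phi> g z) \<le> 0" by (rule bounded_slope_nonpos)
    then show ?thesis by simp
  qed
  show M: "C \<subseteq> Min g"
    using low disp gT CX by (auto simp: Min_iff)
  then show "len g = disp v" using Min_dist[of x g] disp[OF x, of v] gT[OF x] x by auto
qed

lemma len_conj:
  assumes g: "g \<in> carrier G" and h: "h \<in> carrier G" "h' \<in> carrier G" and eq: "g \<otimes> h = h' \<otimes> g"
  shows "len h = len h'"
proof -
  have d: "dist (\<phi> g z) (\<phi> h' (\<phi> g z)) = dist z (\<phi> h z)" if "z \<in> X" for z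
    using isometric[OF g that, of "\<phi> h z"] act_mult[OF g h(1) that] act_mult[OF h(2) g that] eq h that by simp
  obtain x where x: "x \<in> Min h" using min_set_nonempty h by blast
  have 1: "len h' \<le> len h"
    using d[of x] len_le[of "\<phi> g x" h'] Min_dist[OF x] Min_subset[OF x] g by simp
  obtain y where y: "y \<in> Min h'" using min_set_nonempty h by blast
  have "len h \<le> len h'"
    using d[of "\<phi> (inv g) y"] len_le[of "\<phi> (inv g) y" h] Min_dist[OF y] Min_subset[OF y] g by simp
  then show ?thesis using 1 by simp
qed

lemma len_inv:
  assumes g: "g \<in> carrier G" shows "len (inv g) = len g"
proof -
  have "len (inv g) \<le> len g" if g: "g \<in> carrier G" for g
  proof -
    obtain x where x: "x \<in> Min g" using min_set_nonempty g by blast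
    show ?thesis
      using len_le[of "\<phi> g x" "inv g"] Min_dist[OF x] Min_subset[OF x] g by (simp add: dist_commute)
  qed
  from this[OF g] this[of "inv g"] show ?thesis using g by simp
qed

end

locale flat_group_action = hadamard_action X G \<phi> + flat_action X C T
  for X :: "'x::metric_space set" and G (structure) and \<phi> and C and T :: "'v::real_vector \<Rightarrow> 'x \<Rightarrow> 'x"
begin

text \<open>The element \<open>g\<close> acts on \<open>C\<close> as the translation by \<open>v\<close>. The vector \<open>v\<close> need not be unique: the form \<open>polar\<close> may be degenerate.\<close>

definition acts_as where "acts_as g v \<longleftrightarrow> g \<in> carrier G \<and> (\<forall>x\<in>C. \<phi> g x = T v x)"

lemma acts_as_mult: "acts_as g v \<Longrightarrow> acts_as h w \<Longrightarrow> acts_as (g \<otimes> h) (v + w)"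
  using CX T_closed T_add act_mult[of g h] by (auto simp: acts_as_def subset_iff)

lemma acts_as_one: "acts_as \<one> 0"
  using CX T_zero by (auto simp: acts_as_def subset_iff)

lemma acts_as_inv: assumes "acts_as g v" shows "acts_as (inv g) (- v)"
proof -
  have g: "g \<in> carrier G" and gv: "\<And>x. x \<in> C \<Longrightarrow> \<phi> g x = T v x" using assms by (auto simp: acts_as_def)
  have "\<phi> (inv g) x = T (- v) x" if x: "x \<in> C" for x
  proof -
    have "\<phi> g (T (- v) x) = x"
      using gv[OF T_closed[OF x]] T_add[OF x, of v "- v"] T_zero[OF x] by simp
    then show ?thesis using act_inv(1)[OF g, of "T (- v) x"] T_closed[OF x] CX by auto
  qed
  then show ?thesis using g by (simp add: acts_as_def)
qed

lemma acts_as_len: "acts_as g v \<Longrightarrow> len g = disp v"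
  using flat_action_len(2)[OF flat_action_axioms] by (simp add: acts_as_def)

lemma acts_as_Min: "acts_as g v \<Longrightarrow> C \<subseteq> Min g"
  using flat_action_len(1)[OF flat_action_axioms] unfolding acts_as_def by blast

lemma commutator_polar:
  assumes d: "acts_as d v" and c: "acts_as c w" "d \<otimes> c = c \<otimes> d"
    and g: "g \<in> carrier G" "d \<otimes> g = g \<otimes> d" and h: "h \<in> carrier G" "d \<otimes> h = h \<otimes> d"
    and comm: "g \<otimes> h = h \<otimes> g \<otimes> c"
  shows "polar v w = 0"
proof -
  obtain x where x: "x \<in> C" using C_nonempty by blast
  have carr: "d \<in> carrier G" "c \<in> carrier G" using c d by (auto simp: acts_as_def)
  have "x \<in> Min d" using acts_as_Min[OF d] x by blast
  from commutator_orthogonal[OF carr(1) this g h carr(2) c(2) comm]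
  have "(disp (v + w))\<^sup>2 = (disp v)\<^sup>2 + (disp w)\<^sup>2"
    using acts_as_mult[OF d c(1)] d c(1) x disp[OF x] by (simp add: acts_as_def)
  then show ?thesis by (simp add: polar_def)
qed

end

lemma (in hadamard_action) flat_group_actionI:
  "flat_action X C T \<Longrightarrow> flat_group_action X G \<phi> C T"
  by (intro flat_group_action.intro hadamard_action_axioms)

section \<open>Relations between automorphisms of the free group\<close>

interpretation AutF3: group AutF3 by (rule group_AutF3)

lemma AutF3_carrier: "carrier AutF3 = auto F3"
  by (simp add: AutoGroup_def)

lemma AutF3_apply:
  assumes "f \<in> carrier AutF3" "g \<in> carrier AutF3" "w \<in> carrier F3"
  shows "(f \<otimes>\<^bsub>AutF3\<^esub> g) w = f (g w)"
  using assms by (simp add: AutoGroup_def BijGroup_def auto_def compose_def)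

lemma AutF3_one: "w \<in> carrier F3 \<Longrightarrow> \<one>\<^bsub>AutF3\<^esub> w = w"
  by (simp add: AutoGroup_def BijGroup_def)

lemma AutF3_group_hom: "f \<in> carrier AutF3 \<Longrightarrow> group_hom F3 F3 f"
  by (simp add: AutF3_carrier auto_def group_hom_def group_hom_axioms_def group_free_group)

lemma AutF3_closed: "f \<in> carrier AutF3 \<Longrightarrow> w \<in> carrier F3 \<Longrightarrow> f w \<in> carrier F3"
  using group_hom.hom_closed[OF AutF3_group_hom] .

lemma AutF3_mult:
  "f \<in> carrier AutF3 \<Longrightarrow> v \<in> carrier F3 \<Longrightarrow> w \<in> carrier F3 \<Longrightarrow> f (v \<otimes>\<^bsub>F3\<^esub> w) = f v \<otimes>\<^bsub>F3\<^esub> f w"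
  using group_hom.hom_mult[OF AutF3_group_hom] .

lemma AutF3_inv:
  "f \<in> carrier AutF3 \<Longrightarrow> w \<in> carrier F3 \<Longrightarrow> f (inv\<^bsub>F3\<^esub> w) = inv\<^bsub>F3\<^esub> (f w)"
  using group_hom.hom_inv[OF AutF3_group_hom] .

lemmas AutF3_simps = AutF3_apply AutF3_closed AutF3_mult AutF3_inv

text \<open>Equations between automorphisms can be checked on the basis; the relations below are all proved in this way.\<close>

lemma AutF3_eqI:
  assumes f: "f \<in> carrier AutF3" and g: "g \<in> carrier AutF3" and eq: "\<And>i. f (basis_elt i) = g (basis_elt i)"
  shows "f = g"
proof -
  let ?h = "inv\<^bsub>AutF3\<^esub> g \<otimes>\<^bsub>AutF3\<^esub> f"
  have inv: "(inv\<^bsub>AutF3\<^esub> g) (g w) = w" if "w \<in> carrier F3" for w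
    using AutF3_apply[of "inv\<^bsub>AutF3\<^esub> g" g w] g that by (simp add: AutF3_one)
  have "?h (basis_elt i) = basis_elt i" for i
    using f g eq inv by (simp add: AutF3_apply)
  moreover have "?h \<in> hom F3 F3"
    using f g group_hom.homh[OF AutF3_group_hom[of ?h]] by simp
  ultimately have "?h w = w" if "w \<in> carrier F3" for w
    using hom_id that by blast
  moreover have "?h \<in> extensional (carrier F3)"
    using AutF3.m_closed[OF AutF3.inv_closed[OF g] f] by (auto simp: AutF3_carrier auto_def Bij_def)
  moreover have "\<one>\<^bsub>AutF3\<^esub> \<in> extensional (carrier F3)"
    by (simp add: AutoGroup_def BijGroup_def)
  ultimately have "?h = \<one>\<^bsub>AutF3\<^esub>"
    using AutF3_one by (intro extensionalityI[of _ "carrier F3"]) auto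
  moreover have "g \<otimes>\<^bsub>AutF3\<^esub> ?h = f" using f g by (simp flip: AutF3.m_assoc)
  ultimately show ?thesis using g by simp
qed

lemma nielsen_closed:
  assumes "i \<noteq> j" shows "nielsen_left i j \<in> carrier AutF3" "nielsen_right i j \<in> carrier AutF3"
  using nielsen_left_auto[OF assms] nielsen_right_auto[OF assms] by (simp_all add: AutF3_carrier)

lemma nielsen_basis:
  "nielsen_left i j (basis_elt k) = (if k = i then basis_elt j \<otimes>\<^bsub>F3\<^esub> basis_elt i else basis_elt k)"
  "nielsen_right i j (basis_elt k) = (if k = i then basis_elt i \<otimes>\<^bsub>F3\<^esub> basis_elt j else basis_elt k)"
  unfolding nielsen_left_def nielsen_right_def by (subst endo_basis; simp)+

definition invert_basis :: "3 \<Rightarrow> 3 letter_word \<Rightarrow> 3 letter_word" where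
  "invert_basis i = endo_of (\<lambda>k. if k = i then inv\<^bsub>F3\<^esub> (basis_elt i) else basis_elt k)"

definition permute_basis :: "(3 \<Rightarrow> 3) \<Rightarrow> 3 letter_word \<Rightarrow> 3 letter_word" where
  "permute_basis \<sigma> = endo_of (\<lambda>k. basis_elt (\<sigma> k))"

definition inner_aut :: "3 \<Rightarrow> 3 letter_word \<Rightarrow> 3 letter_word" where
  "inner_aut j = (\<lambda>w\<in>carrier F3. basis_elt j \<otimes>\<^bsub>F3\<^esub> w \<otimes>\<^bsub>F3\<^esub> inv\<^bsub>F3\<^esub> (basis_elt j))"

lemma inner_aut_apply: "w \<in> carrier F3 \<Longrightarrow> inner_aut j w = basis_elt j \<otimes>\<^bsub>F3\<^esub> w \<otimes>\<^bsub>F3\<^esub> inv\<^bsub>F3\<^esub> (basis_elt j)"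
  by (simp add: inner_aut_def)

lemma invert_basis_basis: "invert_basis i (basis_elt k) = (if k = i then inv\<^bsub>F3\<^esub> (basis_elt i) else basis_elt k)"
  unfolding invert_basis_def by (subst endo_basis) simp_all

lemma permute_basis_basis: "permute_basis \<sigma> (basis_elt k) = basis_elt (\<sigma> k)"
  unfolding permute_basis_def by (subst endo_basis) simp_all

lemma endo_of_group_hom: "(\<And>x. f x \<in> carrier F3) \<Longrightarrow> group_hom F3 F3 (endo_of f)"
  by (simp add: group_hom_def group_hom_axioms_def group_free_group endo_hom)

lemma invert_basis_closed: "invert_basis i \<in> carrier AutF3"
proof -
  let ?f = "\<lambda>k. if k = i then inv\<^bsub>F3\<^esub> (basis_elt i) else basis_elt k"
  have f: "?f k \<in> carrier F3" for k by simp
  have h: "endo_of ?f \<in> hom F3 F3" by (rule endo_hom[OF f])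
  have "endo_of ?f (endo_of ?f (basis_elt x)) = basis_elt x" for x
    using endo_basis[of ?f, OF f] group_hom.hom_inv[OF endo_of_group_hom[of ?f, OF f], of "basis_elt i"] by simp
  then show ?thesis unfolding AutF3_carrier invert_basis_def
    by (intro auto_by_inverse[OF h h endo_ext])
qed

lemma permute_basis_closed: assumes "bij \<sigma>" shows "permute_basis \<sigma> \<in> carrier AutF3"
  unfolding AutF3_carrier permute_basis_def
proof (rule auto_by_inverse[OF _ _ endo_ext])
  show "endo_of (\<lambda>k. basis_elt (\<sigma> k)) \<in> hom F3 F3" "endo_of (\<lambda>k. basis_elt (inv_into UNIV \<sigma> k)) \<in> hom F3 F3"
    by (rule endo_hom, simp)+
qed (use assms in \<open>simp_all add: endo_basis bij_is_surj bij_is_inj surj_f_inv_f inv_f_f\<close>)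

lemma inner_aut_closed: "inner_aut j \<in> carrier AutF3"
  unfolding AutF3_carrier
proof (rule auto_by_inverse)
  let ?k = "\<lambda>w\<in>carrier F3. inv\<^bsub>F3\<^esub> (basis_elt j) \<otimes>\<^bsub>F3\<^esub> w \<otimes>\<^bsub>F3\<^esub> basis_elt j"
  have c: "u \<otimes>\<^bsub>F3\<^esub> (inv\<^bsub>F3\<^esub> u \<otimes>\<^bsub>F3\<^esub> w) = w" "inv\<^bsub>F3\<^esub> u \<otimes>\<^bsub>F3\<^esub> (u \<otimes>\<^bsub>F3\<^esub> w) = w"
    if "u \<in> carrier F3" "w \<in> carrier F3" for u w
    using that by (simp_all flip: FG.m_assoc)
  show "inner_aut j \<in> hom F3 F3" "?k \<in> hom F3 F3"
    by (rule homI; simp add: inner_aut_def FG.m_assoc c)+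
  show "inner_aut j \<in> extensional (carrier F3)" by (simp add: inner_aut_def)
  show "inner_aut j (?k (basis_elt x)) = basis_elt x" "?k (inner_aut j (basis_elt x)) = basis_elt x" for x
    by (simp_all add: inner_aut_def FG.m_assoc c)
qed

lemmas gen_closed = nielsen_closed invert_basis_closed permute_basis_closed inner_aut_closed
lemmas gen_basis = nielsen_basis invert_basis_basis permute_basis_basis

lemma nielsen_commute:
  assumes "i \<noteq> j" "k \<noteq> j"
  shows "nielsen_left i j \<otimes>\<^bsub>AutF3\<^esub> nielsen_left k j = nielsen_left k j \<otimes>\<^bsub>AutF3\<^esub> nielsen_left i j"
    and "nielsen_right i j \<otimes>\<^bsub>AutF3\<^esub> nielsen_right k j = nielsen_right k j \<otimes>\<^bsub>AutF3\<^esub> nielsen_right i j"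
    and "nielsen_left i j \<otimes>\<^bsub>AutF3\<^esub> nielsen_right k j = nielsen_right k j \<otimes>\<^bsub>AutF3\<^esub> nielsen_left i j"
  by (rule AutF3_eqI; use assms in \<open>simp add: gen_closed AutF3_simps gen_basis FG.m_assoc\<close>)+

lemma nielsen_left_right_commute:
  assumes "i \<noteq> k" "j \<noteq> k"
  shows "nielsen_left k j \<otimes>\<^bsub>AutF3\<^esub> nielsen_right k i = nielsen_right k i \<otimes>\<^bsub>AutF3\<^esub> nielsen_left k j"
  by (rule AutF3_eqI; use assms in \<open>simp add: gen_closed AutF3_simps gen_basis FG.m_assoc\<close>)

text \<open>All three factors commute with \<open>nielsen_left k j\<close>, which makes \<open>nielsen_right k j\<close> a commutator in its centralizer.\<close>

lemma nielsen_right_commutator: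
  assumes "i \<noteq> j" "j \<noteq> k" "i \<noteq> k"
  shows "nielsen_right i j \<otimes>\<^bsub>AutF3\<^esub> nielsen_right k i
    = nielsen_right k i \<otimes>\<^bsub>AutF3\<^esub> nielsen_right i j \<otimes>\<^bsub>AutF3\<^esub> nielsen_right k j"
  by (rule AutF3_eqI; use assms in \<open>simp add: gen_closed AutF3_simps gen_basis FG.m_assoc\<close>)

text \<open>All three factors fix the basis element \<open>j\<close>, so they commute with \<open>inner_aut j\<close>.\<close>

lemma nielsen_left_commutator:
  assumes "i \<noteq> j" "j \<noteq> k" "i \<noteq> k"
  shows "nielsen_left k j \<otimes>\<^bsub>AutF3\<^esub> nielsen_left i k
    = nielsen_left i k \<otimes>\<^bsub>AutF3\<^esub> nielsen_left k j \<otimes>\<^bsub>AutF3\<^esub> nielsen_left i j"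
  by (rule AutF3_eqI; use assms in \<open>simp add: gen_closed AutF3_simps gen_basis FG.m_assoc\<close>)

lemma other_index:
  fixes i j k l :: 3 assumes "i \<noteq> j" "j \<noteq> k" "i \<noteq> k" "l \<noteq> i" "l \<noteq> k" shows "l = j"
  using assms exhaust_3[of i] exhaust_3[of j] exhaust_3[of k] exhaust_3[of l] by metis

lemma inner_aut_decomposition:
  assumes "i \<noteq> j" "j \<noteq> k" "i \<noteq> k"
  shows "inner_aut j \<otimes>\<^bsub>AutF3\<^esub> (nielsen_right i j \<otimes>\<^bsub>AutF3\<^esub> nielsen_right k j)
    = nielsen_left i j \<otimes>\<^bsub>AutF3\<^esub> nielsen_left k j"
proof (rule AutF3_eqI)
  fix l
  show "(inner_aut j \<otimes>\<^bsub>AutF3\<^esub> (nielsen_right i j \<otimes>\<^bsub>AutF3\<^esub> nielsen_right k j)) (basis_elt l)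
      = (nielsen_left i j \<otimes>\<^bsub>AutF3\<^esub> nielsen_left k j) (basis_elt l)"
    using assms other_index[OF assms, of l]
    by (cases "l = i \<or> l = k") (auto simp add: gen_closed AutF3_simps gen_basis inner_aut_apply FG.m_assoc)
qed (use assms in \<open>simp_all add: gen_closed\<close>)

lemma inner_aut_commute:
  assumes f: "f \<in> carrier AutF3" "f (basis_elt j) = basis_elt j"
  shows "inner_aut j \<otimes>\<^bsub>AutF3\<^esub> f = f \<otimes>\<^bsub>AutF3\<^esub> inner_aut j"
  by (rule AutF3_eqI) (use f in \<open>simp_all add: gen_closed AutF3_simps inner_aut_apply\<close>)

lemma invert_basis_nielsen_left:
  assumes "i \<noteq> j"
  shows "invert_basis i \<otimes>\<^bsub>AutF3\<^esub> nielsen_left i j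
    = inv\<^bsub>AutF3\<^esub> (nielsen_right i j) \<otimes>\<^bsub>AutF3\<^esub> invert_basis i"
proof -
  have "nielsen_right i j \<otimes>\<^bsub>AutF3\<^esub> (invert_basis i \<otimes>\<^bsub>AutF3\<^esub> nielsen_left i j) = invert_basis i"
    by (rule AutF3_eqI)
      (use assms in \<open>simp_all add: gen_closed AutF3_simps gen_basis FG.inv_mult_group flip: FG.m_assoc\<close>)
  then show ?thesis
    using assms AutF3.inv_solve_left[of "invert_basis i \<otimes>\<^bsub>AutF3\<^esub> nielsen_left i j" "nielsen_right i j" "invert_basis i"]
    by (simp add: gen_closed)
qed

lemma invert_basis_commute:
  assumes "k \<noteq> j" "k \<noteq> i" "j \<noteq> i"
  shows "invert_basis i \<otimes>\<^bsub>AutF3\<^esub> nielsen_left k j = nielsen_left k j \<otimes>\<^bsub>AutF3\<^esub> invert_basis i"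
    "invert_basis i \<otimes>\<^bsub>AutF3\<^esub> nielsen_right k j = nielsen_right k j \<otimes>\<^bsub>AutF3\<^esub> invert_basis i"
  by (rule AutF3_eqI; use assms in \<open>simp add: gen_closed AutF3_simps gen_basis FG.m_assoc\<close>)+

lemma permute_basis_nielsen_left:
  assumes "i \<noteq> j" and \<sigma>: "bij \<sigma>"
  shows "permute_basis \<sigma> \<otimes>\<^bsub>AutF3\<^esub> nielsen_left i j
    = nielsen_left (\<sigma> i) (\<sigma> j) \<otimes>\<^bsub>AutF3\<^esub> permute_basis \<sigma>"
proof -
  have "\<sigma> x = \<sigma> y \<longleftrightarrow> x = y" for x y using \<sigma> by (auto simp: bij_def inj_def)
  then show ?thesis
    by (intro AutF3_eqI) (use assms in \<open>auto simp: gen_closed AutF3_simps gen_basis\<close>)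
qed

lemma bij_3_exists:
  fixes i j k l :: 3 assumes "i \<noteq> j" "k \<noteq> l"
  obtains \<sigma> where "bij \<sigma>" "\<sigma> i = k" "\<sigma> j = l"
proof -
  let ?s = "Transposition.transpose i k" 
  let ?\<sigma> = "Transposition.transpose (?s j) l \<circ> ?s"
  have "?s j \<noteq> k" using assms by (auto simp: Transposition.transpose_def)
  then have "?\<sigma> i = k" "?\<sigma> j = l" using assms by (auto simp: Transposition.transpose_def)
  moreover have "bij ?\<sigma>" by (intro bij_comp) auto
  ultimately show ?thesis using that by blast
qed

section \<open>The face-centred cubic lattice\<close>

text \<open>The root lattice \<open>D\<^sub>3\<close>, scaled by \<open>k\<close>.\<close>

definition fcc_lattice :: "real \<Rightarrow> (real^3) set" where
  "fcc_lattice k = {k *\<^sub>R vector [real_of_int a, real_of_int b, real_of_int c] | a b c. even (a + b + c)}"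

lemma inner_3: "(x :: real^3) \<bullet> y = x $ 1 * y $ 1 + x $ 2 * y $ 2 + x $ 3 * y $ 3"
  by (simp add: inner_vec_def sum_3)

lemma norm_le_norm_diff_iff: "norm x \<le> norm (x - v) \<longleftrightarrow> 2 * (x \<bullet> v) \<le> v \<bullet> v" for x v :: "'a::real_inner"
  by (simp add: norm_le inner_simps inner_commute)

text \<open>If \<open>a \<le> b + c\<close>, then \<open>(a, b, c)\<close> is a nonnegative combination of the three vectors of the shape \<open>(1, 1, 0)\<close>, and
  the assumptions on \<open>x, y, z\<close> bound the left side by \<open>a + b + c\<close>. Otherwise they bound it by \<open>2 a\<close>, which is
  at most \<open>a\<^sup>2\<close> except for \<open>a = 1\<close>, a case that is excluded by parity.\<close>

lemma fcc_bound_sorted: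
  fixes x y z :: real and a b c :: int
  assumes "0 \<le> x" "0 \<le> y" "0 \<le> z" "x + y \<le> 1" "y + z \<le> 1" "x + z \<le> 1"
    and abc: "0 \<le> a" "0 \<le> b" "0 \<le> c" "b \<le> a" "c \<le> a" and ev: "even (a + b + c)"
  shows "2 * (x * a + y * b + z * c) \<le> a\<^sup>2 + b\<^sup>2 + c\<^sup>2"
proof (cases "a \<le> b + c")
  case True
  have sq: "n \<le> n\<^sup>2" if "0 \<le> n" for n :: int using self_le_power[of n 2] that by (cases "n = 0") auto
  have "2 * (x * a + y * b + z * c)
      = (x + y) * real_of_int (a + b - c) + (y + z) * real_of_int (b + c - a) + (x + z) * real_of_int (a + c - b)" by (simp add: algebra_simps)
  also have "\<dots> \<le> 1 * real_of_int (a + b - c) + 1 * real_of_int (b + c - a) + 1 * real_of_int (a + c - b)"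
    using assms True by (intro add_mono mult_right_mono) auto
  also have "\<dots> = real_of_int (a + b + c)" by simp
  also have "\<dots> \<le> real_of_int (a\<^sup>2 + b\<^sup>2 + c\<^sup>2)"
    unfolding of_int_le_iff using sq abc by (intro add_mono) auto
  finally show ?thesis by simp
next
  case False
  have "a \<noteq> 1"
  proof
    assume "a = 1"
    then have "b = 0" "c = 0" using False abc by auto
    then show False using ev \<open>a = 1\<close> by simp
  qed
  then have a2: "2 \<le> a" using False abc by linarith
  have "2 * (x * a + y * b + z * c)
      = 2 * ((x + y) * real_of_int b + (x + z) * real_of_int c + x * real_of_int (a - b - c))" by (simp add: algebra_simps)
  also have "\<dots> \<le> 2 * (1 * real_of_int b + 1 * real_of_int c + 1 * real_of_int (a - b - c))"
    using assms False by (intro mult_left_mono add_mono mult_right_mono) auto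
  also have "\<dots> = real_of_int (2 * a)" by simp
  also have "\<dots> \<le> real_of_int (a\<^sup>2 + b\<^sup>2 + c\<^sup>2)"
  proof -
    have "2 * a \<le> a\<^sup>2" using a2 by (simp add: power2_eq_square mult_right_mono)
    moreover have "0 \<le> b\<^sup>2" "0 \<le> c\<^sup>2" by simp_all
    ultimately show ?thesis unfolding of_int_le_iff by linarith
  qed
  finally show ?thesis by simp
qed

lemma fcc_bound_nonneg:
  fixes x y z :: real and a b c :: int
  assumes x: "0 \<le> x" "0 \<le> y" "0 \<le> z" "x + y \<le> 1" "y + z \<le> 1" "x + z \<le> 1"
    and abc: "0 \<le> a" "0 \<le> b" "0 \<le> c" and ev: "even (a + b + c)"
  shows "2 * (x * a + y * b + z * c) \<le> a\<^sup>2 + b\<^sup>2 + c\<^sup>2"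
proof -
  consider "b \<le> a" "c \<le> a" | "a \<le> b" "c \<le> b" | "a \<le> c" "b \<le> c" by linarith
  then show ?thesis
  proof cases
    case 1
    then show ?thesis using fcc_bound_sorted[of x y z a b c] assms by simp
  next
    case 2
    then have "2 * (y * b + x * a + z * c) \<le> b\<^sup>2 + a\<^sup>2 + c\<^sup>2"
      using assms by (intro fcc_bound_sorted) (auto simp: add.commute)
    then show ?thesis by (simp add: add.commute)
  next
    case 3
    then have "2 * (z * c + y * b + x * a) \<le> c\<^sup>2 + b\<^sup>2 + a\<^sup>2"
      using assms by (intro fcc_bound_sorted) (auto simp: add.commute)
    then show ?thesis by (simp add: ac_simps)
  qed
qed

lemma fcc_bound:
  fixes x y z :: real and a b c :: int
  assumes "\<bar>x\<bar> + \<bar>y\<bar> \<le> 1" "\<bar>y\<bar> + \<bar>z\<bar> \<le> 1" "\<bar>x\<bar> + \<bar>z\<bar> \<le> 1" and ev: "even (a + b + c)"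
  shows "2 * (x * a + y * b + z * c) \<le> a\<^sup>2 + b\<^sup>2 + c\<^sup>2"
proof -
  have "2 * (\<bar>x\<bar> * \<bar>a\<bar> + \<bar>y\<bar> * \<bar>b\<bar> + \<bar>z\<bar> * \<bar>c\<bar>) \<le> \<bar>a\<bar>\<^sup>2 + \<bar>b\<bar>\<^sup>2 + \<bar>c\<bar>\<^sup>2"
    using fcc_bound_nonneg[of "\<bar>x\<bar>" "\<bar>y\<bar>" "\<bar>z\<bar>" "\<bar>a\<bar>" "\<bar>b\<bar>" "\<bar>c\<bar>"] assms by simp
  moreover have "x * real_of_int a + y * real_of_int b + z * real_of_int c
      \<le> \<bar>x\<bar> * \<bar>a\<bar> + \<bar>y\<bar> * \<bar>b\<bar> + \<bar>z\<bar> * \<bar>c\<bar>"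
    unfolding of_int_abs abs_mult[symmetric] by (intro add_mono abs_ge_self)
  ultimately have "2 * (x * real_of_int a + y * real_of_int b + z * real_of_int c)
      \<le> real_of_int (\<bar>a\<bar>\<^sup>2 + \<bar>b\<bar>\<^sup>2 + \<bar>c\<bar>\<^sup>2)"
    by (meson mult_left_mono order_trans zero_le_numeral)
  then show ?thesis by simp
qed

text \<open>The twelve shortest lattice vectors already give all inequalities on the right.\<close>

lemma dirichlet_domain_fcc_unit:
  "dirichlet_domain (fcc_lattice 1) = {x. \<bar>x $ 1\<bar> + \<bar>x $ 2\<bar> \<le> 1 \<and> \<bar>x $ 2\<bar> + \<bar>x $ 3\<bar> \<le> 1 \<and> \<bar>x $ 1\<bar> + \<bar>x $ 3\<bar> \<le> 1}"
proof (rule equalityI; rule subsetI)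
  fix x :: "real^3" assume "x \<in> dirichlet_domain (fcc_lattice 1)"
  then have D: "2 * (x \<bullet> v) \<le> v \<bullet> v" if "v \<in> fcc_lattice 1" for v
    using that by (auto simp: dirichlet_domain_def norm_le_norm_diff_iff)
  have E: "2 * (x $ 1 * a + x $ 2 * b + x $ 3 * c) \<le> a * a + b * b + c * c" if "even (a + b + c)" for a b c :: int
    using D[of "vector [real_of_int a, real_of_int b, real_of_int c]"] that by (auto simp: fcc_lattice_def inner_3)
  show "x \<in> {x. \<bar>x $ 1\<bar> + \<bar>x $ 2\<bar> \<le> 1 \<and> \<bar>x $ 2\<bar> + \<bar>x $ 3\<bar> \<le> 1 \<and> \<bar>x $ 1\<bar> + \<bar>x $ 3\<bar> \<le> 1}"
    using E[of 1 1 0] E[of 1 "-1" 0] E[of "-1" 1 0] E[of "-1" "-1" 0]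
      E[of 0 1 1] E[of 0 1 "-1"] E[of 0 "-1" 1] E[of 0 "-1" "-1"]
      E[of 1 0 1] E[of 1 0 "-1"] E[of "-1" 0 1] E[of "-1" 0 "-1"] by auto
next
  fix x :: "real^3"
  assume "x \<in> {x. \<bar>x $ 1\<bar> + \<bar>x $ 2\<bar> \<le> 1 \<and> \<bar>x $ 2\<bar> + \<bar>x $ 3\<bar> \<le> 1 \<and> \<bar>x $ 1\<bar> + \<bar>x $ 3\<bar> \<le> 1}"
  then have x: "\<bar>x $ 1\<bar> + \<bar>x $ 2\<bar> \<le> 1" "\<bar>x $ 2\<bar> + \<bar>x $ 3\<bar> \<le> 1" "\<bar>x $ 1\<bar> + \<bar>x $ 3\<bar> \<le> 1" by auto
  show "x \<in> dirichlet_domain (fcc_lattice 1)"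
    unfolding dirichlet_domain_def norm_le_norm_diff_iff
  proof (intro CollectI ballI)
    fix v assume "v \<in> fcc_lattice 1"
    then obtain a b c :: int where v: "even (a + b + c)" "v = vector [real_of_int a, real_of_int b, real_of_int c]"
      by (auto simp: fcc_lattice_def)
    show "2 * (x \<bullet> v) \<le> v \<bullet> v" using fcc_bound[OF x v(1)] v(2) by (simp add: inner_3 power2_eq_square)
  qed
qed

lemma zero_in_rhombic: "0 \<in> standard_rhombic_dodecahedron"
proof -
  let ?S = "{axis i 1 | i. True} \<union> {- axis i 1 | i. True} \<union> {x :: real^3. \<forall>i. x $ i \<in> {1/2, -1/2}}"
  have "axis 1 1 \<in> ?S" "- axis 1 1 \<in> ?S" by blast+
  then have "axis 1 1 \<in> convex hull ?S" "- axis 1 1 \<in> convex hull ?S" by (auto intro: hull_inc)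
  then have "(1/2) *\<^sub>R axis 1 1 + (1/2) *\<^sub>R (- axis 1 1) \<in> convex hull ?S"
    by (rule convexD[OF convex_convex_hull]) auto
  then show ?thesis by (simp add: standard_rhombic_dodecahedron_def)
qed

lemma convex_combination_4:
  assumes S: "convex S" and w: "w \<in> S" and p: "p \<in> S" and q: "q \<in> S" and r: "r \<in> S"
    and c: "0 \<le> \<alpha>" "0 \<le> \<beta>" "0 \<le> \<gamma>" "\<alpha> + \<beta> + \<gamma> \<le> 1"
  shows "(1 - \<alpha> - \<beta> - \<gamma>) *\<^sub>R w + \<alpha> *\<^sub>R p + \<beta> *\<^sub>R q + \<gamma> *\<^sub>R r \<in> S"
proof -
  define u where "u m = (if m = 0 then 1 - \<alpha> - \<beta> - \<gamma> else if m = 1 then \<alpha> else if m = 2 then \<beta> else \<gamma>)" for m :: nat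
  define y where "y m = (if m = 0 then w else if m = 1 then p else if m = 2 then q else r)" for m :: nat
  have "(\<Sum>m\<in>{0,1,2,3}. u m *\<^sub>R y m) \<in> S"
    by (rule convex_sum[OF _ S]) (use assms in \<open>auto simp: u_def y_def\<close>)
  then show ?thesis by (simp add: u_def y_def add.assoc)
qed

text \<open>Up to signs and order of the coordinates, the polytope is divided into simplices with the vertices \<open>0\<close>, \<open>(1, 0, 0)\<close>,
  \<open>(1/2, 1/2, 1/2)\<close> and \<open>(1/2, 1/2, -1/2)\<close>. The coefficients in the proof are the barycentric coordinates of \<open>x\<close>.\<close>

lemma in_rhombic:
  fixes x :: "real^3"
  assumes d: "i \<noteq> j" "j \<noteq> k" "i \<noteq> k" and o: "\<bar>x $ k\<bar> \<le> \<bar>x $ j\<bar>" "\<bar>x $ j\<bar> \<le> \<bar>x $ i\<bar>" and s: "\<bar>x $ i\<bar> + \<bar>x $ j\<bar> \<le> 1"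
  shows "x \<in> standard_rhombic_dodecahedron"
proof -
  let ?S = "{axis i 1 | i. True} \<union> {- axis i 1 | i. True} \<union> {x :: real^3. \<forall>i. x $ i \<in> {1/2, -1/2}}"
  let ?R = "standard_rhombic_dodecahedron"
  \<comment> \<open>The signs of the coordinates of \<open>x\<close>.\<close>
  define e :: "3 \<Rightarrow> real" where "e n = (if 0 \<le> x $ n then 1 else -1)" for n
  have e: "e n * \<bar>x $ n\<bar> = x $ n" "e n \<in> {1, -1}" for n by (auto simp: e_def)
  define p q r :: "real^3" where "p = e i *\<^sub>R axis i 1"
    and "q = (\<chi> n. e n / 2)" and "r = (\<chi> n. if n = k then - e n / 2 else e n / 2)"
  have "p \<in> ?S" using e(2)[of i] by (auto simp: p_def)
  moreover have "q \<in> ?S" "r \<in> ?S" using e(2) by (auto simp: q_def r_def)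
  ultimately have pqr: "p \<in> ?R" "q \<in> ?R" "r \<in> ?R" by (auto simp: standard_rhombic_dodecahedron_def intro: hull_inc)
  let ?\<alpha> = "\<bar>x $ i\<bar> - \<bar>x $ j\<bar>" and ?\<beta> = "\<bar>x $ j\<bar> + \<bar>x $ k\<bar>" and ?\<gamma> = "\<bar>x $ j\<bar> - \<bar>x $ k\<bar>"
  have split: "n = i \<or> n = j \<or> n = k" for n
    using d exhaust_3[of i] exhaust_3[of j] exhaust_3[of k] exhaust_3[of n] by metis
  have "x = (1 - ?\<alpha> - ?\<beta> - ?\<gamma>) *\<^sub>R 0 + ?\<alpha> *\<^sub>R p + ?\<beta> *\<^sub>R q + ?\<gamma> *\<^sub>R r"
  proof (subst vec_eq_iff, intro allI)
    fix n
    have "x $ n = ?\<alpha> * p $ n + ?\<beta> * q $ n + ?\<gamma> * r $ n"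
      using split[of n] d e(1)[of n] by (auto simp: p_def q_def r_def axis_def field_simps)
    then show "x $ n = ((1 - ?\<alpha> - ?\<beta> - ?\<gamma>) *\<^sub>R 0 + ?\<alpha> *\<^sub>R p + ?\<beta> *\<^sub>R q + ?\<gamma> *\<^sub>R r) $ n" by simp
  qed
  also have "\<dots> \<in> ?R"
    using pqr zero_in_rhombic o s by (intro convex_combination_4) (auto simp: standard_rhombic_dodecahedron_def)
  finally show ?thesis .
qed

lemma standard_rhombic_dodecahedron_eq:
  "standard_rhombic_dodecahedron
     = {x. \<bar>x $ 1\<bar> + \<bar>x $ 2\<bar> \<le> 1 \<and> \<bar>x $ 2\<bar> + \<bar>x $ 3\<bar> \<le> 1 \<and> \<bar>x $ 1\<bar> + \<bar>x $ 3\<bar> \<le> 1}" (is "_ = ?P")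
proof
  have "convex ?P"
  proof (rule convexI)
    fix x y :: "real^3" and u v :: real
    assume xy: "x \<in> ?P" "y \<in> ?P" and uv: "0 \<le> u" "0 \<le> v" "u + v = 1"
    have "\<bar>(u *\<^sub>R x + v *\<^sub>R y) $ i\<bar> + \<bar>(u *\<^sub>R x + v *\<^sub>R y) $ j\<bar> \<le> 1"
      if "\<bar>x $ i\<bar> + \<bar>x $ j\<bar> \<le> 1" "\<bar>y $ i\<bar> + \<bar>y $ j\<bar> \<le> 1" for i j
    proof -
      have "\<bar>(u *\<^sub>R x + v *\<^sub>R y) $ n\<bar> \<le> u * \<bar>x $ n\<bar> + v * \<bar>y $ n\<bar>" for n
        using abs_triangle_ineq[of "u * x $ n" "v * y $ n"] uv by (simp add: abs_mult)
      from this[of i] this[of j]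
      have "\<bar>(u *\<^sub>R x + v *\<^sub>R y) $ i\<bar> + \<bar>(u *\<^sub>R x + v *\<^sub>R y) $ j\<bar>
          \<le> u * (\<bar>x $ i\<bar> + \<bar>x $ j\<bar>) + v * (\<bar>y $ i\<bar> + \<bar>y $ j\<bar>)" by (simp add: algebra_simps)
      also have "\<dots> \<le> u * 1 + v * 1" using that uv by (intro add_mono mult_left_mono) auto
      finally show ?thesis using uv by simp
    qed
    then show "u *\<^sub>R x + v *\<^sub>R y \<in> ?P" using xy by auto
  qed
  moreover have "{axis i 1 | i. True} \<union> {- axis i 1 | i. True} \<union> {x :: real^3. \<forall>i. x $ i \<in> {1/2, -1/2}} \<subseteq> ?P"
  proof -
    have "axis i 1 \<in> ?P \<and> - axis i 1 \<in> ?P" for i :: 3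
      using exhaust_3[of i] by (auto simp: axis_def)
    moreover have "x \<in> ?P" if "\<forall>i. x $ i \<in> {1/2, -1/2}" for x :: "real^3"
      using that[rule_format, of 1] that[rule_format, of 2] that[rule_format, of 3] by auto
    ultimately show ?thesis by blast
  qed
  ultimately show "standard_rhombic_dodecahedron \<subseteq> ?P"
    unfolding standard_rhombic_dodecahedron_def by (intro hull_minimal)
next
  show "?P \<subseteq> standard_rhombic_dodecahedron"
  proof
    fix x assume x: "x \<in> ?P"
    obtain i j k :: 3 where "i \<noteq> j" "j \<noteq> k" "i \<noteq> k" "\<bar>x $ k\<bar> \<le> \<bar>x $ j\<bar>" "\<bar>x $ j\<bar> \<le> \<bar>x $ i\<bar>" "\<bar>x $ i\<bar> + \<bar>x $ j\<bar> \<le> 1"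
    proof -
      have n: "(1::3) \<noteq> 2" "(2::3) \<noteq> 3" "(1::3) \<noteq> 3" by simp_all
      have sort: "r \<le> q \<and> q \<le> p \<or> q \<le> r \<and> r \<le> p \<or> r \<le> p \<and> p \<le> q \<or> p \<le> r \<and> r \<le> q \<or> q \<le> p \<and> p \<le> r \<or> p \<le> q \<and> q \<le> r"
        for p q r :: real by linarith
      consider "\<bar>x $ 3\<bar> \<le> \<bar>x $ 2\<bar>" "\<bar>x $ 2\<bar> \<le> \<bar>x $ 1\<bar>" | "\<bar>x $ 2\<bar> \<le> \<bar>x $ 3\<bar>" "\<bar>x $ 3\<bar> \<le> \<bar>x $ 1\<bar>"
        | "\<bar>x $ 3\<bar> \<le> \<bar>x $ 1\<bar>" "\<bar>x $ 1\<bar> \<le> \<bar>x $ 2\<bar>" | "\<bar>x $ 1\<bar> \<le> \<bar>x $ 3\<bar>" "\<bar>x $ 3\<bar> \<le> \<bar>x $ 2\<bar>"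
        | "\<bar>x $ 2\<bar> \<le> \<bar>x $ 1\<bar>" "\<bar>x $ 1\<bar> \<le> \<bar>x $ 3\<bar>" | "\<bar>x $ 1\<bar> \<le> \<bar>x $ 2\<bar>" "\<bar>x $ 2\<bar> \<le> \<bar>x $ 3\<bar>"
        using sort[of "\<bar>x $ 3\<bar>" "\<bar>x $ 2\<bar>" "\<bar>x $ 1\<bar>"] by blast
      then show ?thesis
      proof cases
        case 1 then show ?thesis using that[of 1 2 3] n x by (simp add: add.commute)
      next
        case 2 then show ?thesis using that[of 1 3 2] n x by (simp add: add.commute)
      next
        case 3 then show ?thesis using that[of 2 1 3] n x by (simp add: add.commute)
      next
        case 4 then show ?thesis using that[of 2 3 1] n x by (simp add: add.commute)
      next
        case 5 then show ?thesis using that[of 3 1 2] n x by (simp add: add.commute)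
      next
        case 6 then show ?thesis using that[of 3 2 1] n x by (simp add: add.commute)
      qed
    qed
    then show "x \<in> standard_rhombic_dodecahedron" by (rule in_rhombic)
  qed
qed

lemma dirichlet_domain_scale:
  assumes "0 < k" shows "dirichlet_domain ((\<lambda>v. k *\<^sub>R v) ` A) = (\<lambda>v. k *\<^sub>R v) ` dirichlet_domain A"
proof (rule equalityI; rule subsetI)
  fix x assume x: "x \<in> dirichlet_domain ((\<lambda>v. k *\<^sub>R v) ` A)"
  have "norm (inverse k *\<^sub>R x) \<le> norm (inverse k *\<^sub>R x - a)" if "a \<in> A" for a
  proof -
    have "inverse k *\<^sub>R (x - k *\<^sub>R a) = inverse k *\<^sub>R x - a" using assms by (simp add: algebra_simps)
    moreover have "norm (inverse k *\<^sub>R x) \<le> norm (inverse k *\<^sub>R (x - k *\<^sub>R a))"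
      using x that assms by (simp add: dirichlet_domain_def mult_left_mono)
    ultimately show ?thesis by simp
  qed
  then have "inverse k *\<^sub>R x \<in> dirichlet_domain A" by (simp add: dirichlet_domain_def)
  moreover have "x = k *\<^sub>R inverse k *\<^sub>R x" using assms by simp
  ultimately show "x \<in> (\<lambda>v. k *\<^sub>R v) ` dirichlet_domain A" by blast
next
  fix x assume "x \<in> (\<lambda>v. k *\<^sub>R v) ` dirichlet_domain A"
  then obtain y where y: "x = k *\<^sub>R y" "\<forall>a\<in>A. norm y \<le> norm (y - a)" by (auto simp: dirichlet_domain_def)
  have "norm (k *\<^sub>R y) \<le> norm (k *\<^sub>R (y - a))" if "a \<in> A" for a using y that assms by simp
  then show "x \<in> dirichlet_domain ((\<lambda>v. k *\<^sub>R v) ` A)"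
    using y by (auto simp: dirichlet_domain_def scaleR_right_diff_distrib)
qed

lemma rhombic_dodecahedron_fcc:
  assumes k: "0 < k" shows "rhombic_dodecahedron (dirichlet_domain (fcc_lattice k))"
proof -
  have "fcc_lattice k = (\<lambda>v. k *\<^sub>R v) ` fcc_lattice 1"
    by (simp add: fcc_lattice_def setcompr_eq_image image_image) blast
  then have "dirichlet_domain (fcc_lattice k) = (\<lambda>v. k *\<^sub>R v) ` standard_rhombic_dodecahedron"
    using dirichlet_domain_scale[OF k] dirichlet_domain_fcc_unit standard_rhombic_dodecahedron_eq by metis
  moreover have "dist (k *\<^sub>R x) (k *\<^sub>R y) = k * dist x y" for x y :: "real^3"
    using k by (simp add: dist_norm flip: scaleR_right_diff_distrib)
  ultimately show ?thesis unfolding rhombic_dodecahedron_def using k by blast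
qed

lemma discrete_fcc:
  assumes k: "0 < k" shows "discrete (fcc_lattice k)"
proof -
  have "u = v" if u: "u \<in> fcc_lattice k" and v: "v \<in> fcc_lattice k" and d: "dist u v < k" for u v
  proof -
    have "\<exists>w. u = k *\<^sub>R w \<and> (\<forall>i. w $ i \<in> \<int>)" if m: "u \<in> fcc_lattice k" for u
    proof -
      obtain a b c :: int where "u = k *\<^sub>R vector [real_of_int a, real_of_int b, real_of_int c]"
        using m by (auto simp: fcc_lattice_def)
      moreover have "\<forall>i. (vector [real_of_int a, real_of_int b, real_of_int c] :: real^3) $ i \<in> \<int>"
        by (simp add: forall_3)
      ultimately show ?thesis by blast
    qed
    then obtain u' v' where uv: "u = k *\<^sub>R u'" "v = k *\<^sub>R v'" "\<forall>i. u' $ i \<in> \<int>" "\<forall>i. v' $ i \<in> \<int>"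
      using u v by metis
    have "dist u v = k * norm (u' - v')" using k uv by (simp add: dist_norm flip: scaleR_right_diff_distrib)
    then have n: "norm (u' - v') < 1" using d k by simp
    have "u' $ i = v' $ i" for i
    proof -
      have "\<bar>(u' - v') $ i\<bar> < 1" using component_le_norm_cart[of "u' - v'" i] n by linarith
      moreover have "(u' - v') $ i \<in> \<int>" using uv by simp
      ultimately show ?thesis using Ints_nonzero_abs_less1 by fastforce
    qed
    then show ?thesis using uv by (simp add: vec_eq_iff)
  qed
  then show ?thesis using k unfolding discrete_def isolated_in_dist_Ex_iff by (metis dist_commute)
qed

section \<open>The Gram matrix of the Nielsen generators\<close>

locale nielsen_action = hadamard_action X AutF3 \<phi> for X :: "'x::metric_space set" and \<phi>
begin

text \<open>Permutations of the basis conjugate the left Nielsen transformations to each other; inverting a basis element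
  gives the right ones.\<close>

lemma len_nielsen_left:
  assumes "i \<noteq> j" "k \<noteq> l" shows "len (nielsen_left i j) = len (nielsen_left k l)"
proof -
  obtain \<sigma> where \<sigma>: "bij \<sigma>" "\<sigma> i = k" "\<sigma> j = l" using bij_3_exists assms by metis
  show ?thesis
    using len_conj[OF permute_basis_closed[OF \<sigma>(1)] _ _ permute_basis_nielsen_left[OF assms(1) \<sigma>(1)]] assms \<sigma>
    by (simp add: nielsen_closed)
qed

lemma len_nielsen_right:
  assumes "i \<noteq> j" shows "len (nielsen_right i j) = len (nielsen_left i j)"
  using len_conj[OF invert_basis_closed _ _ invert_basis_nielsen_left[OF assms]] len_inv[of "nielsen_right i j"] assms
  by (simp add: nielsen_closed)

lemma nielsen_fixes_point:
  assumes "len (nielsen_left 2 1) = 0" "\<nu> \<in> nielsen_transformations"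
  shows "\<exists>x\<in>X. \<phi> \<nu> x = x"
proof -
  obtain i j where ij: "i \<noteq> j" "\<nu> = nielsen_left i j \<or> \<nu> = nielsen_right i j"
    using assms(2) by (auto simp: nielsen_transformations_def)
  have "len (nielsen_left i j) = 0" using len_nielsen_left[OF ij(1), of 2 1] assms(1) by simp
  then have "\<nu> \<in> carrier AutF3 \<and> len \<nu> = 0"
    using ij(2) nielsen_closed[OF ij(1)] len_nielsen_right[OF ij(1)] by auto
  then obtain x where "x \<in> Min \<nu>" using min_set_nonempty by blast
  then have "x \<in> X" "dist x (\<phi> \<nu> x) = 0" using Min_subset Min_dist \<open>\<nu> \<in> carrier AutF3 \<and> len \<nu> = 0\<close> by auto
  then show ?thesis by (intro bexI[of _ x]) auto
qed

end

locale nielsen_flat = nielsen_action X \<phi> + flat_group_action X AutF3 \<phi> C T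
  for X :: "'x::metric_space set" and \<phi> and C and T :: "real^4 \<Rightarrow> 'x \<Rightarrow> 'x" +
  assumes gens: "acts_as (nielsen_left 2 1) (axis 1 1)" "acts_as (nielsen_right 2 1) (axis 2 1)"
      "acts_as (nielsen_left 3 1) (axis 3 1)" "acts_as (nielsen_right 3 1) (axis 4 1)"
    and hyperbolic: "0 < len (nielsen_left 2 1)"
begin

abbreviation q where "q i \<equiv> axis i (1::real) :: real^4"
abbreviation L where "L \<equiv> len (nielsen_left 2 1)"

lemma index_neq: "(2::3) \<noteq> 1" "(3::3) \<noteq> 1" "(1::3) \<noteq> 2" "(1::3) \<noteq> 3" "(2::3) \<noteq> 3" "(3::3) \<noteq> 2" by simp_all

lemma disp_q: "disp (q i) = L"
proof -
  have "disp (q 1) = L" "disp (q 2) = L" "disp (q 3) = L" "disp (q 4) = L"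
    using gens[THEN acts_as_len] len_nielsen_right[OF index_neq(1)] len_nielsen_right[OF index_neq(2)] len_nielsen_left[OF index_neq(2,1)]
    by simp_all
  then show ?thesis using exhaust_4[of i] by auto
qed

lemma polar_left_right: "polar (q 1) (q 2) = 0" "polar (q 3) (q 4) = 0"
proof -
  have *: "polar v w = 0" if "acts_as (nielsen_left k 1) v" "acts_as (nielsen_right k 1) w" "i \<noteq> 1" "k \<noteq> 1" "i \<noteq> k"
    for i k v w
    using that by (intro commutator_polar[OF that(1,2) _ _ _ _ _ nielsen_right_commutator[of i 1 k]])
      (auto intro: nielsen_closed nielsen_commute nielsen_left_right_commute)
  show "polar (q 1) (q 2) = 0" by (rule *[OF gens(1,2), of 3]) auto
  show "polar (q 3) (q 4) = 0" by (rule *[OF gens(3,4), of 2]) auto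
qed

lemma disp_conj:
  assumes "acts_as h v" "acts_as h' w" "g \<in> carrier AutF3" "g \<otimes>\<^bsub>AutF3\<^esub> h = h' \<otimes>\<^bsub>AutF3\<^esub> g"
  shows "disp v = disp w"
  using len_conj[OF assms(3) _ _ assms(4)] acts_as_len[OF assms(1)] acts_as_len[OF assms(2)] assms(1,2)
  by (simp add: acts_as_def)

lemma conj_mult:
  assumes "g \<in> carrier AutF3" "h \<in> carrier AutF3" "h' \<in> carrier AutF3" "k \<in> carrier AutF3" "k' \<in> carrier AutF3"
    and "g \<otimes>\<^bsub>AutF3\<^esub> h = h' \<otimes>\<^bsub>AutF3\<^esub> g" "g \<otimes>\<^bsub>AutF3\<^esub> k = k' \<otimes>\<^bsub>AutF3\<^esub> g"
  shows "g \<otimes>\<^bsub>AutF3\<^esub> (h \<otimes>\<^bsub>AutF3\<^esub> k) = (h' \<otimes>\<^bsub>AutF3\<^esub> k') \<otimes>\<^bsub>AutF3\<^esub> g"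
  using assms by (metis m_assoc)

text \<open>Inverting the second basis element conjugates \<open>l\<^sub>2 l\<^sub>3\<close> to \<open>r\<^sub>2\<^sup>-\<^sup>1 l\<^sub>3\<close> and \<open>l\<^sub>2 r\<^sub>3\<close> to \<open>r\<^sub>2\<^sup>-\<^sup>1 r\<^sub>3\<close>; inverting the third one
  conjugates \<open>l\<^sub>3 l\<^sub>2\<close> to \<open>r\<^sub>3\<^sup>-\<^sup>1 l\<^sub>2\<close>. Conjugate elements have the same displacement.\<close>

lemma polar_cross: "polar (q 2) (q 3) = - polar (q 1) (q 3)" "polar (q 1) (q 4) = - polar (q 1) (q 3)"
    "polar (q 2) (q 4) = polar (q 1) (q 3)"
proof -
  have *: "disp (v + w) = disp (- v' + w)"
    if v: "acts_as (nielsen_left i 1) v" "acts_as (nielsen_right i 1) v'" and w: "acts_as h w"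
      and h: "invert_basis i \<otimes>\<^bsub>AutF3\<^esub> h = h \<otimes>\<^bsub>AutF3\<^esub> invert_basis i" and i: "i \<noteq> 1" for i v v' h w
    by (rule disp_conj[OF acts_as_mult[OF v(1) w] acts_as_mult[OF acts_as_inv[OF v(2)] w] invert_basis_closed])
      (use v w h i in \<open>auto intro!: conj_mult invert_basis_closed invert_basis_nielsen_left simp: acts_as_def\<close>)
  have sq: "disp (v + w) = disp (- v' + w) \<Longrightarrow> disp v = disp v' \<Longrightarrow> polar v' w = - polar v w" for v w v'
    using polar_def[of v w] polar_def[of "- v'" w] disp_scale[of "-1" v'] polar_minus(1)[of v' w] by simp
  show 1: "polar (q 2) (q 3) = - polar (q 1) (q 3)"
    by (rule sq[OF *[OF gens(1,2,3) invert_basis_commute(1)]]) (simp_all add: disp_q)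
  have 2: "polar (q 2) (q 4) = - polar (q 1) (q 4)"
    by (rule sq[OF *[OF gens(1,2,4) invert_basis_commute(2)]]) (simp_all add: disp_q)
  have "polar (q 4) (q 1) = - polar (q 3) (q 1)"
    by (rule sq[OF *[OF gens(3,4,1) invert_basis_commute(1)]]) (simp_all add: disp_q)
  then show "polar (q 1) (q 4) = - polar (q 1) (q 3)" "polar (q 2) (q 4) = polar (q 1) (q 3)"
    using 2 by (simp_all add: polar_commute)
qed

text \<open>Conjugation by the first basis element acts as \<open>q 1 + q 3 - (q 2 + q 4)\<close> and is orthogonal to \<open>q 1\<close>, since \<open>l\<^sub>2\<close> is a
  commutator in its centralizer.\<close>

lemma polar_13: "polar (q 1) (q 3) = - L\<^sup>2 / 2"
proof -
  let ?D = "inner_aut 1"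
  let ?l = "nielsen_left 2 1 \<otimes>\<^bsub>AutF3\<^esub> nielsen_left 3 1" and ?r = "nielsen_right 2 1 \<otimes>\<^bsub>AutF3\<^esub> nielsen_right 3 1"
  note c = nielsen_closed[OF index_neq(1)] nielsen_closed[OF index_neq(2)] inner_aut_closed[of 1]
  have cancel: "u \<otimes>\<^bsub>AutF3\<^esub> v \<otimes>\<^bsub>AutF3\<^esub> inv\<^bsub>AutF3\<^esub> v = u"
    if "u \<in> carrier AutF3" "v \<in> carrier AutF3" for u v
    using that by (simp add: m_assoc)
  have "?D \<otimes>\<^bsub>AutF3\<^esub> ?r = ?l" by (rule inner_aut_decomposition) simp_all
  then have D_eq: "?D = ?l \<otimes>\<^bsub>AutF3\<^esub> inv\<^bsub>AutF3\<^esub> ?r"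
    using cancel[OF c(5) m_closed[OF c(2,4)]] by simp
  have D: "acts_as ?D (q 1 + q 3 + - (q 2 + q 4))"
    unfolding D_eq by (intro acts_as_mult acts_as_inv gens)
  have "polar (q 1 + q 3 + - (q 2 + q 4)) (q 1) = 0"
    by (rule commutator_polar[OF D gens(1) _ _ _ _ _ nielsen_left_commutator[of 2 1 3]])
      (auto intro!: inner_aut_commute nielsen_closed simp: nielsen_basis)
  then show ?thesis
    using polar_left_right polar_cross polar_self[of "q 1"] disp_q[of 1]
      polar_commute[of "q 2" "q 1"] polar_commute[of "q 3" "q 1"] polar_commute[of "q 4" "q 1"]
    by (simp add: polar_simps)
qed


section \<open>The invariant flat\<close>

text \<open>Chosen so that the vectors \<open>scale *\<^sub>R (1, 1, 0)\<close> have length \<open>L\<close>.\<close>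

definition scale where "scale = L / sqrt 2"

lemma scale_pos: "0 < scale" using hyperbolic by (simp add: scale_def)

lemma L_sq: "L\<^sup>2 = 2 * scale\<^sup>2" by (simp add: scale_def power_divide)

text \<open>The coefficients of \<open>u\<close> with respect to the basis \<open>(1, 1, 0)\<close>, \<open>(-1, 1, 0)\<close>, \<open>(-1, 0, 1)\<close>, scaled. These
  vectors belong to the first three generators; the fourth one acts like \<open>q 1 - q 2 + q 3\<close>.\<close>

definition lift :: "real^3 \<Rightarrow> real^4" where
  "lift u = ((u $ 1 + u $ 2 + u $ 3) / (2 * scale)) *\<^sub>R q 1
     + ((u $ 2 - u $ 1 - u $ 3) / (2 * scale)) *\<^sub>R q 2 + (u $ 3 / scale) *\<^sub>R q 3"

text \<open>The isometry from \<open>\<real>\<^sup>4\<close> modulo the radical of \<open>polar\<close> to Euclidean space; it maps the four unit vectors to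
  the vectors \<open>(1, 1, 0)\<close>, \<open>(-1, 1, 0)\<close>, \<open>(-1, 0, 1)\<close>, \<open>(1, 0, 1)\<close>, scaled.\<close>

definition proj :: "real^4 \<Rightarrow> real^3" where
  "proj w = scale *\<^sub>R vector [w $ 1 - w $ 2 - w $ 3 + w $ 4, w $ 1 + w $ 2, w $ 3 + w $ 4]"

lemma lift_add: "lift (u + v) = lift u + lift v"
  by (simp add: lift_def add_divide_distrib diff_divide_distrib algebra_simps)

lemma lift_diff: "lift (u - v) = lift u - lift v"
  by (simp add: lift_def add_divide_distrib diff_divide_distrib algebra_simps)

lemma disp_lift: "disp (lift u) = norm u"
proof (rule power2_eq_imp_eq)
  have polar_comb: "polar (x *\<^sub>R q 1 + y *\<^sub>R q 2 + z *\<^sub>R q 3) (x *\<^sub>R q 1 + y *\<^sub>R q 2 + z *\<^sub>R q 3)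
      = L\<^sup>2 * (x\<^sup>2 + y\<^sup>2 + z\<^sup>2 - x * z + y * z)" for x y z
    using polar_self[of "q 1"] polar_self[of "q 2"] polar_self[of "q 3"] polar_left_right(1) polar_cross(1) polar_13
      polar_commute[of "q 2" "q 1"] polar_commute[of "q 3" "q 1"] polar_commute[of "q 3" "q 2"]
    by (simp add: polar_simps disp_q power2_eq_square algebra_simps)
  have "(disp (lift u))\<^sup>2 = (u $ 1)\<^sup>2 + (u $ 2)\<^sup>2 + (u $ 3)\<^sup>2"
    unfolding polar_self[symmetric] lift_def polar_comb L_sq using scale_pos
    by (simp add: field_simps power2_eq_square)
  also have "\<dots> = (norm u)\<^sup>2" unfolding power2_norm_eq_inner inner_3 by (simp add: power2_eq_square)
  finally show "(disp (lift u))\<^sup>2 = (norm u)\<^sup>2" .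
qed (auto simp: disp_nonneg)

text \<open>This vector spans the radical of \<open>polar\<close>. It is the negative of the one by which conjugation by the first basis element acts, so
  that this conjugation is elliptic.\<close>

lemma disp_relation: "disp (- q 1 + q 2 - q 3 + q 4) = 0"
proof -
  have "(disp (- q 1 + q 2 - q 3 + q 4))\<^sup>2 = 0"
    unfolding polar_self[symmetric]
    using polar_self[of "q 1"] polar_self[of "q 2"] polar_self[of "q 3"] polar_self[of "q 4"]
      polar_left_right polar_cross polar_13
      polar_commute[of "q 2" "q 1"] polar_commute[of "q 3" "q 1"] polar_commute[of "q 3" "q 2"]
      polar_commute[of "q 4" "q 1"] polar_commute[of "q 4" "q 2"] polar_commute[of "q 4" "q 3"]
    by (simp add: polar_simps disp_q)
  then show ?thesis by simp
qed

lemma T_proj: assumes "x \<in> C" shows "T w x = T (lift (proj w)) x"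
proof -
  have "w - lift (proj w) = (w $ 4) *\<^sub>R (- q 1 + q 2 - q 3 + q 4)"
    using scale_pos by (simp add: vec_eq_iff forall_4 lift_def proj_def axis_def field_simps)
  then have "disp (w - lift (proj w)) = 0" using disp_scale[of "w $ 4"] disp_relation by simp
  then show ?thesis using disp_dist[OF assms, of w "lift (proj w)"] by simp
qed

lemma Lambda_acts: "h \<in> Lambda \<Longrightarrow> \<exists>w. (\<forall>i. w $ i \<in> \<int>) \<and> acts_as h w"
  unfolding Lambda_def
proof (induction rule: generate.induct)
  case one
  then show ?case using acts_as_one by (intro exI[of _ 0]) simp
next
  case (incl h)
  have "\<forall>i. q j $ i \<in> \<int>" for j by (simp add: axis_def)
  then show ?case using incl gens by blast
next
  case (inv h)
  have "\<forall>i. (- q j) $ i \<in> \<int>" for j by (simp add: axis_def)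
  then show ?case using inv gens[THEN acts_as_inv] by blast
next
  case (eng h k)
  then obtain v w where "\<forall>i. v $ i \<in> \<int>" "acts_as h v" "\<forall>i. w $ i \<in> \<int>" "acts_as k w" by blast
  then show ?case by (intro exI[of _ "v + w"]) (auto intro: acts_as_mult)
qed

lemma subgroup_Lambda: "subgroup Lambda AutF3"
  unfolding Lambda_def by (rule generate_is_subgroup) (use nielsen_closed index_neq in auto)

lemma acts_in_Lambda:
  assumes w: "\<forall>i. w $ i \<in> \<int>" shows "\<exists>h\<in>Lambda. acts_as h w"
proof -
  \<comment> \<open>A subgroup of \<open>\<real>\<^sup>4\<close> that contains the unit vectors.\<close>
  define S where "S = {w. \<exists>h\<in>Lambda. acts_as h w}"
  have add: "v + w \<in> S" if "v \<in> S" "w \<in> S" for v w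
    using that acts_as_mult subgroup.m_closed[OF subgroup_Lambda] unfolding S_def by blast
  have neg: "- v \<in> S" if "v \<in> S" for v
    using that acts_as_inv subgroup.m_inv_closed[OF subgroup_Lambda] unfolding S_def by blast
  have zero: "0 \<in> S" using acts_as_one subgroup.one_closed[OF subgroup_Lambda] unfolding S_def by blast
  have nat: "real n *\<^sub>R v \<in> S" if "v \<in> S" for n v
    by (induction n) (use zero add that in \<open>auto simp: scaleR_left_distrib\<close>)
  have int: "real_of_int n *\<^sub>R v \<in> S" if v: "v \<in> S" for n v
  proof (cases n rule: int_cases2)
    case (nonneg m) then show ?thesis using nat[OF v, of m] by simp
  next
    case (nonpos m) then show ?thesis using neg[OF nat[OF v, of m]] by simp
  qed
  have q: "q i \<in> S" for i
  proof -
    have "{nielsen_left 2 1, nielsen_right 2 1, nielsen_left 3 1, nielsen_right 3 1} \<subseteq> Lambda"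
      unfolding Lambda_def by (auto intro: generate.incl)
    then have "q 1 \<in> S" "q 2 \<in> S" "q 3 \<in> S" "q 4 \<in> S" using gens unfolding S_def by blast+
    then show ?thesis using exhaust_4[of i] by auto
  qed
  have wq: "(w $ i) *\<^sub>R q i \<in> S" for i using int[OF q] w by (metis Ints_cases)
  have "w = (w $ 1) *\<^sub>R q 1 + (w $ 2) *\<^sub>R q 2 + (w $ 3) *\<^sub>R q 3 + (w $ 4) *\<^sub>R q 4"
    by (simp add: vec_eq_iff forall_4 axis_def)
  also have "\<dots> \<in> S" using wq add by blast
  finally show ?thesis by (simp add: S_def)
qed

lemma proj_lattice: "proj ` {w. \<forall>i. w $ i \<in> \<int>} = fcc_lattice scale"
proof (rule equalityI; rule subsetI)
  fix v assume "v \<in> proj ` {w. \<forall>i. w $ i \<in> \<int>}"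
  then obtain w where w: "v = proj w" "\<forall>i. w $ i \<in> \<int>" by blast
  obtain a b c d where abcd: "w $ 1 = real_of_int a" "w $ 2 = real_of_int b" "w $ 3 = real_of_int c" "w $ 4 = real_of_int d"
    using w(2) by (metis Ints_cases)
  have "v = scale *\<^sub>R vector [real_of_int (a - b - c + d), real_of_int (a + b), real_of_int (c + d)]"
    using w(1) abcd by (simp add: proj_def)
  moreover have "even ((a - b - c + d) + (a + b) + (c + d))" by simp
  ultimately show "v \<in> fcc_lattice scale" unfolding fcc_lattice_def by blast
next
  fix v assume "v \<in> fcc_lattice scale"
  then obtain a b c :: int where v: "even (a + b + c)" "v = scale *\<^sub>R vector [real_of_int a, real_of_int b, real_of_int c]"
    by (auto simp: fcc_lattice_def)
  \<comment> \<open>The coefficients with respect to the first three unit vectors are \<open>s\<close>, \<open>b - s\<close> and \<open>c\<close>.\<close>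
  obtain s where s: "a + b + c = 2 * s" using v(1) by (rule evenE)
  define w :: "real^4" where "w = real_of_int s *\<^sub>R q 1 + real_of_int (b - s) *\<^sub>R q 2 + real_of_int c *\<^sub>R q 3"
  have "real_of_int a = 2 * real_of_int s - real_of_int b - real_of_int c"
    using arg_cong[OF s, of real_of_int] by simp
  then have "proj w = v" unfolding v(2) proj_def w_def by (simp add: vec_eq_iff forall_3 axis_def)
  moreover have "\<forall>i. w $ i \<in> \<int>" by (simp add: w_def forall_4 axis_def)
  ultimately show "v \<in> proj ` {w. \<forall>i. w $ i \<in> \<int>}" by blast
qed

lemma Lambda_flat:
  obtains e :: "real^3 \<Rightarrow> 'x" where "range e \<subseteq> X" "\<And>u v. dist (e u) (e v) = dist u v"
    "\<And>h. h \<in> Lambda \<Longrightarrow> \<exists>a. \<forall>u. \<phi> h (e u) = e (u + a)"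
    "translation_vectors \<phi> Lambda e = fcc_lattice scale"
proof -
  obtain x where x: "x \<in> C" using C_nonempty by blast
  define e where "e u = T (lift u) x" for u
  have eC: "e u \<in> C" for u by (simp add: e_def T_closed x)
  have iso: "dist (e u) (e v) = dist u v" for u v
    using disp_dist[OF x, of "lift u" "lift v"] disp_lift[of "u - v"] by (simp add: e_def lift_diff dist_norm)
  have act: "\<phi> h (e u) = e (u + proj w)" if "acts_as h w" for h w u
  proof -
    have "\<phi> h (e u) = T (lift (proj w)) (e u)" using that eC T_proj[OF eC] by (simp add: acts_as_def)
    also have "\<dots> = e (proj w + u)" using T_add[OF x, of "lift (proj w)" "lift u"] by (simp add: e_def lift_add)
    finally show ?thesis by (simp add: add.commute)
  qed
  have "translation_vectors \<phi> Lambda e = proj ` {w. \<forall>i. w $ i \<in> \<int>}"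
  proof (rule equalityI; rule subsetI)
    fix b assume "b \<in> translation_vectors \<phi> Lambda e"
    then obtain h where h: "h \<in> Lambda" "\<forall>u. \<phi> h (e u) = e (u + b)" by (auto simp: translation_vectors_def)
    obtain w where w: "\<forall>i. w $ i \<in> \<int>" "acts_as h w" using Lambda_acts[OF h(1)] by blast
    have "e (0 + b) = e (0 + proj w)" using h(2) act[OF w(2), of 0] by metis
    then have "b = proj w" using iso[of b "proj w"] by simp
    then show "b \<in> proj ` {w. \<forall>i. w $ i \<in> \<int>}" using w by blast
  next
    fix b assume "b \<in> proj ` {w. \<forall>i. w $ i \<in> \<int>}"
    then obtain w where w: "b = proj w" "\<forall>i. w $ i \<in> \<int>" by blast
    obtain h where "h \<in> Lambda" "acts_as h w" using acts_in_Lambda[OF w(2)] by blast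
    then show "b \<in> translation_vectors \<phi> Lambda e" unfolding translation_vectors_def using act w(1) by blast
  qed
  then have "translation_vectors \<phi> Lambda e = fcc_lattice scale" by (simp only: proj_lattice)
  moreover have "range e \<subseteq> X" using eC CX by blast
  moreover have "\<exists>a. \<forall>u. \<phi> h (e u) = e (u + a)" if "h \<in> Lambda" for h
    using Lambda_acts[OF that] act by blast
  ultimately show ?thesis using that iso by blast
qed

end

context nielsen_action
begin

lemma hyperbolic_Lambda_flat:
  assumes "0 < len (nielsen_left 2 1)"
  obtains e :: "real^3 \<Rightarrow> 'x" and k where "0 < k" "range e \<subseteq> X" "\<And>u v. dist (e u) (e v) = dist u v"
    "\<And>h. h \<in> Lambda \<Longrightarrow> \<exists>a. \<forall>u. \<phi> h (e u) = e (u + a)"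
    "translation_vectors \<phi> Lambda e = fcc_lattice k"
proof -
  define b :: "4 \<Rightarrow> 3 letter_word \<Rightarrow> 3 letter_word" where
    "b i = (if i = 1 then nielsen_left 2 1 else if i = 2 then nielsen_right 2 1
      else if i = 3 then nielsen_left 3 1 else nielsen_right 3 1)" for i
  have bc: "b i \<in> carrier AutF3" for i by (simp add: b_def nielsen_closed)
  have comm: "b i \<otimes>\<^bsub>AutF3\<^esub> b j = b j \<otimes>\<^bsub>AutF3\<^esub> b i" for i j
    by (simp add: b_def nielsen_commute)
  obtain C and T :: "real^4 \<Rightarrow> 'x \<Rightarrow> 'x" where T: "flat_action X C T" "\<And>i x. x \<in> C \<Longrightarrow> T (axis i 1) x = \<phi> (b i) x"
    using commuting_flat_action[of b, OF bc comm] by metis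
  interpret flat_group_action X AutF3 \<phi> C T by (rule flat_group_actionI[OF T(1)])
  have acts: "acts_as (b i) (axis i 1)" for i using T(2) bc by (simp add: acts_as_def)
  interpret nielsen_flat X \<phi> C T
    by unfold_locales (use acts[of 1] acts[of 2] acts[of 3] acts[of 4] assms in \<open>simp_all add: b_def\<close>)
  show ?thesis using Lambda_flat scale_pos that by metis
qed

text \<open>For the conjugate of \<open>Lambda\<close> by \<open>g\<close>, the flat of \<open>Lambda\<close> is moved by \<open>g\<close>; the translation vectors stay the same.\<close>

lemma hyperbolic_nielsen_Z4_flat:
  assumes hyp: "0 < len (nielsen_left 2 1)" and H: "nielsen_Z4 H"
  shows "\<exists>e::real^3 \<Rightarrow> 'x. range e \<subseteq> X \<and> (\<forall>u v. dist (e u) (e v) = dist u v) \<and>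
        (\<forall>h\<in>H. \<phi> h ` range e = range e) \<and>
        (\<forall>h\<in>H. \<exists>a. \<forall>u. \<phi> h (e u) = e (u + a)) \<and>
        discrete (translation_vectors \<phi> H e) \<and>
        rhombic_dodecahedron (dirichlet_domain (translation_vectors \<phi> H e))"
proof -
  obtain e0 :: "real^3 \<Rightarrow> 'x" and k where e0: "0 < k" "range e0 \<subseteq> X" "\<And>u v. dist (e0 u) (e0 v) = dist u v"
    "\<And>h. h \<in> Lambda \<Longrightarrow> \<exists>a. \<forall>u. \<phi> h (e0 u) = e0 (u + a)"
    "translation_vectors \<phi> Lambda e0 = fcc_lattice k"
    using hyperbolic_Lambda_flat[OF hyp] by metis
  obtain g where g: "g \<in> carrier AutF3" "H = g <#\<^bsub>AutF3\<^esub> Lambda #>\<^bsub>AutF3\<^esub> inv\<^bsub>AutF3\<^esub> g"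
    using H by (auto simp: nielsen_Z4_def)
  have LC: "h \<in> carrier AutF3" if "h \<in> Lambda" for h
    using that generate_in_carrier[of "{nielsen_left 2 1, nielsen_right 2 1, nielsen_left 3 1, nielsen_right 3 1}" h]
    by (auto simp: Lambda_def nielsen_closed)
  have H_eq: "H = (\<lambda>h. g \<otimes>\<^bsub>AutF3\<^esub> h \<otimes>\<^bsub>AutF3\<^esub> inv\<^bsub>AutF3\<^esub> g) ` Lambda"
    unfolding g(2) l_coset_def r_coset_def by blast
  define e where "e u = \<phi> g (e0 u)" for u
  have eX0: "e0 u \<in> X" for u using e0(2) by blast
  have eX: "e u \<in> X" for u by (simp add: e_def g(1) eX0)
  have iso: "dist (e u) (e v) = dist u v" for u v
    by (simp add: e_def isometric[OF g(1) eX0 eX0] e0(3))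
  have act: "\<phi> (g \<otimes>\<^bsub>AutF3\<^esub> h \<otimes>\<^bsub>AutF3\<^esub> inv\<^bsub>AutF3\<^esub> g) (e u) = \<phi> g (\<phi> h (e0 u))" if "h \<in> Lambda" for h u
    using act_mult[OF m_closed[OF g(1) LC[OF that]] inv_closed[OF g(1)] eX] act_mult[OF g(1) LC[OF that] eX0]
    by (simp add: e_def g(1) eX0)
  have inj: "\<phi> g x = \<phi> g y \<longleftrightarrow> x = y" if "x \<in> X" "y \<in> X" for x y
    using isometric[OF g(1) that] by (metis dist_eq_0_iff)
  have trans: "\<exists>a. \<forall>u. \<phi> h (e u) = e (u + a)" if "h \<in> H" for h
    using that e0(4) act unfolding H_eq e_def by (metis (no_types, lifting) imageE)
  have tv: "translation_vectors \<phi> H e = fcc_lattice k"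
  proof -
    have "(\<forall>u. \<phi> (g \<otimes>\<^bsub>AutF3\<^esub> h \<otimes>\<^bsub>AutF3\<^esub> inv\<^bsub>AutF3\<^esub> g) (e u) = e (u + a)) \<longleftrightarrow> (\<forall>u. \<phi> h (e0 u) = e0 (u + a))"
      if "h \<in> Lambda" for h a
      unfolding act[OF that] using inj eX0 act_closed[OF LC[OF that] eX0] by (simp add: e_def)
    then show ?thesis unfolding e0(5)[symmetric] translation_vectors_def H_eq by blast
  qed
  have range: "\<phi> h ` range e = range e" if h: "h \<in> H" for h
  proof -
    obtain a where a: "\<phi> h (e u) = e (u + a)" for u using trans[OF h] by blast
    have "e u = \<phi> h (e (u - a))" for u by (simp add: a)
    then show ?thesis using a by blast
  qed
  show ?thesis
    by (intro exI[of _ e] conjI ballI)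
      (use eX iso trans range discrete_fcc[OF e0(1)] rhombic_dodecahedron_fcc[OF e0(1)] in \<open>auto simp: tv\<close>)
qed

end

theorem theorem1p3:
  fixes X :: "'x::metric_space set"
    and \<phi> :: "(3 letter_word \<Rightarrow> 3 letter_word) \<Rightarrow> 'x \<Rightarrow> 'x"
  assumes "complete X" and "CAT0 X"
    and "group_action AutF3 X \<phi>"
    and "\<forall>g\<in>carrier AutF3. semisimple X (\<phi> g)"
  shows "(\<forall>\<nu>\<in>nielsen_transformations. \<exists>x\<in>X. \<phi> \<nu> x = x) \<or>
    (\<forall>H. nielsen_Z4 H \<longrightarrow>
      (\<exists>e::real^3 \<Rightarrow> 'x. range e \<subseteq> X \<and> (\<forall>u v. dist (e u) (e v) = dist u v) \<and>
        (\<forall>h\<in>H. \<phi> h ` range e = range e) \<and>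
        (\<forall>h\<in>H. \<exists>a. \<forall>u. \<phi> h (e u) = e (u + a)) \<and>
        discrete (translation_vectors \<phi> H e) \<and>
        rhombic_dodecahedron (dirichlet_domain (translation_vectors \<phi> H e))))"
proof -
  have "hadamard_action X AutF3 \<phi>"
    using CAT0_hadamard[OF assms(1,2)] assms(3,4)
    by (auto simp: hadamard_action_def hadamard_action_axioms_def semisimple_def isometry_of_def)
  then interpret nielsen_action X \<phi> by (rule nielsen_action.intro)
  show ?thesis
  proof (cases "len (nielsen_left 2 1) = 0")
    case True
    then show ?thesis using nielsen_fixes_point by blast
  next
    case False
    then have "0 < len (nielsen_left 2 1)" using len_nonneg[of "nielsen_left 2 1"] by simp
    then show ?thesis using hyperbolic_nielsen_Z4_flat by blast
  qed
qed

end
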